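(* Let $T:\Omega\to\Omega$ be a mixing Gibbs–Markov map preserving the probability measure $\mu$, with partition $\{\Omega_j\}$ and constant $\theta\in(0,1)$. Let $v:\Omega\to\mathbb{R}$ be measurable with $\int_\Omega v^2\,d\mu=\infty$, fix $\alpha\in(0,1)\cup(1,2]$, and suppose that as $x\to\infty$, $\mu(v>x)=p\ell(x)x^{-\alpha}(1+o(1))$ and $\mu(v<-x)=q\ell(x)x^{-\alpha}(1+o(1))$ with $\ell$ slowly varying, $p,q>0$, $p+q=1$. Assume $v$ is locally Lipschitz, i.e. $|v|_\theta=\sup_j D_jv<\infty$, and that there is $C>0$ with $D_jv\le C\inf_{y\in\Omega_j}|v(y)|$ for all $j$. Assume $\int_\Omega v\,d\mu=0$ if $\alpha\in(1,2]$. Write $v_n=\sum_{j=0}^{n-1}v\circ T^j$ and assume $(v_n-b_n)/a_n$ converges in distribution to an $\alpha$-stable law, with $a_n,b_n$ as in the context. Let $\delta>0$ be arbitrarily small and set $D(x)=(\log x)\ell(x)x^{-\alpha}$ if $\alpha\in(0,1)$ and $D(x)=x^{-(\alpha-\delta)}$ if $\alpha\in(1,2]$. Let $N=N(n)$ with $N\to\infty$ and $N/a_n\to\infty$. Then as $n\to\infty$: for $\alpha\in(0,1)\cup(1,2)$, \[|\mu(v_n>N)-n\mu(v>N)|=O(D(N))+o(n\ell(N)N^{-\alpha}),\] and similarly for $\mu(v_n<-N)$ versus $n\mu(v<-N)$; for $\alpha=2$, \[|\mu(v_n>N)-n\mu(v>N)|=O(D(N))+O(n\log N\,N^{-2})+O(n\hat\ell(N)N^{-2}),\]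 and similarly for $\mu(v_n\le -N)$.
   Context: Gibbs–Markov map: $(\Omega,\mu)$ a probability space with an at most countable measurable partition $\{\Omega_j\}$, $T$ ergodic and measure-preserving; $s(y,y')$ is the least $n\ge0$ such that $T^ny,T^ny'$ lie in distinct partition elements (assumed $s(y,y')=\infty$ iff $y=y'$), $d_\theta(y,y')=\theta^{s(y,y')}$; $g=d\mu/d(\mu\circ T)$. $T$ is Gibbs–Markov if each $T(\Omega_j)$ is a union of partition elements and $T|_{\Omega_j}$ is a measurable bijection onto $T(\Omega_j)$; $\inf_j\mu(T\Omega_j)>0$; and there are $C>0$, $\theta\in(0,1)$ with $|\log g(y)-\log g(y')|\le Cd_\theta(y,y')$ for $y,y'\in\Omega_j$. $D_jf=\sup_{y\ne y'\in\Omega_j}|f(y)-f(y')|/d_\theta(y,y')$. $\hat\ell(x)=1+\int_1^{1+x}\ell(u)u^{-1}du$. $a_n^\alpha=n\ell(a_n)(1+o(1))$ if $\alpha\in(0,2)$, $a_n^2=n\hat\ell(a_n)(1+o(1))$ if $\alpha=2$; $b_n=0$ if $\alpha\in(0,1)$ and $b_n=n\int v\,d\mu$ if $\alpha\in(1,2]$. *)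

theory Defs
  imports "HOL-Probability.Probability" "HOL-Library.Landau_Symbols"
begin

definition same_part :: "(nat \<Rightarrow> 'a set) \<Rightarrow> nat set \<Rightarrow> 'a \<Rightarrow> 'a \<Rightarrow> bool" where
  "same_part Om J x y \<longleftrightarrow> (\<exists>j\<in>J. x \<in> Om j \<and> y \<in> Om j)"

definition sep_time :: "('a \<Rightarrow> 'a) \<Rightarrow> (nat \<Rightarrow> 'a set) \<Rightarrow> nat set \<Rightarrow> 'a \<Rightarrow> 'a \<Rightarrow> enat" where
  "sep_time T Om J y y' =
     (if \<exists>n. \<not> same_part Om J ((T ^^ n) y) ((T ^^ n) y')
      then enat (LEAST n. \<not> same_part Om J ((T ^^ n) y) ((T ^^ n) y'))
      else \<infinity>)"

definition d_theta :: "real \<Rightarrow> ('a \<Rightarrow> 'a) \<Rightarrow> (nat \<Rightarrow> 'a set) \<Rightarrow> nat set \<Rightarrow> 'a \<Rightarrow> 'a \<Rightarrow> real" where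
  "d_theta \<theta> T Om J y y' = (case sep_time T Om J y y' of enat n \<Rightarrow> \<theta> ^ n | \<infinity> \<Rightarrow> 0)"

definition D_loc :: "real \<Rightarrow> ('a \<Rightarrow> 'a) \<Rightarrow> (nat \<Rightarrow> 'a set) \<Rightarrow> nat set \<Rightarrow> ('a \<Rightarrow> real) \<Rightarrow> nat \<Rightarrow> ereal" where
  "D_loc \<theta> T Om J f j =
     (SUP p \<in> {(y, y'). y \<in> Om j \<and> y' \<in> Om j \<and> y \<noteq> y'}.
        ereal (\<bar>f (fst p) - f (snd p)\<bar> / d_theta \<theta> T Om J (fst p) (snd p)))"

definition is_partition :: "'a measure \<Rightarrow> (nat \<Rightarrow> 'a set) \<Rightarrow> nat set \<Rightarrow> bool" where
  "is_partition M Om J \<longleftrightarrow>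
     (\<forall>j\<in>J. Om j \<in> sets M \<and> Om j \<noteq> {}) \<and> disjoint_family_on Om J \<and> (\<Union>j\<in>J. Om j) = space M"

definition measure_preserving_map :: "'a measure \<Rightarrow> ('a \<Rightarrow> 'a) \<Rightarrow> bool" where
  "measure_preserving_map M T \<longleftrightarrow> T \<in> measurable M M \<and> distr M M T = M"

definition ergodic_map :: "'a measure \<Rightarrow> ('a \<Rightarrow> 'a) \<Rightarrow> bool" where
  "ergodic_map M T \<longleftrightarrow>
     (\<forall>A\<in>sets M. T -` A \<inter> space M = A \<longrightarrow> measure M A = 0 \<or> measure M A = 1)"

definition mixing_map :: "'a measure \<Rightarrow> ('a \<Rightarrow> 'a) \<Rightarrow> bool" where
  "mixing_map M T \<longleftrightarrow>
     (\<forall>A\<in>sets M. \<forall>B\<in>sets M.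
        (\<lambda>n. measure M ((T ^^ n) -` A \<inter> space M \<inter> B)) \<longlonglongrightarrow> measure M A * measure M B)"

text \<open>Gibbs--Markov map with partition {Om j | j \<in> J} and constant theta.
  The function g is (a version of) d mu / d(mu o T): on each partition element,
  mu(T A) = integral over A of 1/g d mu, for measurable A inside that element.\<close>
definition gibbs_markov :: "'a measure \<Rightarrow> ('a \<Rightarrow> 'a) \<Rightarrow> (nat \<Rightarrow> 'a set) \<Rightarrow> nat set \<Rightarrow> real \<Rightarrow> bool" where
  "gibbs_markov M T Om J \<theta> \<longleftrightarrow>
     prob_space M \<and> measure_preserving_map M T \<and> ergodic_map M T \<and>
     is_partition M Om J \<and> 0 < \<theta> \<and> \<theta> < 1 \<and>
     (\<forall>y\<in>space M. \<forall>y'\<in>space M. sep_time T Om J y y' = \<infinity> \<longleftrightarrow> y = y') \<and>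
     (\<forall>j\<in>J. \<exists>K\<subseteq>J. T ` Om j = (\<Union>k\<in>K. Om k)) \<and>
     (\<forall>j\<in>J. inj_on T (Om j) \<and> (\<forall>A\<in>sets M. A \<subseteq> Om j \<longrightarrow> T ` A \<in> sets M)) \<and>
     (\<exists>c>0. \<forall>j\<in>J. measure M (T ` Om j) \<ge> c) \<and>
     (\<exists>g C. g \<in> borel_measurable M \<and> (\<forall>y\<in>space M. g y > 0) \<and>
        (\<forall>j\<in>J. \<forall>A\<in>sets M. A \<subseteq> Om j \<longrightarrow>
            emeasure M (T ` A) = (\<integral>\<^sup>+ y\<in>A. ennreal (1 / g y) \<partial>M)) \<and>
        C > 0 \<and>
        (\<forall>j\<in>J. \<forall>y\<in>Om j. \<forall>y'\<in>Om j.
            \<bar>ln (g y) - ln (g y')\<bar> \<le> C * d_theta \<theta> T Om J y y'))"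

definition slowly_varying :: "(real \<Rightarrow> real) \<Rightarrow> bool" where
  "slowly_varying L \<longleftrightarrow> L \<in> borel_measurable borel \<and> (\<forall>x>0. L x > 0) \<and>
     (\<forall>c>0. ((\<lambda>x. L (c * x) / L x) \<longlongrightarrow> 1) at_top)"

definition ell_hat :: "(real \<Rightarrow> real) \<Rightarrow> real \<Rightarrow> real" where
  "ell_hat L x = 1 + (LBINT u=1..1+x. L u / u)"

text \<open>Non-degenerate alpha-stable law (alpha \<noteq> 1), via its characteristic function
  exp(-sigma^alpha |t|^alpha (1 - i beta sgn(t) tan(pi alpha/2)) + i m t), sigma > 0,
  beta \<in> [-1,1]; for alpha = 2 this is a non-degenerate Gaussian.\<close>
definition stable_law :: "real \<Rightarrow> real measure \<Rightarrow> bool" where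
  "stable_law \<alpha> \<nu> \<longleftrightarrow> real_distribution \<nu> \<and>
     (\<exists>\<sigma>>0. \<exists>\<beta>\<in>{-1..1}. \<exists>m::real. \<forall>t::real.
        char \<nu> t = exp (- complex_of_real (\<sigma> powr \<alpha> * \<bar>t\<bar> powr \<alpha>)
                          * (1 - \<i> * complex_of_real (\<beta> * sgn t * tan (pi * \<alpha> / 2)))
                        + \<i> * complex_of_real (m * t)))"

definition birkhoff_sum :: "('a \<Rightarrow> 'a) \<Rightarrow> ('a \<Rightarrow> real) \<Rightarrow> nat \<Rightarrow> 'a \<Rightarrow> real" where
  "birkhoff_sum T v n y = (\<Sum>j<n. v ((T ^^ j) y))"

end

theory Submission
  imports Defs
begin

text \<open>Bounded distortion and big images make events determined by the first \<open>k\<close> symbols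
  quasi-independent of the future: \<open>\<mu>(A \<inter> T\<^sup>-\<^sup>k B) \<le> K \<mu>(A) \<mu>(B)\<close>, while the Lipschitz bound makes
  \<open>v\<^sub>k\<close> vary by at most \<open>\<kappa>\<close> on a \<open>k\<close>-cylinder. So the classical inequalities for independent sums
  (Ottaviani, Hoffmann-Jorgensen) survive up to constants. Tightness of \<open>v\<^sub>n / a\<^sub>n\<close> makes the maximum
  of \<open>\<bar>v\<^sub>k\<bar>\<close> over \<open>k \<le> n\<close> exceed \<open>R a\<^sub>n\<close> with small probability, and iterating the
  Hoffmann-Jorgensen inequality from that scale gives \<open>\<mu>(max \<bar>v\<^sub>k\<bar> > s) \<le> C n B(s)\<close> for all \<open>s \<ge> R a\<^sub>n\<close>,
  where \<open>B(s)\<close> is the tail of \<open>\<bar>v\<bar>\<close> if \<open>\<alpha> < 2\<close> and the normalised truncated second moment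
  \<open>ell_hat L s / s\<^sup>2\<close> if \<open>\<alpha> = 2\<close>. For \<open>\<alpha> = 2\<close> this is the claim. For \<open>\<alpha> < 2\<close> a large value of \<open>v\<^sub>n\<close> is due
  either to one summand of almost the same size or to two passages over \<open>\<epsilon> N\<close>, and the latter costs
  \<open>O((n B(N))\<^sup>2) = o(n B(N))\<close>. In both cases the
  \<open>O(D(N))\<close> term can be taken to be zero.\<close>

text \<open>Quasi-independence is an upper bound only. It serves for error terms and maximal
  inequalities, whereas the leading term keeps the constant 1 because it comes from stationarity:
  from a union bound above, and from disjointness of the events that the big jump occurs at time i
  below.

  The event \<bar>v_m\<bar> > t is not decided by the first m symbols, so stopping at it does not
  fit the product bound. It is replaced by the union of all m-cylinders that meet it, and \<kappa>
  is the price in the threshold.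

  The Hoffmann-Jorgensen inequality has a quadratic term. With one of its two factors below
  \<open>1 / (2 * K * \<Gamma>^2)\<close> it becomes a contraction for the other, which is why
  smallness of the maximum at scale \<open>R * a n\<close> has to be secured beforehand. This takes
  two facts about \<open>a\<close>. It tends to infinity: for \<alpha> < 2 the defining relation
  alone does not force this, since slow variation says nothing about \<open>L\<close> near 0, and
  mixing has to exclude a bounded subsequence. And \<open>a k\<close> is at most a constant times
  \<open>a n\<close> for k \<le> n, although \<open>a\<close> need not be monotone.\<close>

locale gibbs_markov_map =
  fixes M :: "'a measure" and T :: "'a \<Rightarrow> 'a" and Om :: "nat \<Rightarrow> 'a set" and J :: "nat set"
    and \<theta> :: real
  assumes GM: "gibbs_markov M T Om J \<theta>"
begin

sublocale prob_space M
  using GM by (simp add: gibbs_markov_def)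

section \<open>Partition, cylinders and the separation metric\<close>

lemma T_measurable [measurable]: "T \<in> measurable M M"
  using GM by (simp add: gibbs_markov_def measure_preserving_map_def)

lemma distr_T: "distr M M T = M"
  using GM by (simp add: gibbs_markov_def measure_preserving_map_def)

lemma T_pow_measurable [measurable]: "(T ^^ k) \<in> measurable M M"
  by (induction k) (auto intro: measurable_compose[OF _ T_measurable] simp: comp_def)

lemma T_pow_space: "y \<in> space M \<Longrightarrow> (T ^^ k) y \<in> space M"
  using T_pow_measurable measurable_space by metis

lemma Om_sets [measurable]: "j \<in> J \<Longrightarrow> Om j \<in> sets M"
  using GM by (simp add: gibbs_markov_def is_partition_def)

lemma Om_unique: "i \<in> J \<Longrightarrow> j \<in> J \<Longrightarrow> y \<in> Om i \<Longrightarrow> y \<in> Om j \<Longrightarrow> i = j"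
proof -
  assume a: "i \<in> J" "j \<in> J" "y \<in> Om i" "y \<in> Om j"
  have "disjoint_family_on Om J" using GM by (simp add: gibbs_markov_def is_partition_def)
  with a show "i = j" unfolding disjoint_family_on_def by blast
qed

lemma Om_cover: "y \<in> space M \<Longrightarrow> \<exists>j\<in>J. y \<in> Om j"
proof -
  assume a: "y \<in> space M"
  have "(\<Union>j\<in>J. Om j) = space M" using GM by (simp add: gibbs_markov_def is_partition_def)
  with a show ?thesis by blast
qed

lemma theta: "0 < \<theta>" "\<theta> < 1"
  using GM by (simp_all add: gibbs_markov_def)

lemma image_sets: "j \<in> J \<Longrightarrow> A \<in> sets M \<Longrightarrow> A \<subseteq> Om j \<Longrightarrow> T ` A \<in> sets M"
  using GM by (simp add: gibbs_markov_def)

text \<open>Partition elements are disjoint, so a union of them that meets \<open>Om j\<close>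
  contains it; \<open>T y\<close> is the meeting point.\<close>

lemma markov: "i \<in> J \<Longrightarrow> j \<in> J \<Longrightarrow> y \<in> Om i \<Longrightarrow> T y \<in> Om j \<Longrightarrow> Om j \<subseteq> T ` Om i"
proof -
  assume a: "i \<in> J" "j \<in> J" "y \<in> Om i" "T y \<in> Om j"
  have "\<forall>j\<in>J. \<exists>K\<subseteq>J. T ` Om j = (\<Union>k\<in>K. Om k)"
    using GM unfolding gibbs_markov_def by (elim conjE)
  with a obtain Ks where Ks: "Ks \<subseteq> J" "T ` Om i = (\<Union>k\<in>Ks. Om k)" by blast
  then obtain k where "k \<in> Ks" "T y \<in> Om k" using a by blast
  then have "k = j" using Om_unique a Ks(1) by blast
  then show ?thesis using \<open>k \<in> Ks\<close> Ks(2) by blast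
qed

text \<open>The equivalence relation whose classes are the cylinders of length \<open>k\<close>. As
  a relation it lets the later arguments speak of saturated events without referring to the
  partition.\<close>

definition same_upto :: "nat \<Rightarrow> 'a \<Rightarrow> 'a \<Rightarrow> bool" where
  "same_upto k y y' \<longleftrightarrow> (\<forall>i<k. same_part Om J ((T ^^ i) y) ((T ^^ i) y'))"

lemma same_part_trans: "same_part Om J x y \<Longrightarrow> same_part Om J y z \<Longrightarrow> same_part Om J x z"
  unfolding same_part_def using Om_unique by blast

lemma same_upto_trans: "same_upto k x y \<Longrightarrow> same_upto k y z \<Longrightarrow> same_upto k x z"
  unfolding same_upto_def using same_part_trans by blast

lemma same_upto_sym: "same_upto k x y \<Longrightarrow> same_upto k y x"
  unfolding same_upto_def same_part_def by blast

lemma same_upto_refl: "x \<in> space M \<Longrightarrow> same_upto k x x"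
  unfolding same_upto_def same_part_def using Om_cover T_pow_space by blast

lemma same_upto_mono: "same_upto k x y \<Longrightarrow> i \<le> k \<Longrightarrow> same_upto i x y"
  unfolding same_upto_def by auto

lemma same_upto_shift: "same_upto k x y \<Longrightarrow> i \<le> k \<Longrightarrow> same_upto (k - i) ((T ^^ i) x) ((T ^^ i) y)"
  unfolding same_upto_def by (auto simp flip: comp_apply[of "T ^^ _" "T ^^ _"] funpow_add)

lemma d_theta_le:
  assumes "same_upto k y y'"
  shows "d_theta \<theta> T Om J y y' \<le> \<theta> ^ k"
proof (cases "sep_time T Om J y y'")
  case (enat n)
  then have ex: "\<exists>n. \<not> same_part Om J ((T ^^ n) y) ((T ^^ n) y')"
    by (auto simp: sep_time_def split: if_splits)
  then have n: "n = (LEAST n. \<not> same_part Om J ((T ^^ n) y) ((T ^^ n) y'))"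
    using enat by (auto simp: sep_time_def)
  have "\<not> same_part Om J ((T ^^ n) y) ((T ^^ n) y')"
    using LeastI_ex[OF ex] unfolding n .
  then have "k \<le> n" using assms unfolding same_upto_def using not_le by blast
  then show ?thesis using enat theta by (simp add: d_theta_def power_decreasing)
next
  case infinity
  then show ?thesis using theta by (simp add: d_theta_def)
qed

lemma d_theta_pos:
  assumes "y \<in> space M" "y' \<in> space M" "y \<noteq> y'"
  shows "0 < d_theta \<theta> T Om J y y'"
proof -
  have "sep_time T Om J y y' = \<infinity> \<longleftrightarrow> y = y'" using GM assms by (simp add: gibbs_markov_def)
  then have "sep_time T Om J y y' \<noteq> \<infinity>" using assms by blast
  then show ?thesis using theta by (auto simp: d_theta_def)
qed

section \<open>Bounded distortion\<close>

text \<open>Both sets lie in one cylinder of length \<open>Suc k\<close>, where the Jacobian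
  \<open>1 / g\<close> differs from its value at a base point by at most a factor
  \<open>exp (C * \<theta> ^ k)\<close>, and that value cancels in the comparison. Products instead
  of quotients keep the estimate meaningful for null sets. The last clause, nonsingularity of
  \<open>T\<close> on a cylinder, permits a cancellation when the bound is iterated.\<close>

lemma one_step_distortion:
  obtains C where "C > 0" 
    "\<And>k A A'. A \<in> sets M \<Longrightarrow> A' \<in> sets M \<Longrightarrow> (\<And>x y. x \<in> A \<union> A' \<Longrightarrow> y \<in> A \<union> A' \<Longrightarrow> same_upto (Suc k) x y) \<Longrightarrow>
      measure M (T ` A) * measure M A' \<le> exp (C * \<theta> ^ k) * measure M (T ` A') * measure M A"
    "\<And>k A. A \<in> sets M \<Longrightarrow> (\<And>x y. x \<in> A \<Longrightarrow> y \<in> A \<Longrightarrow> same_upto (Suc k) x y) \<Longrightarrow>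
      measure M (T ` A) = 0 \<longleftrightarrow> measure M A = 0"
proof -
  obtain g C where g [measurable]: "g \<in> borel_measurable M" and g_pos: "\<And>y. y \<in> space M \<Longrightarrow> g y > 0"
    and jac: "\<And>j A. j \<in> J \<Longrightarrow> A \<in> sets M \<Longrightarrow> A \<subseteq> Om j \<Longrightarrow>
            emeasure M (T ` A) = (\<integral>\<^sup>+ y\<in>A. ennreal (1 / g y) \<partial>M)"
    and C: "C > 0"
    and lng: "\<And>j y y'. j \<in> J \<Longrightarrow> y \<in> Om j \<Longrightarrow> y' \<in> Om j \<Longrightarrow> \<bar>ln (g y) - ln (g y')\<bar> \<le> C * d_theta \<theta> T Om J y y'"
  proof -
    have "\<exists>g C. g \<in> borel_measurable M \<and> (\<forall>y\<in>space M. g y > 0) \<and>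
        (\<forall>j\<in>J. \<forall>A\<in>sets M. A \<subseteq> Om j \<longrightarrow>
            emeasure M (T ` A) = (\<integral>\<^sup>+ y\<in>A. ennreal (1 / g y) \<partial>M)) \<and>
        C > 0 \<and>
        (\<forall>j\<in>J. \<forall>y\<in>Om j. \<forall>y'\<in>Om j.
            \<bar>ln (g y) - ln (g y')\<bar> \<le> C * d_theta \<theta> T Om J y y')"
      using GM unfolding gibbs_markov_def by (elim conjE)
    then show ?thesis using that by (elim exE conjE) simp
  qed
  have in_Om: "\<exists>j\<in>J. U \<subseteq> Om j" 
    if U: "U \<subseteq> space M" "U \<noteq> {}" "\<And>x y. x \<in> U \<Longrightarrow> y \<in> U \<Longrightarrow> same_upto (Suc k) x y" for U k
  proof -
    obtain x where x: "x \<in> U" using U by blast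
    obtain j where j: "j \<in> J" "x \<in> Om j" using Om_cover x U(1) by blast
    have "y \<in> Om j" if "y \<in> U" for y
    proof -
      have "same_upto (Suc k) x y" using U(3)[OF x that] .
      then have "same_part Om J x y" unfolding same_upto_def by auto
      then show ?thesis unfolding same_part_def using Om_unique j by blast
    qed
    then show ?thesis using j by blast
  qed
  \<comment> \<open>The Jacobian is compared with its value at a base point of the cylinder.\<close>
  have bounds: "exp (- (C * \<theta> ^ k)) / g x * measure M A \<le> measure M (T ` A) \<and>
     measure M (T ` A) \<le> exp (C * \<theta> ^ k) / g x * measure M A"
    if A: "A \<in> sets M" and U: "A \<subseteq> U" "U \<subseteq> space M" "x \<in> U" "\<And>x y. x \<in> U \<Longrightarrow> y \<in> U \<Longrightarrow> same_upto (Suc k) x y"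
    for A U x k
  proof -
    have "U \<noteq> {}" using U(3) by blast
    then obtain j where j: "j \<in> J" "U \<subseteq> Om j" using in_Om[of U k] U(2,4) by blast
    have gx: "g x > 0" using g_pos U by blast
    have pt: "exp (- (C * \<theta> ^ k)) / g x \<le> 1 / g y \<and> 1 / g y \<le> exp (C * \<theta> ^ k) / g x" if "y \<in> A" for y
    proof -
      have gy: "g y > 0" using g_pos U that by blast
      have "d_theta \<theta> T Om J x y \<le> \<theta> ^ Suc k" using d_theta_le U(3,4) U(1) that by blast
      also have "\<dots> \<le> \<theta> ^ k" using theta by (simp add: mult_left_le_one_le)
      finally have "d_theta \<theta> T Om J x y \<le> \<theta> ^ k" .
      then have l: "\<bar>ln (g x) - ln (g y)\<bar> \<le> C * \<theta> ^ k"
      proof -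
        have "x \<in> Om j" "y \<in> Om j" using U that j by blast+
        then have "\<bar>ln (g x) - ln (g y)\<bar> \<le> C * d_theta \<theta> T Om J x y" using lng j by blast
        also have "\<dots> \<le> C * \<theta> ^ k" using \<open>d_theta \<theta> T Om J x y \<le> \<theta> ^ k\<close> C by (intro mult_left_mono) auto
        finally show ?thesis .
      qed
      have gy_eq: "1 / g y = exp (ln (g x) - ln (g y)) / g x"
        using gx gy by (simp add: exp_diff)
      show ?thesis unfolding gy_eq using l gx by (intro conjI divide_right_mono) auto
    qed
    have jacA: "emeasure M (T ` A) = (\<integral>\<^sup>+ y\<in>A. ennreal (1 / g y) \<partial>M)"
      using jac j A U by blast
    have "ennreal (exp (- (C * \<theta> ^ k)) / g x * measure M A) = (\<integral>\<^sup>+ y\<in>A. ennreal (exp (- (C * \<theta> ^ k)) / g x) \<partial>M)"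
      using A gx by (subst nn_integral_cmult_indicator) (auto simp: emeasure_eq_measure simp flip: ennreal_mult)
    also have "\<dots> \<le> (\<integral>\<^sup>+ y\<in>A. ennreal (1 / g y) \<partial>M)"
      by (rule nn_integral_mono) (auto split: split_indicator intro!: ennreal_leI pt[THEN conjunct1])
    also have "\<dots> = ennreal (measure M (T ` A))" using jacA by (simp add: emeasure_eq_measure)
    finally have 1: "exp (- (C * \<theta> ^ k)) / g x * measure M A \<le> measure M (T ` A)"
      by (subst (asm) ennreal_le_iff) auto
    have "ennreal (measure M (T ` A)) = (\<integral>\<^sup>+ y\<in>A. ennreal (1 / g y) \<partial>M)" 
      using jacA by (simp add: emeasure_eq_measure)
    also have "\<dots> \<le> (\<integral>\<^sup>+ y\<in>A. ennreal (exp (C * \<theta> ^ k) / g x) \<partial>M)"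
      by (rule nn_integral_mono) (auto split: split_indicator intro!: ennreal_leI pt[THEN conjunct2])
    also have "\<dots> = ennreal (exp (C * \<theta> ^ k) / g x * measure M A)"
      using A gx by (subst nn_integral_cmult_indicator) (auto simp: emeasure_eq_measure simp flip: ennreal_mult)
    finally have 2: "measure M (T ` A) \<le> exp (C * \<theta> ^ k) / g x * measure M A"
      using gx by (subst (asm) ennreal_le_iff) auto
    show ?thesis using 1 2 by blast
  qed
  show ?thesis
  \<comment> \<open>\<open>A\<close> and \<open>A'\<close> are each compared with the base point,
    which doubles the exponent.\<close>
  proof (rule that[of "2 * C"])
    show "2 * C > 0" using C by simp
  next
    fix k A A'
    assume A: "A \<in> sets M" "A' \<in> sets M" and s: "\<And>x y. x \<in> A \<union> A' \<Longrightarrow> y \<in> A \<union> A' \<Longrightarrow> same_upto (Suc k) x y"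
    show "measure M (T ` A) * measure M A' \<le> exp (2 * C * \<theta> ^ k) * measure M (T ` A') * measure M A"
    proof (cases "A \<union> A' = {}")
      case True then show ?thesis by auto
    next
      case False
      then obtain x where x: "x \<in> A \<union> A'" by blast
      have sub: "A \<union> A' \<subseteq> space M" using A sets.sets_into_space by auto
      have gx: "g x > 0" using g_pos sub x by blast
      have b1: "measure M (T ` A) \<le> exp (C * \<theta> ^ k) / g x * measure M A"
        using bounds[of A "A \<union> A'" x k] A sub x s by blast
      have b2: "exp (- (C * \<theta> ^ k)) / g x * measure M A' \<le> measure M (T ` A')"
        using bounds[of A' "A \<union> A'" x k] A sub x s by blast
      have "measure M (T ` A) * measure M A' \<le> (exp (C * \<theta> ^ k) / g x * measure M A) * measure M A'"
        using b1 by (intro mult_right_mono) auto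
      also have "\<dots> = exp (2 * C * \<theta> ^ k) * (exp (- (C * \<theta> ^ k)) / g x * measure M A') * measure M A"
        by (simp add: algebra_simps exp_minus flip: exp_add) (simp add: mult_exp_exp field_simps)
      also have "\<dots> \<le> exp (2 * C * \<theta> ^ k) * measure M (T ` A') * measure M A"
        using b2 by (intro mult_right_mono mult_left_mono) auto
      finally show ?thesis .
    qed
  next
    fix k A
    assume A: "A \<in> sets M" and s: "\<And>x y. x \<in> A \<Longrightarrow> y \<in> A \<Longrightarrow> same_upto (Suc k) x y"
    show "measure M (T ` A) = 0 \<longleftrightarrow> measure M A = 0"
    proof (cases "A = {}")
      case False
      then obtain x where x: "x \<in> A" by blast
      have sub: "A \<subseteq> space M" using A sets.sets_into_space by auto
      have gx: "g x > 0" using g_pos sub x by blast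
      have "exp (- (C * \<theta> ^ k)) / g x * measure M A \<le> measure M (T ` A) \<and>
          measure M (T ` A) \<le> exp (C * \<theta> ^ k) / g x * measure M A"
        using bounds[of A A x k] A sub x s by blast
      moreover have "exp (- (C * \<theta> ^ k)) / g x > 0" using gx by simp
      ultimately show ?thesis
        by (metis measure_nonneg mult_zero_right order_antisym zero_less_mult_iff linorder_not_le measure_le_0_iff)
    qed auto
  qed
qed

text \<open>\<open>T\<close> sends measurable parts of a partition element to measurable sets, and
  the image of a set inside a cylinder of length \<open>Suc k\<close> lies inside a cylinder of
  length \<open>k\<close>, so the argument repeats.\<close>

lemma image_pow_sets:
  "A \<in> sets M \<Longrightarrow> (\<And>x y. x \<in> A \<Longrightarrow> y \<in> A \<Longrightarrow> same_upto k x y) \<Longrightarrow> (T ^^ k) ` A \<in> sets M"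
proof (induction k arbitrary: A)
  case (Suc k)
  show ?case
  proof (cases "A = {}")
    case False
    then obtain x where x: "x \<in> A" by blast
    obtain j where j: "j \<in> J" "x \<in> Om j" using Om_cover x Suc(2) sets.sets_into_space by blast
    have "A \<subseteq> Om j"
    proof
      fix y assume "y \<in> A"
      then have "same_upto (Suc k) x y" using Suc(3) x by blast
      then have "same_part Om J x y" unfolding same_upto_def by auto
      then show "y \<in> Om j" unfolding same_part_def using Om_unique j by blast
    qed
    then have "T ` A \<in> sets M" using image_sets j Suc(2) by blast
    moreover have "same_upto k x y" if xy: "x \<in> T ` A" "y \<in> T ` A" for x y
      using same_upto_shift[of "Suc k" _ _ 1] Suc(3) xy by auto
    ultimately have "(T ^^ k) ` (T ` A) \<in> sets M" using Suc(1) by blast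
    then show ?thesis by (simp add: image_image funpow_swap1 comp_def)
  qed auto
qed auto

text \<open>Applying the one-step bound to the pair and induction to its images, the exponents add
  up to \<open>C\<close> times a geometric sum; hence one constant serves all
  \<open>k\<close>.\<close>

lemma distortion:
  obtains E where "E > 0"
    "\<And>k A A'. A \<in> sets M \<Longrightarrow> A' \<in> sets M \<Longrightarrow> (\<And>x y. x \<in> A \<union> A' \<Longrightarrow> y \<in> A \<union> A' \<Longrightarrow> same_upto k x y) \<Longrightarrow>
      measure M ((T ^^ k) ` A) * measure M A' \<le> E * measure M ((T ^^ k) ` A') * measure M A"
proof -
  obtain C where C: "C > 0" 
    and step: "\<And>k A A'. A \<in> sets M \<Longrightarrow> A' \<in> sets M \<Longrightarrow> (\<And>x y. x \<in> A \<union> A' \<Longrightarrow> y \<in> A \<union> A' \<Longrightarrow> same_upto (Suc k) x y) \<Longrightarrow>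
      measure M (T ` A) * measure M A' \<le> exp (C * \<theta> ^ k) * measure M (T ` A') * measure M A"
    and null: "\<And>k A. A \<in> sets M \<Longrightarrow> (\<And>x y. x \<in> A \<Longrightarrow> y \<in> A \<Longrightarrow> same_upto (Suc k) x y) \<Longrightarrow>
      measure M (T ` A) = 0 \<longleftrightarrow> measure M A = 0"
    using one_step_distortion by blast
  have main: "measure M ((T ^^ k) ` A) * measure M A' \<le> exp (C * (\<Sum>i<k. \<theta> ^ i)) * measure M ((T ^^ k) ` A') * measure M A"
    if "A \<in> sets M" "A' \<in> sets M" "(\<And>x y. x \<in> A \<union> A' \<Longrightarrow> y \<in> A \<union> A' \<Longrightarrow> same_upto k x y)" for k A A'
    using that
  proof (induction k arbitrary: A A')
    case (Suc k)
    have sets: "T ` A \<in> sets M" "T ` A' \<in> sets M"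
      using image_pow_sets[of _ 1] Suc.prems same_upto_mono[of "Suc k" _ _ 1] by auto
    have eq: "(T ^^ Suc k) ` X = (T ^^ k) ` (T ` X)" for X
      by (simp add: image_image funpow_swap1 comp_def)
    have same: "same_upto k x y" if xy: "x \<in> T ` A \<union> T ` A'" "y \<in> T ` A \<union> T ` A'" for x y
      using same_upto_shift[of "Suc k" _ _ 1] Suc.prems(3) xy by auto
    define e where "e = exp (C * (\<Sum>i<k. \<theta> ^ i))"
    have IH: "measure M ((T ^^ k) ` (T ` A)) * measure M (T ` A') \<le> e * measure M ((T ^^ k) ` (T ` A')) * measure M (T ` A)"
      unfolding e_def by (rule Suc.IH[OF sets same])
    have st: "measure M (T ` A) * measure M A' \<le> exp (C * \<theta> ^ k) * measure M (T ` A') * measure M A"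
      using step Suc.prems by blast
    show ?case
    proof (cases "measure M A' = 0")
      case False
      \<comment> \<open>The induction hypothesis carries the measure of the image of
        \<open>A'\<close> as a factor; nonsingularity makes it positive, so it can be divided
        out.\<close>
      have nz: "measure M (T ` A') > 0"
        using null[of A' k] False Suc.prems by (metis UnCI measure_nonneg order_le_less)
      have "measure M ((T ^^ k) ` (T ` A)) * measure M A' * measure M (T ` A')
          \<le> e * measure M ((T ^^ k) ` (T ` A')) * (measure M (T ` A) * measure M A')"
        using mult_right_mono[OF IH, of "measure M A'"] by (simp add: mult_ac)
      also have "\<dots> \<le> e * measure M ((T ^^ k) ` (T ` A')) * (exp (C * \<theta> ^ k) * measure M (T ` A') * measure M A)"
        by (intro mult_left_mono st) (auto simp: e_def)
      finally have "measure M ((T ^^ k) ` (T ` A)) * measure M A' \<le> 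
          e * exp (C * \<theta> ^ k) * measure M ((T ^^ k) ` (T ` A')) * measure M A"
        using nz by (simp add: mult_ac)
      then show ?thesis unfolding eq by (simp add: e_def distrib_left exp_add)
    qed auto
  qed auto
  have sum_le: "(\<Sum>i<k. \<theta> ^ i) \<le> 1 / (1 - \<theta>)" for k
    using sum_le_suminf[of "\<lambda>i. \<theta> ^ i" "{..<k}"] theta by (simp add: summable_geometric suminf_geometric)
  show ?thesis
  proof (rule that[of "exp (C * (1 / (1 - \<theta>)))"], simp, goal_cases)
    case (1 k A A')
    have "measure M ((T ^^ k) ` A) * measure M A' \<le> exp (C * (\<Sum>i<k. \<theta> ^ i)) * measure M ((T ^^ k) ` A') * measure M A"
      by (rule main[OF 1])
    also have "\<dots> \<le> exp (C * (1 / (1 - \<theta>))) * measure M ((T ^^ k) ` A') * measure M A"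
      using sum_le[of k] C by (intro mult_right_mono iffD2[OF exp_le_cancel_iff] mult_left_mono) auto
    finally show ?case by simp
  qed
qed

section \<open>Cylinders of words, big images, quasi-independence and oscillation\<close>

text \<open>Words are lists of natural numbers, so there are only countably many cylinders and
  measures can be summed over them.\<close>

definition word_cylinder :: "nat list \<Rightarrow> 'a set" where
  "word_cylinder w = {y \<in> space M. \<forall>i<length w. (T ^^ i) y \<in> Om (w ! i)}"

lemma word_cylinder_sets: "set w \<subseteq> J \<Longrightarrow> word_cylinder w \<in> sets M"
proof -
  assume w: "set w \<subseteq> J"
  have "(T ^^ i) -` Om (w ! i) \<inter> space M \<in> sets M" if "i < length w" for i
    using w that by (intro measurable_sets[OF T_pow_measurable]) (auto simp: Om_sets subset_eq)
  then have "(\<Inter>i\<in>{..<length w}. (T ^^ i) -` Om (w ! i) \<inter> space M) \<inter> space M \<in> sets M"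
    by (cases "w = []") (auto intro!: sets.Int[OF sets.finite_INT] simp del: INT_simps)
  also have "(\<Inter>i\<in>{..<length w}. (T ^^ i) -` Om (w ! i) \<inter> space M) \<inter> space M = word_cylinder w"
    unfolding word_cylinder_def by auto
  finally show ?thesis .
qed

lemma word_cylinder_same:
  "set w \<subseteq> J \<Longrightarrow> x \<in> word_cylinder w \<Longrightarrow> y \<in> word_cylinder w \<Longrightarrow> same_upto (length w) x y"
  unfolding word_cylinder_def same_upto_def same_part_def by (auto simp: subset_eq)

lemma word_cylinder_cover:
  assumes "y \<in> space M"
  obtains w where "length w = k" "set w \<subseteq> J" "y \<in> word_cylinder w"
proof -
  have "\<forall>i. \<exists>j. j \<in> J \<and> (T ^^ i) y \<in> Om j" using Om_cover T_pow_space assms by blast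
  then obtain f where f: "\<And>i. f i \<in> J \<and> (T ^^ i) y \<in> Om (f i)" by metis
  show ?thesis by (rule that[of "map f [0..<k]"]) (use f assms in \<open>auto simp: word_cylinder_def\<close>)
qed

text \<open>The point \<open>y\<close> certifies that every transition in the word is admissible. A
  point of the last element is then pulled back one symbol at a time by
  \<open>markov\<close>.\<close>

lemma word_cylinder_image:
  assumes "set w \<subseteq> J" "y \<in> word_cylinder w" "length w = Suc k"
  shows "Om (w ! k) \<subseteq> (T ^^ k) ` word_cylinder w"
  using assms
proof (induction k arbitrary: w)
  case 0
  have "Om (w ! 0) \<subseteq> space M" using 0 Om_sets sets.sets_into_space by (metis lessI nth_mem subsetD)
  then show ?case using 0 by (auto simp: word_cylinder_def)
next
  case (Suc k)
  define u where "u = take (Suc k) w"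
  have len: "length u = Suc k" using Suc.prems u_def by simp
  have nth: "u ! i = w ! i" if "i \<le> k" for i using that by (simp add: u_def)
  have IH: "Om (u ! k) \<subseteq> (T ^^ k) ` word_cylinder u"
  proof (rule Suc.IH)
    show "set u \<subseteq> J" using Suc.prems set_take_subset unfolding u_def by fast
    show "y \<in> word_cylinder u" using Suc.prems len by (auto simp: word_cylinder_def nth)
  qed (rule len)
  have J: "w ! k \<in> J" "w ! Suc k \<in> J" using Suc.prems by (auto simp: subset_eq)
  have y: "(T ^^ k) y \<in> Om (w ! k)" "T ((T ^^ k) y) \<in> Om (w ! Suc k)"
    using Suc.prems by (auto simp: word_cylinder_def dest: spec[of _ k] spec[of _ "Suc k"])
  show ?case
  proof
    fix z assume z: "z \<in> Om (w ! Suc k)"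
    then obtain t where t: "t \<in> Om (w ! k)" "z = T t" using markov[OF J y] by blast
    then obtain s where s: "s \<in> word_cylinder u" "t = (T ^^ k) s" using IH nth by auto
    have "(T ^^ i) s \<in> Om (w ! i)" if "i < Suc (Suc k)" for i
    proof (cases "i = Suc k")
      case True then show ?thesis using s t z by simp
    next
      case False then show ?thesis using s that len nth by (auto simp: word_cylinder_def)
    qed
    then have "s \<in> word_cylinder w" using s Suc.prems by (auto simp: word_cylinder_def)
    then show "z \<in> (T ^^ Suc k) ` word_cylinder w" using s t by auto
  qed
qed

text \<open>After all steps but one the image contains a whole partition element, and the last step
  is covered by the lower bound for images of partition elements.\<close>

lemma word_cylinder_big_image:
  obtains c where "c > 0" 
    "\<And>w y. set w \<subseteq> J \<Longrightarrow> y \<in> word_cylinder w \<Longrightarrow> measure M ((T ^^ length w) ` word_cylinder w) \<ge> c"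
proof -
  obtain c where c: "c > 0" "\<And>j. j \<in> J \<Longrightarrow> measure M (T ` Om j) \<ge> c"
  proof -
    have "\<exists>c>0. \<forall>j\<in>J. measure M (T ` Om j) \<ge> c"
      using GM unfolding gibbs_markov_def by (elim conjE)
    then show ?thesis using that by blast
  qed
  show ?thesis
  \<comment> \<open>The \<open>1\<close> is for the empty word, whose cylinder is the whole
    space.\<close>
  proof (rule that[of "min c 1"])
    fix w y assume w: "set w \<subseteq> J" "y \<in> word_cylinder w"
    show "measure M ((T ^^ length w) ` word_cylinder w) \<ge> min c 1"
    proof (cases "length w")
      case 0
      then show ?thesis by (auto simp: word_cylinder_def prob_space)
    next
      case (Suc k)
      have j: "w ! k \<in> J" using w Suc by (auto simp: subset_eq)
      have "c \<le> measure M (T ` Om (w ! k))" using c j by blast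
      also have "\<dots> \<le> measure M ((T ^^ length w) ` word_cylinder w)"
      proof (rule finite_measure_mono)
        show "T ` Om (w ! k) \<subseteq> (T ^^ length w) ` word_cylinder w"
          unfolding Suc using image_mono[OF word_cylinder_image[OF w Suc], of T] by (simp add: image_comp)
        show "(T ^^ length w) ` word_cylinder w \<in> events"
          by (rule image_pow_sets[OF word_cylinder_sets[OF w(1)] word_cylinder_same[OF w(1)]])
      qed
      finally show ?thesis by simp
    qed
  qed (use c in auto)
qed

text \<open>For a single cylinder, distortion compares the part that \<open>T ^^ k\<close> sends
  into \<open>B\<close> with the whole cylinder, and the big image bounds the ratio of the image
  measures by a constant times the measure of \<open>B\<close>. A saturated set is a countable
  disjoint union of cylinders, over which the bound is summed. This also yields its measurability,
  which is therefore part of the conclusion.\<close>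

lemma quasi_independence:
  obtains K where "K > 0"
    "\<And>k A B. A \<subseteq> space M \<Longrightarrow> (\<And>y y'. y \<in> A \<Longrightarrow> y' \<in> space M \<Longrightarrow> same_upto k y y' \<Longrightarrow> y' \<in> A) \<Longrightarrow> B \<in> sets M \<Longrightarrow>
       A \<in> sets M \<and> measure M (A \<inter> (T ^^ k) -` B) \<le> K * measure M A * measure M B"
proof -
  obtain E where E: "E > 0"
    and dist: "\<And>k A A'. A \<in> sets M \<Longrightarrow> A' \<in> sets M \<Longrightarrow> (\<And>x y. x \<in> A \<union> A' \<Longrightarrow> y \<in> A \<union> A' \<Longrightarrow> same_upto k x y) \<Longrightarrow>
      measure M ((T ^^ k) ` A) * measure M A' \<le> E * measure M ((T ^^ k) ` A') * measure M A"
    using distortion by blast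
  obtain c where c: "c > 0" 
    and big: "\<And>w y. set w \<subseteq> J \<Longrightarrow> y \<in> word_cylinder w \<Longrightarrow> measure M ((T ^^ length w) ` word_cylinder w) \<ge> c"
    using word_cylinder_big_image by blast
  have cyl: "measure M (word_cylinder w \<inter> (T ^^ length w) -` B) \<le> E / c * measure M (word_cylinder w) * measure M B"
    if w: "set w \<subseteq> J" "y \<in> word_cylinder w" and B: "B \<in> sets M" for w y B
  proof -
    let ?C = "word_cylinder w" and ?k = "length w"
    have C: "?C \<in> sets M" using word_cylinder_sets w by blast
    have "?C \<inter> (T ^^ ?k) -` B = ?C \<inter> ((T ^^ ?k) -` B \<inter> space M)" using C sets.sets_into_space by blast
    then have CB: "?C \<inter> (T ^^ ?k) -` B \<in> sets M" using C B T_pow_measurable by (metis measurable_sets sets.Int)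
    have "c * measure M (?C \<inter> (T ^^ ?k) -` B) \<le> measure M ((T ^^ ?k) ` ?C) * measure M (?C \<inter> (T ^^ ?k) -` B)"
      using big[OF w] by (intro mult_right_mono) auto
    also have "\<dots> \<le> E * measure M ((T ^^ ?k) ` (?C \<inter> (T ^^ ?k) -` B)) * measure M ?C"
      by (rule dist[OF C CB]) (use word_cylinder_same w in blast)
    also have "\<dots> \<le> E * measure M B * measure M ?C"
      using E B by (intro mult_right_mono mult_left_mono finite_measure_mono) auto
    finally show ?thesis using c by (simp add: field_simps)
  qed
  show ?thesis
  proof (rule that[of "E / c"], goal_cases)
    case 1 show ?case using E c by simp
  next
    case (2 k A B)
    \<comment> \<open>Saturation makes every cylinder that meets \<open>A\<close> a subset of
      \<open>A\<close>, and the common point is the witness of non-emptiness that the big-image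
      bound asks for.\<close>
    define W where "W = {w. length w = k \<and> set w \<subseteq> J \<and> word_cylinder w \<inter> A \<noteq> {}}"
    have sub: "word_cylinder w \<subseteq> A" if "w \<in> W" for w
    proof
      fix y assume y: "y \<in> word_cylinder w"
      obtain x where x: "x \<in> word_cylinder w" "x \<in> A" using \<open>w \<in> W\<close> unfolding W_def by blast
      have "same_upto k x y" using word_cylinder_same[of w x y] that x y by (auto simp: W_def)
      then show "y \<in> A" using 2(2) x y by (auto simp: word_cylinder_def)
    qed
    have A_eq: "A = (\<Union>w\<in>W. word_cylinder w)"
    proof
      show "A \<subseteq> (\<Union>w\<in>W. word_cylinder w)"
      proof
        fix y assume y: "y \<in> A"
        then obtain w where "length w = k" "set w \<subseteq> J" "y \<in> word_cylinder w"
          using word_cylinder_cover 2(1) by blast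
        then show "y \<in> (\<Union>w\<in>W. word_cylinder w)" using y unfolding W_def by blast
      qed
    qed (use sub in blast)
    have cW: "countable W" by (rule countableI_type)
    have setsW: "word_cylinder w \<in> sets M" if "w \<in> W" for w
      using that word_cylinder_sets unfolding W_def by blast
    have A: "A \<in> sets M" using sets.countable_UN'[of W word_cylinder M] cW setsW A_eq by simp
    have disj: "disjoint_family_on word_cylinder W"
      unfolding disjoint_family_on_def
    proof (intro ballI impI)
      fix u w assume uw: "u \<in> W" "w \<in> W" "u \<noteq> w"
      have len: "length u = k" "length w = k" "set u \<subseteq> J" "set w \<subseteq> J" using uw(1,2) unfolding W_def by simp_all
      then obtain i where i: "i < k" "u ! i \<noteq> w ! i" using uw(3) nth_equalityI[of u w] by auto
      from len have J: "u ! i \<in> J" "w ! i \<in> J"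
        using i nth_mem[of i u] nth_mem[of i w] by (simp_all add: subsetD)
      have False if y: "y \<in> word_cylinder u" "y \<in> word_cylinder w" for y
        using Om_unique[OF J, of "(T ^^ i) y"] i y len by (auto simp: word_cylinder_def)
      then show "word_cylinder u \<inter> word_cylinder w = {}" by blast
    qed
    let ?P = "(T ^^ k) -` B"
    have cap: "word_cylinder w \<inter> ?P \<in> sets M" if "w \<in> W" for w
    proof -
      have "word_cylinder w \<inter> ?P = word_cylinder w \<inter> (?P \<inter> space M)" 
        using setsW[OF that] sets.sets_into_space by blast
      then show ?thesis using setsW[OF that] 2(3) T_pow_measurable by (metis measurable_sets sets.Int)
    qed
    have "ennreal (measure M (A \<inter> ?P)) = emeasure M (\<Union>w\<in>W. word_cylinder w \<inter> ?P)"
    proof -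
      have "A \<inter> ?P = (\<Union>w\<in>W. word_cylinder w \<inter> ?P)" by (subst A_eq) blast
      then show ?thesis by (simp only: emeasure_eq_measure)
    qed
    also have "\<dots> = (\<integral>\<^sup>+w. emeasure M (word_cylinder w \<inter> ?P) \<partial>count_space W)"
    proof (intro emeasure_UN_countable)
      show "disjoint_family_on (\<lambda>w. word_cylinder w \<inter> ?P) W"
        using disj unfolding disjoint_family_on_def by fast
    qed (use cap cW in auto)
    also have "\<dots> \<le> (\<integral>\<^sup>+w. ennreal (E / c * measure M B) * emeasure M (word_cylinder w) \<partial>count_space W)"
    proof (rule nn_integral_mono)
      fix w assume "w \<in> space (count_space W)"
      then have w: "w \<in> W" by simp
      then obtain y where "y \<in> word_cylinder w" by (auto simp: W_def)
      then have "measure M (word_cylinder w \<inter> ?P) \<le> E / c * measure M (word_cylinder w) * measure M B"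
        using cyl[of w y B] w 2(3) by (simp add: W_def)
      then show "emeasure M (word_cylinder w \<inter> ?P) \<le> ennreal (E / c * measure M B) * emeasure M (word_cylinder w)"
        using E c by (simp add: emeasure_eq_measure mult_ac flip: ennreal_mult)
    qed
    also have "\<dots> = ennreal (E / c * measure M B) * (\<integral>\<^sup>+w. emeasure M (word_cylinder w) \<partial>count_space W)"
      by (rule nn_integral_cmult) auto
    also have "(\<integral>\<^sup>+w. emeasure M (word_cylinder w) \<partial>count_space W) = emeasure M A"
      using emeasure_UN_countable[of W word_cylinder M] setsW cW disj A_eq by simp
    also have "ennreal (E / c * measure M B) * emeasure M A = ennreal (E / c * measure M A * measure M B)"
      using E c by (simp add: emeasure_eq_measure mult_ac flip: ennreal_mult)
    finally have "measure M (A \<inter> ?P) \<le> E / c * measure M A * measure M B"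
      using E c by (subst (asm) ennreal_le_iff) auto
    then show ?case using A by blast
  qed
qed

text \<open>Points sharing \<open>k\<close> symbols still share \<open>k - i\<close> of them after
  \<open>i\<close> steps, so the differences of the summands are dominated by a geometric sequence
  read backwards from the last one. Its sum does not depend on \<open>k\<close>.\<close>

lemma lipschitz_oscillation:
  assumes "(SUP j\<in>J. D_loc \<theta> T Om J v j) < \<infinity>"
  obtains \<kappa> where "\<kappa> > 0"
    "\<And>k i y y'. y \<in> space M \<Longrightarrow> y' \<in> space M \<Longrightarrow> same_upto k y y' \<Longrightarrow> i \<le> k \<Longrightarrow>
       \<bar>birkhoff_sum T v i y - birkhoff_sum T v i y'\<bar> \<le> \<kappa>"
    "\<And>k i y y'. y \<in> space M \<Longrightarrow> y' \<in> space M \<Longrightarrow> same_upto k y y' \<Longrightarrow> i < k \<Longrightarrow>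
       \<bar>v ((T ^^ i) y) - v ((T ^^ i) y')\<bar> \<le> \<kappa>"
proof -
  obtain C where C: "(SUP j\<in>J. D_loc \<theta> T Om J v j) \<le> ereal C" "C > 0"
  proof -
    obtain n :: nat where "(SUP j\<in>J. D_loc \<theta> T Om J v j) < ereal (real n)"
      using assms by (metis less_PInf_Ex_of_nat less_irrefl)
    also have "\<dots> \<le> ereal (max (real n) 1)" by simp
    finally show ?thesis using that[of "max (real n) 1"] by simp
  qed
  have lip: "\<bar>v y - v y'\<bar> \<le> C * \<theta> ^ k" if yy: "y \<in> space M" "y' \<in> space M" "same_upto (Suc k) y y'" for y y' k
  proof (cases "y = y'")
    case True then show ?thesis using C theta by simp
  next
    case False
    have "same_part Om J y y'" using yy(3) unfolding same_upto_def by auto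
    then obtain j where j: "j \<in> J" "y \<in> Om j" "y' \<in> Om j" unfolding same_part_def by blast
    have "ereal (\<bar>v y - v y'\<bar> / d_theta \<theta> T Om J y y') \<le> D_loc \<theta> T Om J v j"
      unfolding D_loc_def using j False by (intro SUP_upper2[of "(y, y')"]) auto
    also have "\<dots> \<le> ereal C" using C(1) j by (meson SUP_upper order_trans)
    finally have "\<bar>v y - v y'\<bar> / d_theta \<theta> T Om J y y' \<le> C" by simp
    then have "\<bar>v y - v y'\<bar> \<le> C * d_theta \<theta> T Om J y y'"
      using d_theta_pos[OF yy(1,2) False] by (simp add: divide_le_eq)
    also have "\<dots> \<le> C * \<theta> ^ Suc k" using d_theta_le[OF yy(3)] C by (intro mult_left_mono) auto
    also have "\<dots> \<le> C * \<theta> ^ k" using C theta by (simp add: mult_left_le_one_le)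
    finally show ?thesis .
  qed
  have lipi: "\<bar>v ((T ^^ i) y) - v ((T ^^ i) y')\<bar> \<le> C * \<theta> ^ (k - Suc i)" 
    if yy: "y \<in> space M" "y' \<in> space M" "same_upto k y y'" "i < k" for y y' k i
  proof (rule lip)
    show "same_upto (Suc (k - Suc i)) ((T ^^ i) y) ((T ^^ i) y')"
      using same_upto_shift[OF yy(3), of i] yy(4) by (simp add: Suc_diff_Suc)
  qed (use yy T_pow_space in auto)
  have sum_le: "(\<Sum>i<k. \<theta> ^ i) \<le> 1 / (1 - \<theta>)" for k
    using sum_le_suminf[of "\<lambda>i. \<theta> ^ i" "{..<k}"] theta by (simp add: summable_geometric suminf_geometric)
  show ?thesis
  proof (rule that[of "C / (1 - \<theta>)"])
    show "C / (1 - \<theta>) > 0" using C theta by simp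
  next
    fix k i :: nat and y y' assume h: "y \<in> space M" "y' \<in> space M" "same_upto k y y'" "i \<le> k"
    then have s: "same_upto i y y'" using same_upto_mono by blast
    have "\<bar>birkhoff_sum T v i y - birkhoff_sum T v i y'\<bar> = \<bar>\<Sum>m<i. v ((T ^^ m) y) - v ((T ^^ m) y')\<bar>"
      by (simp add: birkhoff_sum_def sum_subtractf)
    also have "\<dots> \<le> (\<Sum>m<i. \<bar>v ((T ^^ m) y) - v ((T ^^ m) y')\<bar>)" by (rule sum_abs)
    also have "\<dots> \<le> (\<Sum>m<i. C * \<theta> ^ (i - Suc m))" using lipi[OF h(1,2) s] by (intro sum_mono) auto
    also have "\<dots> = C * (\<Sum>m<i. \<theta> ^ m)" 
      by (simp add: sum_distrib_left) (rule sum.nat_diff_reindex)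
    also have "\<dots> \<le> C * (1 / (1 - \<theta>))" using sum_le C by (intro mult_left_mono) auto
    finally show "\<bar>birkhoff_sum T v i y - birkhoff_sum T v i y'\<bar> \<le> C / (1 - \<theta>)" by simp
  next
    fix k i :: nat and y y' assume h: "y \<in> space M" "y' \<in> space M" "same_upto k y y'" "i < k"
    have "\<bar>v ((T ^^ i) y) - v ((T ^^ i) y')\<bar> \<le> C * \<theta> ^ (k - Suc i)" by (rule lipi[OF h])
    also have "\<dots> \<le> C * 1" using theta C by (intro mult_left_mono power_le_one) auto
    also have "\<dots> \<le> C / (1 - \<theta>)" using theta C by (simp add: le_divide_eq mult_left_le)
    finally show "\<bar>v ((T ^^ i) y) - v ((T ^^ i) y')\<bar> \<le> C / (1 - \<theta>)" .
  qed
qed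

end

section \<open>Stationary sums with quasi-independent past and future\<close>

lemma (in prob_space) prob_preserved_vimage:
  assumes "f \<in> measurable M M" "distr M M f = M" "B \<in> sets M"
  shows "prob (f -` B \<inter> space M) = prob B"
  using measure_distr[OF assms(1,3)] assms(2) by simp

text \<open>Collects what the probabilistic arguments need of the dynamics: stationarity, relations
  \<open>same k\<close> for equality of the first \<open>k\<close> symbols, the product bound for
  saturated events, and bounded oscillation. The assumptions are stable under passing from
  \<open>v\<close> to \<open>- v\<close>, which gives the lower tail without a second
  argument.\<close>

locale quasi_independent_sums = prob_space M
  for M :: "'a measure" +
  fixes T :: "'a \<Rightarrow> 'a" and v :: "'a \<Rightarrow> real" and same :: "nat \<Rightarrow> 'a \<Rightarrow> 'a \<Rightarrow> bool" and K \<kappa> :: real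
  assumes T_meas [measurable]: "T \<in> measurable M M"
    and T_pres: "distr M M T = M"
    and v_meas [measurable]: "v \<in> borel_measurable M"
    and same_refl: "y \<in> space M \<Longrightarrow> same k y y"
    and same_sym: "same k x y \<Longrightarrow> same k y x"
    and same_trans: "same k x y \<Longrightarrow> same k y z \<Longrightarrow> same k x z"
    and same_mono: "same k x y \<Longrightarrow> i \<le> k \<Longrightarrow> same i x y"
    and K_pos: "K > 0" and kappa_pos: "\<kappa> > 0"
    and quasi_indep: "A \<subseteq> space M \<Longrightarrow>
        (\<And>y y'. y \<in> A \<Longrightarrow> y' \<in> space M \<Longrightarrow> same k y y' \<Longrightarrow> y' \<in> A) \<Longrightarrow> B \<in> sets M \<Longrightarrow>
       A \<in> sets M \<and> measure M (A \<inter> (T ^^ k) -` B) \<le> K * measure M A * measure M B"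
    and osc_sum: "y \<in> space M \<Longrightarrow> y' \<in> space M \<Longrightarrow> same k y y' \<Longrightarrow> i \<le> k \<Longrightarrow>
       \<bar>birkhoff_sum T v i y - birkhoff_sum T v i y'\<bar> \<le> \<kappa>"
    and osc_fun: "y \<in> space M \<Longrightarrow> y' \<in> space M \<Longrightarrow> same k y y' \<Longrightarrow> i < k \<Longrightarrow>
       \<bar>v ((T ^^ i) y) - v ((T ^^ i) y')\<bar> \<le> \<kappa>"
begin

abbreviation S :: "nat \<Rightarrow> 'a \<Rightarrow> real" where "S \<equiv> birkhoff_sum T v"

lemma T_pow_meas [measurable]: "(T ^^ k) \<in> measurable M M"
  by (induction k) (auto intro: measurable_compose[OF _ T_meas] simp: comp_def)

lemma T_pow_in_space: "y \<in> space M \<Longrightarrow> (T ^^ k) y \<in> space M"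
  using T_pow_meas measurable_space by metis

lemma T_pow_pres: "distr M M (T ^^ k) = M"
proof (induction k)
  case 0 then show ?case by (simp add: distr_id id_def)
next
  case (Suc k)
  have "distr M M (T ^^ Suc k) = distr (distr M M (T ^^ k)) M T"
    by (simp add: distr_distr comp_def)
  also have "\<dots> = M" using Suc T_pres by simp
  finally show ?case .
qed

lemma prob_T_pow: "B \<in> sets M \<Longrightarrow> prob ((T ^^ k) -` B \<inter> space M) = prob B"
  by (rule prob_preserved_vimage[OF T_pow_meas T_pow_pres])

lemma prob_T_pow_Collect:
  assumes "{y \<in> space M. P y} \<in> sets M"
  shows "prob {y \<in> space M. P ((T ^^ k) y)} = prob {y \<in> space M. P y}"
proof -
  have "{y \<in> space M. P ((T ^^ k) y)} = (T ^^ k) -` {y \<in> space M. P y} \<inter> space M"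
    using T_pow_in_space by auto
  then show ?thesis using prob_T_pow[OF assms] by simp
qed

lemma S_meas [measurable]: "S k \<in> borel_measurable M"
  unfolding birkhoff_sum_def by measurable

lemma S_add: "S (m + k) y = S m y + S k ((T ^^ m) y)"
proof -
  have "S (m + k) y = (\<Sum>j<m. v ((T ^^ j) y)) + (\<Sum>j=m..<m+k. v ((T ^^ j) y))"
    unfolding birkhoff_sum_def
    by (simp add: sum.atLeastLessThan_concat[symmetric] lessThan_atLeast0)
  also have "(\<Sum>j=m..<m+k. v ((T ^^ j) y)) = (\<Sum>j<k. v ((T ^^ j) ((T ^^ m) y)))"
    using sum.shift_bounds_nat_ivl[of "\<lambda>j. v ((T ^^ j) y)" 0 m k]
    by (simp add: lessThan_atLeast0 funpow_add add.commute)
  finally show ?thesis by (simp add: birkhoff_sum_def)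
qed

lemma S_Suc: "S (Suc m) y = S m y + v ((T ^^ m) y)"
  by (simp add: birkhoff_sum_def)

lemma S_0 [simp]: "S 0 y = 0"
  by (simp add: birkhoff_sum_def)

text \<open>Passage times are defined through saturated events, so that the first passage at time
  \<open>m\<close> is exactly determined by the first \<open>m\<close> symbols.\<close>

definition passage :: "(nat \<Rightarrow> real) \<Rightarrow> real \<Rightarrow> nat \<Rightarrow> 'a set" where
  "passage c t m = {y \<in> space M. \<exists>y'\<in>space M. same m y y' \<and> \<bar>S m y' - c m\<bar> > t}"

definition first_passage :: "(nat \<Rightarrow> real) \<Rightarrow> real \<Rightarrow> nat \<Rightarrow> 'a set" where
  "first_passage c t m = passage c t m - (\<Union>i<m. passage c t i)"

lemma passage_saturated:
  assumes "i \<le> m" "y' \<in> space M" "same m y y'"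
  shows "y \<in> passage c t i \<Longrightarrow> y' \<in> passage c t i"
proof -
  assume y: "y \<in> passage c t i"
  then obtain z where z: "z \<in> space M" "same i y z" "\<bar>S i z - c i\<bar> > t"
    unfolding passage_def by blast
  have "same i y' z" using same_trans same_sym same_mono assms z by blast
  then show ?thesis using z assms unfolding passage_def by blast
qed

text \<open>A set defined by an existential over points has no evident measurability. Saturation
  provides it, through the first conclusion of \<open>quasi_indep\<close> with the empty set as
  \<open>B\<close>.\<close>

lemma passage_sets [measurable]: "passage c t m \<in> sets M"
proof -
  have "passage c t m \<subseteq> space M" unfolding passage_def by blast
  then show ?thesis using quasi_indep[of "passage c t m" m "{}"] passage_saturated[of m m] by blast
qed

lemma first_passage_sets [measurable]: "first_passage c t m \<in> sets M"
  unfolding first_passage_def by measurable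

lemma passage_lower: "y \<in> passage c t m \<Longrightarrow> \<bar>S m y - c m\<bar> > t - \<kappa>"
proof -
  assume "y \<in> passage c t m"
  then obtain z where z: "y \<in> space M" "z \<in> space M" "same m y z" "\<bar>S m z - c m\<bar> > t"
    unfolding passage_def by blast
  then show ?thesis using osc_sum[of y z m m] by simp
qed

lemma passage_upper: "y \<in> space M \<Longrightarrow> \<bar>S m y - c m\<bar> > t \<Longrightarrow> y \<in> passage c t m"
  unfolding passage_def using same_refl by blast

lemma UN_first_passage: "(\<Union>m\<le>n. first_passage c t m) = (\<Union>m\<le>n. passage c t m)"
proof
  show "(\<Union>m\<le>n. passage c t m) \<subseteq> (\<Union>m\<le>n. first_passage c t m)"
  proof
    fix y assume "y \<in> (\<Union>m\<le>n. passage c t m)"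
    then obtain m where m: "m \<le> n" "y \<in> passage c t m" by blast
    define k where "k = (LEAST k. y \<in> passage c t k)"
    have "y \<in> passage c t k" unfolding k_def using m by (rule_tac LeastI)
    moreover have "k \<le> m" unfolding k_def using m by (rule_tac Least_le)
    moreover have "y \<notin> passage c t i" if "i < k" for i using that not_less_Least unfolding k_def by blast
    ultimately show "y \<in> (\<Union>m\<le>n. first_passage c t m)" unfolding first_passage_def using m by fastforce
  qed
qed (auto simp: first_passage_def)

lemma first_passage_disjoint: "disjoint_family_on (first_passage c t) I"
proof -
  have "first_passage c t m \<inter> first_passage c t n = {}" if "m < n" for m n
    using that unfolding first_passage_def by blast
  then show ?thesis unfolding disjoint_family_on_def by (metis Int_commute nat_neq_iff)
qed

lemma first_passage_vimage_sets:
  assumes "F \<in> sets M"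
  shows "first_passage c t m \<inter> (T ^^ m) -` F \<in> sets M"
proof -
  have "first_passage c t m \<inter> (T ^^ m) -` F = first_passage c t m \<inter> ((T ^^ m) -` F \<inter> space M)"
    by (auto simp: first_passage_def passage_def)
  then show ?thesis using measurable_sets[OF T_pow_meas assms] by (metis first_passage_sets sets.Int)
qed

text \<open>A first passage at time \<open>m\<close> is a saturated event of length
  \<open>m\<close>, hence quasi-independent of what \<open>F m\<close> says about the orbit from
  time \<open>m\<close> on. Since the first passages are disjoint, their probabilities add up to
  that of a passage at some time, with no factor \<open>n\<close>.\<close>

lemma first_passage_bound:
  assumes F: "\<And>m. m \<le> n \<Longrightarrow> F m \<in> sets M" "\<And>m. m \<le> n \<Longrightarrow> prob (F m) \<le> \<beta>"
  shows "prob (\<Union>m\<le>n. first_passage c t m \<inter> (T ^^ m) -` F m) \<le> K * prob (\<Union>m\<le>n. passage c t m) * \<beta>"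
proof -
  have sp: "first_passage c t m \<subseteq> space M" for m by (auto simp: first_passage_def passage_def)
  have ms: "first_passage c t m \<inter> (T ^^ m) -` F m \<in> sets M" if "m \<le> n" for m
    using F(1)[OF that] by (rule first_passage_vimage_sets)
  have b: "prob (first_passage c t m \<inter> (T ^^ m) -` F m) \<le> K * prob (first_passage c t m) * \<beta>" if "m \<le> n" for m
  proof -
    have "y' \<in> first_passage c t m" if "y \<in> first_passage c t m" "y' \<in> space M" "same m y y'" for y y'
    proof -
      have y: "y \<in> space M" "y \<in> passage c t m" "\<And>i. i < m \<Longrightarrow> y \<notin> passage c t i"
        using that(1) sp by (auto simp: first_passage_def)
      have "y' \<notin> passage c t i" if "i < m" for i
        using passage_saturated[of i m y y' c t] y same_sym[OF \<open>same m y y'\<close>] that by auto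
      then show ?thesis
        using passage_saturated[of m m y' y c t] y that by (auto simp: first_passage_def)
    qed
    then have "prob (first_passage c t m \<inter> (T ^^ m) -` F m) \<le> K * prob (first_passage c t m) * prob (F m)"
      using quasi_indep[of "first_passage c t m" m "F m"] F(1) that sp by blast
    also have "\<dots> \<le> K * prob (first_passage c t m) * \<beta>"
      using F(2) that K_pos by (intro mult_left_mono) auto
    finally show ?thesis .
  qed
  have "prob (\<Union>m\<le>n. first_passage c t m \<inter> (T ^^ m) -` F m) \<le> (\<Sum>m\<le>n. prob (first_passage c t m \<inter> (T ^^ m) -` F m))"
    using ms by (intro finite_measure_subadditive_finite) auto
  also have "\<dots> \<le> (\<Sum>m\<le>n. K * prob (first_passage c t m) * \<beta>)" using b by (intro sum_mono) auto
  also have "\<dots> = K * (\<Sum>m\<le>n. prob (first_passage c t m)) * \<beta>" by (simp add: sum_distrib_left sum_distrib_right)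
  also have "(\<Sum>m\<le>n. prob (first_passage c t m)) = prob (\<Union>m\<le>n. first_passage c t m)"
    by (intro finite_measure_finite_Union[symmetric] first_passage_disjoint) auto
  finally show ?thesis unfolding UN_first_passage .
qed

section \<open>Maximal inequalities and bounds for large sums\<close>

definition Q :: "nat \<Rightarrow> real \<Rightarrow> real" where
  "Q n t = prob {y \<in> space M. \<exists>k\<le>n. \<bar>S k y\<bar> > t}"

lemma Q_nonneg: "0 \<le> Q n t" and Q_le_1: "Q n t \<le> 1"
  unfolding Q_def by auto

lemma Q_mono: "m \<le> n \<Longrightarrow> t \<le> s \<Longrightarrow> Q m s \<le> Q n t"
  unfolding Q_def by (intro finite_measure_mono) (auto, meson le_less_trans order_trans)

lemma prob_passage_le: "prob (\<Union>m\<le>n. passage (\<lambda>_. 0) t m) \<le> Q n (t - \<kappa>)"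
  unfolding Q_def 
proof (rule finite_measure_mono)
  show "(\<Union>m\<le>n. passage (\<lambda>_. 0) t m) \<subseteq> {y \<in> space M. \<exists>k\<le>n. t - \<kappa> < \<bar>S k y\<bar>}"
    using passage_lower[of _ "\<lambda>_. 0" t] by (auto simp: passage_def)
qed measurable

text \<open>After a passage over \<open>2 * t\<close> at time \<open>m\<close>, either the final sum
  is far from its centre too or the remaining increment compensates for the passage; both are
  unlikely by \<open>\<beta>\<close>. The slack \<open>\<kappa>\<close> pays for the saturation of
  the passage and \<open>r\<close> for centres that are additive only approximately.\<close>

lemma ottaviani:
  assumes sub: "\<And>m. m \<le> n \<Longrightarrow> \<bar>c n - c m - c (n - m)\<bar> \<le> r" 
    and \<beta>: "\<And>k. k \<le> n \<Longrightarrow> prob {y \<in> space M. \<bar>S k y - c k\<bar> > t - \<kappa> - r} \<le> \<beta>" and r: "r \<ge> 0"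
  shows "prob {y \<in> space M. \<exists>k\<le>n. \<bar>S k y - c k\<bar> > 2 * t} \<le> (1 + K) * \<beta>"
proof -
  define F where "F m = {y \<in> space M. \<bar>S (n - m) y - c (n - m)\<bar> > t - \<kappa> - r}" for m
  have F: "F m \<in> sets M" for m unfolding F_def by measurable
  have sub2: "{y \<in> space M. \<exists>k\<le>n. \<bar>S k y - c k\<bar> > 2 * t} \<subseteq> 
      {y \<in> space M. \<bar>S n y - c n\<bar> > t - \<kappa> - r} \<union> (\<Union>m\<le>n. first_passage c (2 * t) m \<inter> (T ^^ m) -` F m)"
  proof
    fix y assume y: "y \<in> {y \<in> space M. \<exists>k\<le>n. \<bar>S k y - c k\<bar> > 2 * t}"
    then have "y \<in> (\<Union>m\<le>n. passage c (2 * t) m)" using passage_upper by blast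
    then obtain m where m: "m \<le> n" "y \<in> first_passage c (2 * t) m" unfolding UN_first_passage[symmetric] by blast
    then have Sm: "\<bar>S m y - c m\<bar> > 2 * t - \<kappa>" using passage_lower by (auto simp: first_passage_def)
    have "y \<in> (T ^^ m) -` F m" if "\<not> \<bar>S n y - c n\<bar> > t - \<kappa> - r"
    proof -
      have "S n y = S m y + S (n - m) ((T ^^ m) y)" using S_add[of m "n - m" y] m by simp
      then have "\<bar>S (n - m) ((T ^^ m) y) - c (n - m)\<bar> > t - \<kappa> - r"
        using that Sm sub[OF m(1)] kappa_pos r by linarith
      then show ?thesis using y T_pow_in_space by (auto simp: F_def)
    qed
    then show "y \<in> {y \<in> space M. \<bar>S n y - c n\<bar> > t - \<kappa> - r} \<union> (\<Union>m\<le>n. first_passage c (2 * t) m \<inter> (T ^^ m) -` F m)"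
      using m y by blast
  qed
  have ms: "(\<Union>m\<le>n. first_passage c (2 * t) m \<inter> (T ^^ m) -` F m) \<in> sets M"
    using F by (intro sets.finite_UN first_passage_vimage_sets) auto
  have "\<beta> \<ge> 0" using \<beta>[of 0] measure_nonneg by (meson le0 order_trans)
  have "prob {y \<in> space M. \<exists>k\<le>n. \<bar>S k y - c k\<bar> > 2 * t} \<le> 
     prob ({y \<in> space M. \<bar>S n y - c n\<bar> > t - \<kappa> - r} \<union> (\<Union>m\<le>n. first_passage c (2 * t) m \<inter> (T ^^ m) -` F m))"
    by (rule finite_measure_mono[OF sub2]) (use ms in measurable)
  also have "\<dots> \<le> prob {y \<in> space M. \<bar>S n y - c n\<bar> > t - \<kappa> - r} + prob (\<Union>m\<le>n. first_passage c (2 * t) m \<inter> (T ^^ m) -` F m)"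
    by (rule measure_Un_le) (use ms in measurable)
  also have "\<dots> \<le> \<beta> + K * prob (\<Union>m\<le>n. passage c (2 * t) m) * \<beta>"
    using \<beta> by (intro add_mono first_passage_bound F) (auto simp: F_def)
  also have "K * prob (\<Union>m\<le>n. passage c (2 * t) m) * \<beta> \<le> K * 1 * \<beta>"
    using K_pos \<open>\<beta> \<ge> 0\<close> by (intro mult_right_mono mult_left_mono) auto
  finally show ?thesis by (simp add: algebra_simps)
qed

text \<open>After the first passage over \<open>t\<close>, unless some single summand is atypical, the remaining
  sum has to exceed \<open>t\<close> as well.\<close>

lemma single_jump_bound:
  assumes A: "A \<in> sets M" and R: "Measurable.pred borel R" and t: "t \<ge> 0"
    and A_imp: "\<And>y m. y \<in> A \<Longrightarrow> (\<forall>i<n. \<not> R (v ((T ^^ i) y))) \<Longrightarrow> m < n \<Longrightarrow> (\<forall>j\<le>m. \<bar>S j y\<bar> \<le> t) \<Longrightarrow>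
        \<exists>k\<le>n. k \<ge> Suc m \<and> \<bar>S k y - S (Suc m) y\<bar> > t"
    and A_pass: "\<And>y. y \<in> A \<Longrightarrow> \<exists>k\<le>n. \<bar>S k y\<bar> > t"
  shows "prob A \<le> real n * prob {y \<in> space M. R (v y)} + K * Q n (t - \<kappa>) * Q n t"
proof -
  define F where "F = {y \<in> space M. \<exists>k\<le>n. \<bar>S k y\<bar> > t}"
  note [measurable] = A R
  have F [measurable]: "F \<in> sets M" unfolding F_def by measurable
  have Asp: "A \<subseteq> space M" using A sets.sets_into_space by blast
  let ?fp = "first_passage (\<lambda>_. 0) t"
  have sub2: "A \<subseteq> (\<Union>i<n. {y \<in> space M. R (v ((T ^^ i) y))}) \<union> (\<Union>m\<le>n. ?fp m \<inter> (T ^^ m) -` F)"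
  proof
    fix y assume y: "y \<in> A"
    show "y \<in> (\<Union>i<n. {y \<in> space M. R (v ((T ^^ i) y))}) \<union> (\<Union>m\<le>n. ?fp m \<inter> (T ^^ m) -` F)"
    proof (cases "\<exists>i<n. R (v ((T ^^ i) y))")
      case True then show ?thesis using y Asp by blast
    next
      case False
      obtain k where k: "k \<le> n" "\<bar>S k y\<bar> > t" using A_pass[OF y] by blast
      then have "y \<in> (\<Union>m\<le>n. passage (\<lambda>_. 0) t m)" using y Asp passage_upper[of y t k "\<lambda>_. 0"] by auto
      then obtain m where m: "m \<le> n" "y \<in> ?fp m" unfolding UN_first_passage[symmetric] by blast
      \<comment> \<open>The sum of length 0 vanishes and \<open>t\<close> is non-negative, so the
        passage has a last step, before which all sums are at most \<open>t\<close>.\<close>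
      have "m \<noteq> 0" using m t by (auto simp: first_passage_def passage_def)
      then obtain l where l: "m = Suc l" using not0_implies_Suc by blast
      have "y \<notin> passage (\<lambda>_. 0) t j" if "j \<le> l" for j using m l that by (auto simp: first_passage_def)
      then have "\<bar>S j y\<bar> \<le> t" if "j \<le> l" for j using that passage_upper[of y t j "\<lambda>_. 0"] y Asp by force
      then obtain k where k: "k \<le> n" "k \<ge> m" "\<bar>S k y - S m y\<bar> > t" using A_imp[OF y, of l] False l m by auto
      have "S k y - S m y = S (k - m) ((T ^^ m) y)" using S_add[of m "k - m" y] k by simp
      then have "(T ^^ m) y \<in> F" unfolding F_def using k y Asp T_pow_in_space
        by (auto intro!: exI[of _ "k - m"])
      then show ?thesis using m by blast
    qed
  qed
  have ms: "(\<Union>m\<le>n. ?fp m \<inter> (T ^^ m) -` F) \<in> sets M"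
    using F by (intro sets.finite_UN first_passage_vimage_sets) auto
  have ms1: "{y \<in> space M. R (v ((T ^^ i) y))} \<in> sets M" for i by measurable
  then have ms2: "(\<Union>i<n. {y \<in> space M. R (v ((T ^^ i) y))}) \<in> sets M" by blast
  have "prob A \<le> prob ((\<Union>i<n. {y \<in> space M. R (v ((T ^^ i) y))}) \<union> (\<Union>m\<le>n. ?fp m \<inter> (T ^^ m) -` F))"
    by (rule finite_measure_mono[OF sub2]) (use ms ms2 in blast)
  also have "\<dots> \<le> prob (\<Union>i<n. {y \<in> space M. R (v ((T ^^ i) y))}) + prob (\<Union>m\<le>n. ?fp m \<inter> (T ^^ m) -` F)"
    by (rule measure_Un_le[OF ms2 ms])
  also have "prob (\<Union>i<n. {y \<in> space M. R (v ((T ^^ i) y))}) \<le> (\<Sum>i<n. prob {y \<in> space M. R (v ((T ^^ i) y))})"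
    using ms1 by (intro finite_measure_subadditive_finite) auto
  also have "(\<Sum>i<n. prob {y \<in> space M. R (v ((T ^^ i) y))}) = (\<Sum>i<n. prob {y \<in> space M. R (v y)})"
    by (intro sum.cong refl prob_T_pow_Collect) measurable
  also have "prob (\<Union>m\<le>n. ?fp m \<inter> (T ^^ m) -` F) \<le> K * prob (\<Union>m\<le>n. passage (\<lambda>_. 0) t m) * Q n t"
    using F by (intro first_passage_bound) (auto simp: Q_def F_def)
  also have "\<dots> \<le> K * Q n (t - \<kappa>) * Q n t"
    using K_pos Q_nonneg by (intro mult_right_mono mult_left_mono prob_passage_le) auto
  finally show ?thesis by simp
qed

text \<open>Before the first passage the sum is at most \<open>t\<close>, and without a summand
  beyond \<open>t\<close> it is at most \<open>2 * t\<close> at the passage; an increment after it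
  must make up the rest of \<open>3 * t\<close>.\<close>

lemma hoffmann_jorgensen:
  assumes "t \<ge> 0"
  shows "Q n (3 * t) \<le> real n * prob {y \<in> space M. \<bar>v y\<bar> > t} + K * Q n (t - \<kappa>) * Q n t"
  unfolding Q_def[of n "3 * t"]
proof (rule single_jump_bound[where R = "\<lambda>x. \<bar>x\<bar> > t"])
  fix y m assume y: "y \<in> {y \<in> space M. \<exists>k\<le>n. 3 * t < \<bar>S k y\<bar>}" and small: "\<forall>i<n. \<not> t < \<bar>v ((T ^^ i) y)\<bar>"
    and m: "m < n" "\<forall>j\<le>m. \<bar>S j y\<bar> \<le> t"
  obtain k where k: "k \<le> n" "3 * t < \<bar>S k y\<bar>" using y by blast
  have "\<bar>S (Suc m) y\<bar> \<le> 2 * t" 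
  proof -
    have "\<bar>S m y\<bar> \<le> t" "\<bar>v ((T ^^ m) y)\<bar> \<le> t" using m small by (auto simp: not_less)
    then show ?thesis unfolding S_Suc by linarith
  qed
  moreover have "k \<ge> Suc m" 
  proof (rule ccontr)
    assume "\<not> k \<ge> Suc m"
    then have "\<bar>S k y\<bar> \<le> t" using m(2) by simp
    then show False using k(2) assms by linarith
  qed
  ultimately show "\<exists>k\<le>n. k \<ge> Suc m \<and> \<bar>S k y - S (Suc m) y\<bar> > t" using k by (intro exI[of _ k]) auto
next
  fix y assume "y \<in> {y \<in> space M. \<exists>k\<le>n. 3 * t < \<bar>S k y\<bar>}"
  then show "\<exists>k\<le>n. \<bar>S k y\<bar> > t" using assms by force
qed (use assms in \<open>simp_all\<close>)

text \<open>Only upward jumps count as atypical. Before the first passage over \<open>e * N\<close>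
  the sum is at most \<open>e * N\<close>, a summand of at most \<open>(1 - 2 * e) * N\<close> lifts
  it to at most \<open>N - e * N\<close>, and a later increment of more than \<open>e * N\<close> is
  still required.\<close>

lemma large_sum_upper:
  assumes e: "0 < e" "e \<le> 1" and N: "N > 0"
  shows "prob {y \<in> space M. S n y > N} \<le> 
    real n * prob {y \<in> space M. v y > (1 - 2 * e) * N} + K * Q n (e * N - \<kappa>) * Q n (e * N)"
proof (rule single_jump_bound)
  fix y m assume y: "y \<in> {y \<in> space M. N < S n y}" and small: "\<forall>i<n. \<not> (1 - 2 * e) * N < v ((T ^^ i) y)"
    and m: "m < n" "\<forall>j\<le>m. \<bar>S j y\<bar> \<le> e * N"
  have "S m y \<le> e * N" using m(2) by (meson abs_le_D1 le_refl)
  moreover have "v ((T ^^ m) y) \<le> (1 - 2 * e) * N" using small m(1) by (simp add: not_less)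
  ultimately have "S (Suc m) y \<le> N - e * N" by (simp add: S_Suc algebra_simps)
  then show "\<exists>k\<le>n. k \<ge> Suc m \<and> \<bar>S k y - S (Suc m) y\<bar> > e * N" using y m by (intro exI[of _ n]) auto
next
  fix y assume y: "y \<in> {y \<in> space M. N < S n y}"
  have "e * N \<le> N" using e N by simp
  then show "\<exists>k\<le>n. \<bar>S k y\<bar> > e * N" using y by (intro exI[of _ n]) auto
qed (use e N in simp_all)

text \<open>A summand above \<open>(1 + 2 * e) * N\<close> forces the sum above \<open>N\<close> if
  the partial sums before it and the increment after it stay within \<open>e * N\<close>. The
  probability of such a summand at a given time is exact by stationarity; quasi-independence bounds
  the loss from a bad past or a bad future, so \<open>K\<close> does not touch the leading
  term.\<close>

lemma large_sum_lower:
  assumes e: "e > 0" and N: "N > 0"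
  shows "prob {y \<in> space M. S n y > N} \<ge> real n * (prob {y \<in> space M. v y > (1 + 2 * e) * N} 
     - K * (Q n (e * N - \<kappa>) + Q n (e * N)) * prob {y \<in> space M. v y > (1 + 2 * e) * N - \<kappa>})"
proof -
  define t where "t = e * N"
  define b where "b = (1 + 2 * e) * N"
  have t: "t > 0" and b: "b = N + 2 * t" using e N by (auto simp: t_def b_def algebra_simps)
  define H where "H x = prob {y \<in> space M. v y > x}" for x
  have H_nonneg: "H x \<ge> 0" for x by (simp add: H_def)
  define V where "V i = {y \<in> space M. v ((T ^^ i) y) > b}" for i
  define G where "G i = {y \<in> space M. v ((T ^^ i) y) > b \<and> (\<forall>k\<le>i. \<bar>S k y\<bar> \<le> t) \<and> \<bar>S (n - Suc i) ((T ^^ Suc i) y)\<bar> \<le> t}" for i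
  define A where "A i = (\<Union>m\<le>i. passage (\<lambda>_. 0) t m)" for i
  define B where "B = {y \<in> space M. v y > b}"
  \<comment> \<open>The first \<open>Suc i\<close> symbols do not decide whether the jump exceeds
    \<open>b\<close>. The saturated version is quasi-independent of the future and costs
    \<open>\<kappa>\<close> in the threshold.\<close>
  define A' where "A' i = {y \<in> space M. \<exists>y'\<in>space M. same (Suc i) y y' \<and> v ((T ^^ i) y') > b}" for i
  define B' where "B' i = {y \<in> space M. \<bar>S (n - Suc i) y\<bar> > t}" for i
  have [measurable]: "V i \<in> sets M" "G i \<in> sets M" "A i \<in> sets M" "B \<in> sets M" "B' i \<in> sets M" for i
    unfolding V_def G_def B_def B'_def A_def by measurable
  have Q_n: "Q i (t - \<kappa>) \<le> Q n (t - \<kappa>)" if "i \<le> n" for i using that by (intro Q_mono) auto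
  have H_mono: "H b \<le> H (b - \<kappa>)" unfolding H_def using kappa_pos by (intro finite_measure_mono) auto
  have PG: "prob (G i) \<ge> H b - K * (Q n (t - \<kappa>) + Q n t) * H (b - \<kappa>)" if i: "i < n" for i
  proof -
    have "prob (A i \<inter> (T ^^ i) -` B) \<le> K * prob (A i) * prob B"
    proof -
      have "A i \<subseteq> space M" by (auto simp: A_def passage_def)
      moreover have "y' \<in> A i" if "y \<in> A i" "y' \<in> space M" "same i y y'" for y y'
        using that passage_saturated[of _ i y' y] unfolding A_def by blast
      ultimately show ?thesis using quasi_indep[of "A i" i B] by auto
    qed
    also have "\<dots> \<le> K * Q n (t - \<kappa>) * H (b - \<kappa>)"
      using K_pos prob_passage_le[where n=i and t=t] Q_n[of i] i H_mono Q_nonneg H_nonneg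
      by (intro mult_mono mult_left_mono) (auto simp: A_def B_def H_def[symmetric])
    finally have 1: "prob (A i \<inter> (T ^^ i) -` B) \<le> K * Q n (t - \<kappa>) * H (b - \<kappa>)" .
    have sat: "A' i \<subseteq> space M" "\<And>y y'. y \<in> A' i \<Longrightarrow> y' \<in> space M \<Longrightarrow> same (Suc i) y y' \<Longrightarrow> y' \<in> A' i"
      unfolding A'_def using same_trans same_sym by blast+
    have A'_sets: "A' i \<in> sets M" and "prob (A' i \<inter> (T ^^ Suc i) -` B' i) \<le> K * prob (A' i) * prob (B' i)"
      using quasi_indep[of "A' i" "Suc i" "B' i", OF sat] by (auto simp del: funpow.simps)
    note this(2)
    also have "K * prob (A' i) * prob (B' i) \<le> K * H (b - \<kappa>) * Q n t"
    proof (intro mult_mono mult_left_mono)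
      have "prob (A' i) \<le> prob {y \<in> space M. v ((T ^^ i) y) > b - \<kappa>}"
      proof (rule finite_measure_mono)
        show "A' i \<subseteq> {y \<in> space M. v ((T ^^ i) y) > b - \<kappa>}"
        proof
          fix y assume "y \<in> A' i"
          then obtain z where z: "y \<in> space M" "z \<in> space M" "same (Suc i) y z" "v ((T ^^ i) z) > b" 
            unfolding A'_def by blast
          then show "y \<in> {y \<in> space M. v ((T ^^ i) y) > b - \<kappa>}" using osc_fun[of y z "Suc i" i] by simp
        qed
      qed measurable
      also have "\<dots> = H (b - \<kappa>)" unfolding H_def by (rule prob_T_pow_Collect) measurable
      finally show "prob (A' i) \<le> H (b - \<kappa>)" .
      show "prob (B' i) \<le> Q n t" unfolding B'_def Q_def
        by (intro finite_measure_mono) (auto intro: exI[of _ "n - Suc i"])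
    qed (use K_pos in \<open>auto simp: H_def\<close>)
    finally have 2: "prob (A' i \<inter> (T ^^ Suc i) -` B' i) \<le> K * H (b - \<kappa>) * Q n t" .
    have ms1: "A i \<inter> (T ^^ i) -` B \<in> sets M"
    proof -
      have "A i \<inter> (T ^^ i) -` B = A i \<inter> ((T ^^ i) -` B \<inter> space M)" by (auto simp: A_def passage_def)
      then show ?thesis using measurable_sets[OF T_pow_meas[of i], of B] by simp
    qed
    have ms2: "A' i \<inter> (T ^^ Suc i) -` B' i \<in> sets M"
    proof -
      have "A' i \<inter> (T ^^ Suc i) -` B' i = A' i \<inter> ((T ^^ Suc i) -` B' i \<inter> space M)" using sat(1) by blast
      then show ?thesis using measurable_sets[OF T_pow_meas[of "Suc i"], of "B' i"] A'_sets by (simp del: funpow.simps)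
    qed
    have sub: "V i \<subseteq> G i \<union> ((A i \<inter> (T ^^ i) -` B) \<union> (A' i \<inter> (T ^^ Suc i) -` B' i))"
    proof
      fix y assume y: "y \<in> V i"
      then have sp: "y \<in> space M" and vb: "v ((T ^^ i) y) > b" by (auto simp: V_def)
      have in_A': "y \<in> A' i" unfolding A'_def using sp vb same_refl by blast
      have in_B: "(T ^^ i) y \<in> B" unfolding B_def using sp vb T_pow_in_space by blast
      show "y \<in> G i \<union> ((A i \<inter> (T ^^ i) -` B) \<union> (A' i \<inter> (T ^^ Suc i) -` B' i))"
      proof (cases "\<exists>k\<le>i. \<bar>S k y\<bar> > t")
        case True
        then have "y \<in> A i" using passage_upper[of y t _ "\<lambda>_. 0"] sp unfolding A_def by auto
        then show ?thesis using in_B by blast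
      next
        case False
        show ?thesis
        proof (cases "\<bar>S (n - Suc i) ((T ^^ Suc i) y)\<bar> > t")
          case True
          then have "(T ^^ Suc i) y \<in> B' i" unfolding B'_def using sp T_pow_in_space by blast
          then show ?thesis using in_A' by blast
        next
          case F2: False
          then have "y \<in> G i" unfolding G_def using sp vb False by (auto simp: not_less)
          then show ?thesis by blast
        qed
      qed
    qed
    have "H b = prob (V i)" unfolding H_def V_def by (rule prob_T_pow_Collect[symmetric]) measurable
    also have "\<dots> \<le> prob (G i \<union> ((A i \<inter> (T ^^ i) -` B) \<union> (A' i \<inter> (T ^^ Suc i) -` B' i)))"
      by (rule finite_measure_mono[OF sub]) (use ms1 ms2 in \<open>intro sets.Un, auto simp del: funpow.simps\<close>)
    also have "\<dots> \<le> prob (G i) + prob ((A i \<inter> (T ^^ i) -` B) \<union> (A' i \<inter> (T ^^ Suc i) -` B' i))"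
      by (rule measure_Un_le) (use ms1 ms2 in \<open>auto simp del: funpow.simps intro!: sets.Un\<close>)
    also have "prob ((A i \<inter> (T ^^ i) -` B) \<union> (A' i \<inter> (T ^^ Suc i) -` B' i)) \<le> 
        prob (A i \<inter> (T ^^ i) -` B) + prob (A' i \<inter> (T ^^ Suc i) -` B' i)"
      by (rule measure_Un_le[OF ms1 ms2])
    finally show ?thesis using 1 2 by (simp add: algebra_simps)
  qed
  \<comment> \<open>A jump at time \<open>i\<close> leaves \<open>S (Suc i)\<close> above
    \<open>N + t\<close>, which contradicts the small sums required up to a later jump time
    \<open>j\<close>.\<close>
  have disj: "disjoint_family_on G {..<n}"
  proof -
    have "G i \<inter> G j = {}" if ij: "i < j" for i j
    proof -
      have False if y: "y \<in> G i" "y \<in> G j" for y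
      proof -
        have "\<bar>S i y\<bar> \<le> t" "v ((T ^^ i) y) > b" using y(1) by (auto simp: G_def)
        then have "S (Suc i) y > t" using N t by (auto simp: S_Suc b)
        moreover have "\<bar>S (Suc i) y\<bar> \<le> t" using y(2) ij by (auto simp: G_def)
        ultimately show False by linarith
      qed
      then show ?thesis by blast
    qed
    then show ?thesis unfolding disjoint_family_on_def by (metis Int_commute nat_neq_iff)
  qed
  have sub: "(\<Union>i<n. G i) \<subseteq> {y \<in> space M. S n y > N}"
  proof
    fix y assume "y \<in> (\<Union>i<n. G i)"
    then obtain i where i: "i < n" "y \<in> G i" by blast
    have "S n y = S i y + v ((T ^^ i) y) + S (n - Suc i) ((T ^^ Suc i) y)"
      using S_add[of "Suc i" "n - Suc i" y] i by (simp add: S_Suc)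
    moreover have "y \<in> space M" "\<bar>S i y\<bar> \<le> t" "v ((T ^^ i) y) > b" "\<bar>S (n - Suc i) ((T ^^ Suc i) y)\<bar> \<le> t"
      using i by (auto simp: G_def)
    ultimately show "y \<in> {y \<in> space M. S n y > N}" unfolding b mem_Collect_eq by linarith
  qed
  have "real n * (H b - K * (Q n (t - \<kappa>) + Q n t) * H (b - \<kappa>)) = (\<Sum>i<n. H b - K * (Q n (t - \<kappa>) + Q n t) * H (b - \<kappa>))"
    by simp
  also have "\<dots> \<le> (\<Sum>i<n. prob (G i))" using PG by (intro sum_mono) auto
  also have "\<dots> = prob (\<Union>i<n. G i)" by (intro finite_measure_finite_Union[symmetric] disj) auto
  also have "\<dots> \<le> prob {y \<in> space M. S n y > N}" by (rule finite_measure_mono[OF sub]) measurable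
  finally show ?thesis unfolding H_def t_def b_def .
qed

end

section \<open>Tightness, mixing and the growth of the normalisation\<close>

lemma (in prob_space) tail_small:
  fixes f :: "'a \<Rightarrow> real"
  assumes [measurable]: "f \<in> borel_measurable M" and "\<epsilon> > 0"
  obtains R where "R > 0" "prob {y \<in> space M. \<bar>f y\<bar> > R} < \<epsilon>"
proof -
  define A where "A n = {y \<in> space M. \<bar>f y\<bar> > real n}" for n
  have "(\<lambda>n. prob (A n)) \<longlonglongrightarrow> prob (\<Inter>n. A n)"
    unfolding A_def by (intro finite_Lim_measure_decseq) (auto simp: decseq_def)
  moreover have "(\<Inter>n. A n) = {}"
  proof -
    have "\<exists>n. y \<notin> A n" for y
    proof -
      obtain n where "\<bar>f y\<bar> < real n" using reals_Archimedean2 by blast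
      then have "y \<notin> A n" by (auto simp: A_def)
      then show ?thesis ..
    qed
    then show ?thesis by blast
  qed
  ultimately have "(\<lambda>n. prob (A n)) \<longlonglongrightarrow> 0" by simp
  then have "eventually (\<lambda>n. prob (A n) < \<epsilon>) sequentially" using \<open>\<epsilon> > 0\<close> by (rule order_tendstoD)
  then have "eventually (\<lambda>n. prob (A n) < \<epsilon> \<and> n > 0) sequentially" 
    using eventually_gt_at_top[of "0::nat"] by eventually_elim simp
  then obtain n where "prob (A n) < \<epsilon>" "n > 0" by (auto simp: eventually_sequentially)
  then show ?thesis using that[of "real n"] by (auto simp: A_def)
qed

text \<open>A continuous cutoff that is 0 for \<bar>x\<bar> \<le> r and 1 for \<bar>x\<bar> \<ge> 2r
  lies between the two indicators. Its integrals converge, so no continuity point of the limit law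
  has to be chosen.\<close>

lemma weak_conv_tight:
  assumes \<mu>: "\<And>n. real_distribution (\<mu> n)" and \<nu>: "real_distribution \<nu>" and conv: "weak_conv_m \<mu> \<nu>"
    and "\<epsilon> > 0"
  obtains R n0 where "R > 0" "\<And>n. n \<ge> n0 \<Longrightarrow> measure (\<mu> n) {x. \<bar>x\<bar> > R} \<le> \<epsilon>"
proof -
  interpret \<nu>: real_distribution \<nu> by (rule \<nu>)
  have "id \<in> borel_measurable \<nu>" by simp
  then obtain r where r: "r > 0" "measure \<nu> {x. \<bar>x\<bar> > r} < \<epsilon> / 2"
    using \<nu>.tail_small[of id "\<epsilon> / 2"] \<open>\<epsilon> > 0\<close> by (auto simp: space_borel)
  define f where "f x = max 0 (min 1 (\<bar>x\<bar> / r - 1))" for x :: real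
  have f_bd: "0 \<le> f x" "f x \<le> 1" for x by (auto simp: f_def)
  have f_meas [measurable]: "f \<in> borel_measurable borel" unfolding f_def by measurable
  have "isCont f x" for x unfolding f_def using r by (intro continuous_intros) auto
  then have "(\<lambda>n. integral\<^sup>L (\<mu> n) f) \<longlonglongrightarrow> integral\<^sup>L \<nu> f"
    using f_bd by (intro weak_conv_imp_bdd_ae_continuous_conv[where B=1] \<mu> \<nu> conv) auto
  moreover have "integral\<^sup>L \<nu> f < \<epsilon>"
  proof -
    have "integral\<^sup>L \<nu> f \<le> integral\<^sup>L \<nu> (indicator {x. \<bar>x\<bar> > r})"
      using f_bd r by (intro integral_mono \<nu>.integrable_const_bound[where B=1])
        (auto simp: f_def divide_simps min_def split: split_indicator)
    also have "\<dots> = measure \<nu> {x. \<bar>x\<bar> > r}" by (simp add: space_borel)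
    finally show ?thesis using r \<open>\<epsilon> > 0\<close> by simp
  qed
  ultimately have "eventually (\<lambda>n. integral\<^sup>L (\<mu> n) f < \<epsilon>) sequentially" by (rule order_tendstoD)
  then obtain n0 where n0: "\<And>n. n \<ge> n0 \<Longrightarrow> integral\<^sup>L (\<mu> n) f < \<epsilon>" by (auto simp: eventually_sequentially)
  show ?thesis
  proof (rule that[of "2 * r" n0])
    fix n assume n: "n \<ge> n0"
    interpret m: real_distribution "\<mu> n" by (rule \<mu>)
    have "measure (\<mu> n) {x. \<bar>x\<bar> > 2 * r} = integral\<^sup>L (\<mu> n) (indicator {x. \<bar>x\<bar> > 2 * r})"
      by (simp add: space_borel)
    also have "\<dots> \<le> integral\<^sup>L (\<mu> n) f"
      using f_bd r by (intro integral_mono m.integrable_const_bound[where B=1])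
        (auto simp: f_def field_simps split: split_indicator)
    finally show "measure (\<mu> n) {x. \<bar>x\<bar> > 2 * r} \<le> \<epsilon>" using n0[OF n] by simp
  qed (use r in auto)
qed

context quasi_independent_sums
begin

text \<open>Cut the values of \<open>f\<close> into unit cells \<open>A j\<close>. On
  \<open>A j\<close>, a value at time \<open>n\<close> within \<open>R\<close> of the value at time
  0 is within \<open>R + 1\<close> of \<open>j\<close>. If no integer were a good centre, every
  \<open>B j\<close> would have probability above \<open>2 * \<eta>\<close>, and mixing would
  reproduce this inside each cell for large \<open>n\<close>.\<close>

lemma centre_from_mixing:
  fixes f :: "'a \<Rightarrow> real"
  assumes mix: "mixing_map M T" and f [measurable]: "f \<in> borel_measurable M" and "\<eta> > 0"
    and freq: "\<exists>\<^sub>F n in sequentially. prob {y \<in> space M. \<bar>f ((T ^^ n) y) - f y\<bar> > R} \<le> \<eta>"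
  shows "\<exists>x. prob {y \<in> space M. \<bar>f y - x\<bar> > R + 1} \<le> 2 * \<eta>"
proof (rule ccontr)
  assume neg: "\<not> ?thesis"
  define A where "A j = {y \<in> space M. \<lfloor>f y\<rfloor> = j}" for j :: int
  define B where "B j = {y \<in> space M. \<bar>f y - real_of_int j\<bar> > R + 1}" for j :: int
  have [measurable]: "A j \<in> sets M" "B j \<in> sets M" for j unfolding A_def B_def by measurable
  have B: "prob (B j) > 2 * \<eta>" for j using neg unfolding B_def by (meson not_le)
  \<comment> \<open>Finitely many cells carry more than half of the mass. Finiteness allows the
    mixing limit to be taken term by term, and the half accounts for the \<open>2\<close> in
    \<open>2 * \<eta>\<close>.\<close>
  obtain r where r: "prob {y \<in> space M. \<bar>f y\<bar> > r} < 1 / 2" using tail_small[OF f, of "1/2"] by auto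
  define I where "I = {\<lfloor>-r\<rfloor>..\<lfloor>r\<rfloor>}"
  have "1 / 2 < prob {y \<in> space M. \<bar>f y\<bar> \<le> r}"
  proof -
    have "prob {y \<in> space M. \<bar>f y\<bar> \<le> r} = 1 - prob {y \<in> space M. \<not> \<bar>f y\<bar> \<le> r}"
      by (subst prob_neg) (auto)
    then show ?thesis using r by (simp add: not_le)
  qed
  also have "\<dots> \<le> prob (\<Union>j\<in>I. A j)"
    by (intro finite_measure_mono) (auto simp: A_def I_def abs_le_iff intro!: floor_mono)
  also have "\<dots> = (\<Sum>j\<in>I. prob (A j))"
    by (intro finite_measure_finite_Union) (auto simp: I_def disjoint_family_on_def A_def)
  finally have sumA: "1 / 2 < (\<Sum>j\<in>I. prob (A j))" .
  have "(\<lambda>n. \<Sum>j\<in>I. prob ((T ^^ n) -` B j \<inter> space M \<inter> A j)) \<longlonglongrightarrow> (\<Sum>j\<in>I. prob (B j) * prob (A j))"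
    using mix unfolding mixing_map_def by (intro tendsto_sum) auto
  moreover have "\<eta> < (\<Sum>j\<in>I. prob (B j) * prob (A j))"
  proof -
    have "\<eta> < 2 * \<eta> * (\<Sum>j\<in>I. prob (A j))" using sumA \<open>\<eta> > 0\<close> by simp
    also have "\<dots> \<le> (\<Sum>j\<in>I. prob (B j) * prob (A j))"
      unfolding sum_distrib_left using B by (intro sum_mono mult_right_mono) (auto intro: less_imp_le)
    finally show ?thesis .
  qed
  ultimately have ev: "eventually (\<lambda>n. \<eta> < (\<Sum>j\<in>I. prob ((T ^^ n) -` B j \<inter> space M \<inter> A j))) sequentially"
    by (rule order_tendstoD)
  have le: "(\<Sum>j\<in>I. prob ((T ^^ n) -` B j \<inter> space M \<inter> A j)) \<le> prob {y \<in> space M. \<bar>f ((T ^^ n) y) - f y\<bar> > R}" for n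
  proof -
    have ms: "(T ^^ n) -` B j \<inter> space M \<inter> A j \<in> sets M" for j
      using measurable_sets[OF T_pow_meas[of n], of "B j"] by simp
    have "(\<Sum>j\<in>I. prob ((T ^^ n) -` B j \<inter> space M \<inter> A j)) = prob (\<Union>j\<in>I. (T ^^ n) -` B j \<inter> space M \<inter> A j)"
      using ms by (intro finite_measure_finite_Union[symmetric]) (auto simp: I_def disjoint_family_on_def A_def)
    also have "\<dots> \<le> prob {y \<in> space M. \<bar>f ((T ^^ n) y) - f y\<bar> > R}"
    proof (rule finite_measure_mono)
      show "(\<Union>j\<in>I. (T ^^ n) -` B j \<inter> space M \<inter> A j) \<subseteq> {y \<in> space M. \<bar>f ((T ^^ n) y) - f y\<bar> > R}"
      proof
        fix y assume "y \<in> (\<Union>j\<in>I. (T ^^ n) -` B j \<inter> space M \<inter> A j)"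
        then obtain j where j: "y \<in> space M" "\<lfloor>f y\<rfloor> = j" "\<bar>f ((T ^^ n) y) - real_of_int j\<bar> > R + 1"
          by (auto simp: A_def B_def)
        have "real_of_int j \<le> f y" "f y < real_of_int j + 1" using j(2) by linarith+
        then show "y \<in> {y \<in> space M. \<bar>f ((T ^^ n) y) - f y\<bar> > R}" using j by (auto simp: abs_if split: if_splits)
      qed
    qed measurable
    finally show ?thesis .
  qed
  have "\<forall>\<^sub>F n in sequentially. \<not> prob {y \<in> space M. \<bar>f ((T ^^ n) y) - f y\<bar> > R} \<le> \<eta>"
    using ev by eventually_elim (use le in \<open>meson less_le_trans not_le\<close>)
  then show False using freq unfolding frequently_def by blast
qed

text \<open>The set \<open>A'\<close> of points whose whole orbit keeps \<bar>v\<bar> at most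
  \<open>W\<close> is forward invariant, so mixing makes it independent of itself: its probability
  equals its square and is not 1.\<close>

lemma orbit_unbounded:
  assumes mix: "mixing_map M T" and unb: "prob {y \<in> space M. \<bar>v y\<bar> > W} > 0" and "\<epsilon> > 0"
  obtains n where "prob {y \<in> space M. \<forall>k<n. \<bar>v ((T ^^ k) y)\<bar> \<le> W} < \<epsilon>"
proof -
  define A where "A n = {y \<in> space M. \<forall>k<n. \<bar>v ((T ^^ k) y)\<bar> \<le> W}" for n :: nat
  define A' where "A' = {y \<in> space M. \<forall>k. \<bar>v ((T ^^ k) y)\<bar> \<le> W}"
  have [measurable]: "A n \<in> sets M" "A' \<in> sets M" for n unfolding A_def A'_def by measurable
  have "(T ^^ n) -` A' \<inter> space M \<inter> A' = A'" for n
  proof -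
    have "(T ^^ n) y \<in> A'" if "y \<in> A'" for y
      using that T_pow_in_space unfolding A'_def
      by (auto simp flip: comp_apply[of "T ^^ _" "T ^^ _"] funpow_add)
    then show ?thesis by (auto simp: A'_def)
  qed
  then have "(\<lambda>n::nat. prob A') \<longlonglongrightarrow> prob A' * prob A'"
    using mix[unfolded mixing_map_def, rule_format, of A' A'] by simp
  then have "prob A' * prob A' = prob A'" by (simp add: LIMSEQ_const_iff)
  moreover have "prob A' < 1"
  proof -
    have "prob A' \<le> prob {y \<in> space M. \<not> \<bar>v y\<bar> > W}"
      unfolding A'_def by (intro finite_measure_mono) (auto simp: not_less dest: spec[of _ 0])
    also have "\<dots> = 1 - prob {y \<in> space M. \<bar>v y\<bar> > W}" by (subst prob_neg) auto
    finally show ?thesis using unb by simp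
  qed
  ultimately have "prob A' = 0" by (metis less_irrefl mult_cancel_right2)
  have "(\<lambda>n. prob (A n)) \<longlonglongrightarrow> prob (\<Inter>n. A n)"
    by (intro finite_Lim_measure_decseq) (auto simp: decseq_def A_def)
  moreover have "(\<Inter>n. A n) = A'" by (auto simp: A_def A'_def)
  ultimately have "(\<lambda>n. prob (A n)) \<longlonglongrightarrow> 0" using \<open>prob A' = 0\<close> by simp
  then have "eventually (\<lambda>n. prob (A n) < \<epsilon>) sequentially" using \<open>\<epsilon> > 0\<close> by (rule order_tendstoD)
  then show ?thesis using that by (auto simp: eventually_sequentially A_def)
qed

text \<open>Turns three bounds in probability into a point at which all three estimates hold; this
  is how deterministic inequalities for the centres arise.\<close>

lemma outside_three_events:
  assumes "{y \<in> space M. P y} \<in> sets M" "{y \<in> space M. P' y} \<in> sets M" "{y \<in> space M. P'' y} \<in> sets M"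
    and "prob {y \<in> space M. P y} + prob {y \<in> space M. P' y} + prob {y \<in> space M. P'' y} < 1"
  obtains y where "y \<in> space M" "\<not> P y" "\<not> P' y" "\<not> P'' y"
proof -
  have "prob (({y \<in> space M. P y} \<union> {y \<in> space M. P' y}) \<union> {y \<in> space M. P'' y}) \<le>
     prob {y \<in> space M. P y} + prob {y \<in> space M. P' y} + prob {y \<in> space M. P'' y}"
    using measure_Un_le[OF assms(1,2)] measure_Un_le[OF sets.Un[OF assms(1,2)] assms(3)] by linarith
  then have "({y \<in> space M. P y} \<union> {y \<in> space M. P' y}) \<union> {y \<in> space M. P'' y} \<noteq> space M"
    using assms(4) prob_space by auto
  then show ?thesis using that by blast
qed

text \<open>If \<open>a\<close> stayed bounded along a subsequence, then \<open>S n\<close> would be tight along it, hence so would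
  be \<open>S m \<circ> T ^^ n - S m = S n \<circ> T ^^ m - S n\<close>, uniformly in \<open>m\<close>. Mixing turns the left-hand side
  into a difference of independent copies, so every \<open>S m\<close> is concentrated about some \<open>c m\<close>, and the
  maximal inequality then bounds the orbit of \<open>v\<close>.\<close>

lemma normalisation_unbounded:
  assumes mix: "mixing_map M T" and unb: "\<And>W. prob {y \<in> space M. \<bar>v y\<bar> > W} > 0"
    and tight: "\<And>\<eta>. \<eta> > 0 \<Longrightarrow> \<exists>R>0. \<exists>n0. \<forall>n\<ge>n0. prob {y \<in> space M. \<bar>S n y\<bar> > R * a n} \<le> \<eta>"
  shows "filterlim a at_top sequentially"
proof (rule ccontr)
  assume "\<not> filterlim a at_top sequentially"
  then obtain Z0 where "\<not> (\<forall>\<^sub>F n in sequentially. Z0 \<le> a n)" unfolding filterlim_at_top by blast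
  then have fr: "\<exists>\<^sub>F n in sequentially. a n \<le> Z0"
    unfolding frequently_def by (auto elim!: contrapos_nn eventually_mono)
  \<comment> \<open>With concentration at level \<open>4 * \<eta>\<close>, three exceptional events
    have total probability at most 3/4, and the factor \<open>1 + K\<close> of the maximal
    inequality still leaves 1/4.\<close>
  define \<eta> where "\<eta> = 1 / (16 * (1 + K))"
  have eta: "\<eta> > 0" "\<eta> \<le> 1 / 16" using K_pos by (auto simp: \<eta>_def field_simps)
  obtain R n0 where R: "R > 0" and tR: "\<forall>n\<ge>n0. prob {y \<in> space M. \<bar>S n y\<bar> > R * a n} \<le> \<eta>" using tight eta by blast
  define r where "r = R * Z0"
  have fr2: "\<exists>\<^sub>F n in sequentially. prob {y \<in> space M. \<bar>S n y\<bar> > r} \<le> \<eta>"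
  proof -
    have "\<exists>\<^sub>F n in sequentially. a n \<le> Z0 \<and> n \<ge> n0"
      using frequently_eventually_conj[OF fr eventually_ge_at_top[of n0]]
      by (simp add: conj_commute)
    then show ?thesis
    proof (rule frequently_elim1)
      fix n assume n: "a n \<le> Z0 \<and> n0 \<le> n"
      then have "R * a n \<le> r" using R by (simp add: r_def)
      then have "prob {y \<in> space M. \<bar>S n y\<bar> > r} \<le> prob {y \<in> space M. \<bar>S n y\<bar> > R * a n}"
        by (intro finite_measure_mono) auto
      also have "\<dots> \<le> \<eta>" using tR n by blast
      finally show "prob {y \<in> space M. \<bar>S n y\<bar> > r} \<le> \<eta>" .
    qed
  qed
  \<comment> \<open>\<open>centre_from_mixing\<close> widens the radius by 1; the maximum with 0
    covers a negative \<open>Z0\<close>.\<close>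
  define \<rho> where "\<rho> = max 0 (2 * r) + 1"
  have "\<exists>x. prob {y \<in> space M. \<bar>S m y - x\<bar> > \<rho>} \<le> 4 * \<eta>" for m
  proof -
    have le: "prob {y \<in> space M. \<bar>S m ((T ^^ n) y) - S m y\<bar> > max 0 (2 * r)} \<le> 2 * \<eta>"
      if n: "prob {y \<in> space M. \<bar>S n y\<bar> > r} \<le> \<eta>" for n
    proof -
      have sw: "S m ((T ^^ n) y) - S m y = S n ((T ^^ m) y) - S n y" for y
        using S_add[of m n y] S_add[of n m y] by (simp add: add.commute)
      have "prob {y \<in> space M. \<bar>S m ((T ^^ n) y) - S m y\<bar> > max 0 (2 * r)} \<le>
          prob ({y \<in> space M. \<bar>S n ((T ^^ m) y)\<bar> > r} \<union> {y \<in> space M. \<bar>S n y\<bar> > r})"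
        unfolding sw by (intro finite_measure_mono) (auto simp: abs_if split: if_splits)
      also have "\<dots> \<le> prob {y \<in> space M. \<bar>S n ((T ^^ m) y)\<bar> > r} + prob {y \<in> space M. \<bar>S n y\<bar> > r}"
        by (intro measure_Un_le) measurable
      also have "prob {y \<in> space M. \<bar>S n ((T ^^ m) y)\<bar> > r} = prob {y \<in> space M. \<bar>S n y\<bar> > r}"
        by (intro prob_T_pow_Collect) measurable
      finally show ?thesis using n by simp
    qed
    have "\<exists>\<^sub>F n in sequentially. prob {y \<in> space M. \<bar>S m ((T ^^ n) y) - S m y\<bar> > max 0 (2 * r)} \<le> 2 * \<eta>"
      by (rule frequently_elim1[OF fr2 le])
    then have "\<exists>x. prob {y \<in> space M. \<bar>S m y - x\<bar> > \<rho>} \<le> 2 * (2 * \<eta>)"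
      unfolding \<rho>_def by (rule centre_from_mixing[OF mix S_meas, rotated]) (use eta in simp)
    then show ?thesis by simp
  qed
  then obtain c where c: "\<And>m. prob {y \<in> space M. \<bar>S m y - c m\<bar> > \<rho>} \<le> 4 * \<eta>" by metis
  have rho: "\<rho> > 0" by (simp add: \<rho>_def)
  have ms: "{y \<in> space M. \<bar>S m y - x\<bar> > z} \<in> sets M" "{y \<in> space M. \<bar>S m ((T ^^ n) y) - x\<bar> > z} \<in> sets M" 
     "{y \<in> space M. \<bar>v ((T ^^ n) y)\<bar> > z} \<in> sets M" for m n x z
    by measurable
  have pT: "prob {y \<in> space M. \<bar>S k ((T ^^ m) y) - c k\<bar> > \<rho>} \<le> 4 * \<eta>" for k m
    using prob_T_pow_Collect[where P = "\<lambda>y. \<bar>S k y - c k\<bar> > \<rho>" and k = m] c[of k] by simp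
  \<comment> \<open>The centres inherit additivity from the sums up to \<open>3 * \<rho>\<close>, by
    evaluation at one point where all three sums are near their centres.\<close>
  have sub: "\<bar>c n - c m - c (n - m)\<bar> \<le> 3 * \<rho>" if "m \<le> n" for m n
  proof -
    have "prob {y \<in> space M. \<bar>S n y - c n\<bar> > \<rho>} + prob {y \<in> space M. \<bar>S m y - c m\<bar> > \<rho>}
        + prob {y \<in> space M. \<bar>S (n - m) ((T ^^ m) y) - c (n - m)\<bar> > \<rho>} < 1"
      using c[of n] c[of m] pT[of "n - m" m] eta by linarith
    then obtain y where "\<not> \<bar>S n y - c n\<bar> > \<rho>" "\<not> \<bar>S m y - c m\<bar> > \<rho>" "\<not> \<bar>S (n - m) ((T ^^ m) y) - c (n - m)\<bar> > \<rho>"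
      by (rule outside_three_events[OF ms(1) ms(1) ms(2)])
    moreover have "S n y = S m y + S (n - m) ((T ^^ m) y)" using S_add[of m "n - m" y] that by simp
    ultimately show ?thesis by linarith
  qed
  obtain l where l: "l > 0" "prob {y \<in> space M. \<bar>v y\<bar> > l} < \<eta>" using tail_small[OF v_meas eta(1)] by blast
  have pv: "prob {y \<in> space M. \<bar>v ((T ^^ k) y)\<bar> > l} < \<eta>" for k
    using prob_T_pow_Collect[of "\<lambda>y. \<bar>v y\<bar> > l" k] l by simp
  have step: "\<bar>c (Suc k) - c k\<bar> \<le> 2 * \<rho> + l" for k
  proof -
    have "prob {y \<in> space M. \<bar>S (Suc k) y - c (Suc k)\<bar> > \<rho>} + prob {y \<in> space M. \<bar>S k y - c k\<bar> > \<rho>}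
        + prob {y \<in> space M. \<bar>v ((T ^^ k) y)\<bar> > l} < 1"
      using c[of k] c[of "Suc k"] pv[of k] eta by linarith
    then obtain y where "\<not> \<bar>S (Suc k) y - c (Suc k)\<bar> > \<rho>" "\<not> \<bar>S k y - c k\<bar> > \<rho>" "\<not> \<bar>v ((T ^^ k) y)\<bar> > l"
      by (rule outside_three_events[OF ms(1) ms(1) ms(3)])
    then show ?thesis unfolding S_Suc by linarith
  qed
  \<comment> \<open>Here \<open>t - \<kappa> - 3 * \<rho>\<close> equals \<open>\<rho>\<close>, the
    radius of concentration. If two consecutive sums are within \<open>2 * t\<close> of their
    centres, which differ by at most \<open>2 * \<rho> + l\<close>, the summand between them is at
    most \<open>W\<close> in absolute value.\<close>
  define t where "t = 4 * \<rho> + \<kappa>"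
  define W where "W = 4 * t + 2 * \<rho> + l"
  obtain n where n: "prob {y \<in> space M. \<forall>k<n. \<bar>v ((T ^^ k) y)\<bar> \<le> W} < 1 / 2"
    using orbit_unbounded[OF mix unb, of "1/2"] by auto
  have "prob {y \<in> space M. \<exists>k\<le>n. \<bar>S k y - c k\<bar> > 2 * t} \<le> (1 + K) * (4 * \<eta>)"
    using sub c rho by (intro ottaviani[where r = "3 * \<rho>"]) (auto simp: t_def)
  also have "\<dots> = 1 / 4" using K_pos by (simp add: \<eta>_def field_simps)
  finally have 1: "prob {y \<in> space M. \<exists>k\<le>n. \<bar>S k y - c k\<bar> > 2 * t} \<le> 1 / 4" .
  have "space M \<subseteq> {y \<in> space M. \<forall>k<n. \<bar>v ((T ^^ k) y)\<bar> \<le> W} \<union> {y \<in> space M. \<exists>k\<le>n. \<bar>S k y - c k\<bar> > 2 * t}"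
  proof
    fix y assume y: "y \<in> space M"
    have "\<exists>k\<le>n. \<bar>S k y - c k\<bar> > 2 * t" if k: "k < n" "\<not> \<bar>v ((T ^^ k) y)\<bar> \<le> W" for k
    proof -
      have "\<bar>S k y - c k\<bar> > 2 * t \<or> \<bar>S (Suc k) y - c (Suc k)\<bar> > 2 * t"
        using k(2) step[of k] unfolding W_def S_Suc by linarith
      then show ?thesis using k(1) by (metis Suc_leI less_imp_le_nat)
    qed
    then show "y \<in> {y \<in> space M. \<forall>k<n. \<bar>v ((T ^^ k) y)\<bar> \<le> W} \<union> {y \<in> space M. \<exists>k\<le>n. \<bar>S k y - c k\<bar> > 2 * t}"
      using y by blast
  qed
  then have "prob (space M) \<le> prob ({y \<in> space M. \<forall>k<n. \<bar>v ((T ^^ k) y)\<bar> \<le> W} \<union> {y \<in> space M. \<exists>k\<le>n. \<bar>S k y - c k\<bar> > 2 * t})"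
    by (intro finite_measure_mono) measurable
  also have "\<dots> \<le> prob {y \<in> space M. \<forall>k<n. \<bar>v ((T ^^ k) y)\<bar> \<le> W} + prob {y \<in> space M. \<exists>k\<le>n. \<bar>S k y - c k\<bar> > 2 * t}"
    by (intro measure_Un_le) measurable
  finally show False using n 1 prob_space by simp
qed

end

section \<open>Functions with dyadic decay and the associated scale\<close>

text \<open>What the tail of \<bar>v\<bar> and \<open>ell_hat L s / s\<^sup>2\<close> have in
  common. \<open>\<rho>\<close> is the gain per doubling, \<open>\<Gamma>\<close> bounds the loss
  per doubling, and \<open>A\<close> replaces monotonicity within a dyadic block, since the second
  function is not known to be decreasing.\<close>

locale dyadic_decay =
  fixes B :: "real \<Rightarrow> real" and x0 A \<Gamma> \<rho> :: real
  assumes x0: "x0 > 0" and A_ge: "A \<ge> 1" and Gam: "\<Gamma> \<ge> 1" and rho: "0 < \<rho>" "\<rho> < 1"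
    and B_pos: "x \<ge> x0 \<Longrightarrow> B x > 0"
    and B_upper: "x0 \<le> x \<Longrightarrow> x \<le> y \<Longrightarrow> y \<le> 2 * x \<Longrightarrow> B y \<le> A * B x"
    and B_lower: "x0 \<le> x \<Longrightarrow> x \<le> y \<Longrightarrow> y \<le> 2 * x \<Longrightarrow> B x \<le> \<Gamma> * B y"
    and B_double: "x0 \<le> x \<Longrightarrow> B (2 * x) \<le> \<rho> * B x"
begin

lemma pow2_ge: "x0 \<le> x \<Longrightarrow> x0 \<le> 2 ^ j * x"
proof -
  assume x: "x0 \<le> x"
  have "1 * x \<le> 2 ^ j * x" using x x0 by (intro mult_right_mono) auto
  then show ?thesis using x by simp
qed

lemma B_pow2: "x0 \<le> x \<Longrightarrow> B (2 ^ j * x) \<le> \<rho> ^ j * B x"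
proof (induction j)
  case (Suc j)
  have "B (2 ^ Suc j * x) = B (2 * (2 ^ j * x))" by (simp add: mult_ac)
  also have "\<dots> \<le> \<rho> * B (2 ^ j * x)" by (rule B_double[OF pow2_ge[OF Suc.prems]])
  also have "\<dots> \<le> \<rho> * (\<rho> ^ j * B x)" using Suc rho by (intro mult_left_mono) auto
  finally show ?case by simp
qed simp

text \<open>With \<open>j\<close> maximal such that \<open>2 ^ j * x \<le> y\<close>, the dyadic
  steps give the power of \<open>\<rho>\<close> and the remaining factor below 2 costs
  \<open>A\<close>.\<close>

lemma decay:
  assumes "x0 \<le> x" "2 ^ m * x \<le> y"
  shows "B y \<le> A * \<rho> ^ m * B x"
proof -
  have x: "x > 0" using assms x0 by simp
  define j where "j = nat \<lfloor>log 2 (y / x)\<rfloor>"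
  have yx: "2 ^ m \<le> y / x" using assms x by (simp add: field_simps)
  then have yx1: "y / x \<ge> 1" by (meson one_le_power order_trans one_le_numeral)
  then have yx_pos: "y / x > 0" by linarith
  have fl: "0 \<le> \<lfloor>log 2 (y / x)\<rfloor>" using yx1 by simp
  have "real j \<le> log 2 (y / x)" "log 2 (y / x) < real j + 1" unfolding j_def using fl by linarith+
  then have "2 powr real j \<le> y / x" "y / x < 2 powr (real j + 1)"
    using yx_pos by (simp_all add: le_log_iff log_less_iff)
  then have j: "2 ^ j \<le> y / x" "y / x < 2 * 2 ^ j" by (simp_all add: powr_realpow powr_add)
  have jm: "m \<le> j"
  proof (rule ccontr)
    assume "\<not> m \<le> j"
    then have "(2::real) ^ Suc j \<le> 2 ^ m" by (intro power_increasing) auto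
    then show False using j yx by simp
  qed
  have "B y \<le> A * B (2 ^ j * x)"
    using j x by (intro B_upper pow2_ge assms) (auto simp: field_simps)
  also have "\<dots> \<le> A * (\<rho> ^ j * B x)" using A_ge by (intro mult_left_mono B_pow2 assms) auto
  also have "\<dots> \<le> A * (\<rho> ^ m * B x)"
    using A_ge rho jm B_pos[OF assms(1)] by (intro mult_left_mono mult_right_mono power_decreasing) auto
  finally show ?thesis by (simp add: mult_ac)
qed

lemma growth: "x0 \<le> x \<Longrightarrow> x \<le> y \<Longrightarrow> y \<le> 2 ^ j * x \<Longrightarrow> B x \<le> \<Gamma> ^ j * B y"
proof (induction j arbitrary: y)
  case (Suc j)
  have By: "B y > 0" using B_pos Suc.prems by simp
  show ?case
  proof (cases "y \<le> 2 ^ j * x")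
    case True
    then have "B x \<le> \<Gamma> ^ j * B y" using Suc by blast
    also have "\<dots> \<le> \<Gamma> ^ Suc j * B y" using Gam By by (intro mult_right_mono power_increasing) auto
    finally show ?thesis .
  next
    case False
    have "1 * x \<le> 2 ^ j * x" using Suc.prems x0 by (intro mult_right_mono) auto
    then have "B x \<le> \<Gamma> ^ j * B (2 ^ j * x)" using Suc by simp
    also have "\<dots> \<le> \<Gamma> ^ j * (\<Gamma> * B y)"
      using False Suc.prems Gam pow2_ge by (intro mult_left_mono B_lower) (auto simp: mult_ac)
    finally show ?thesis by (simp add: mult_ac)
  qed
qed (use Gam in auto)

lemma decay_factor_small:
  assumes "\<epsilon> > 0" obtains m where "A * \<rho> ^ m < \<epsilon>"
proof -
  have "(\<lambda>m. A * \<rho> ^ m) \<longlonglongrightarrow> A * 0" using rho by (intro tendsto_mult_left LIMSEQ_realpow_zero) auto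
  then have "eventually (\<lambda>m. A * \<rho> ^ m < \<epsilon>) sequentially" using assms by (intro order_tendstoD) auto
  then show ?thesis using that by (auto simp: eventually_sequentially)
qed

context
  fixes a :: "nat \<Rightarrow> real"
  assumes a_inf: "filterlim a at_top sequentially" and aB: "(\<lambda>n. real n * B (a n)) \<longlonglongrightarrow> 1"
begin

lemma eventually_scale:
  "eventually (\<lambda>n. a n \<ge> x \<and> 1 / 2 \<le> real n * B (a n) \<and> real n * B (a n) \<le> 2) sequentially"
proof -
  have "eventually (\<lambda>n. a n \<ge> x) sequentially" using a_inf unfolding filterlim_at_top by blast
  moreover have "eventually (\<lambda>n. real n * B (a n) > 1 / 2) sequentially" using aB by (rule order_tendstoD) simp
  moreover have "eventually (\<lambda>n. real n * B (a n) < 2) sequentially" using aB by (rule order_tendstoD) simp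
  ultimately show ?thesis by eventually_elim simp
qed

text \<open>For every fixed \<open>m\<close>, \<open>N n\<close> is eventually at least
  \<open>m\<close> doublings beyond \<open>a n\<close>, while \<open>real n * B (a n)\<close> stays
  at most 2.\<close>

lemma beyond_scale_null:
  assumes "filterlim (\<lambda>n. N n / a n) at_top sequentially"
  shows "(\<lambda>n. real n * B (N n)) \<longlonglongrightarrow> 0"
proof (rule tendstoI)
  fix \<epsilon> :: real assume "\<epsilon> > 0"
  then obtain m where m: "A * \<rho> ^ m < \<epsilon> / 2" using decay_factor_small[of "\<epsilon> / 2"] by auto
  have "eventually (\<lambda>n. N n / a n \<ge> 2 ^ m) sequentially" using assms unfolding filterlim_at_top by blast
  then show "eventually (\<lambda>n. dist (real n * B (N n)) 0 < \<epsilon>) sequentially"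
    using eventually_scale[of x0]
  proof eventually_elim
    case (elim n)
    have an: "a n > 0" using elim x0 by linarith
    have N: "2 ^ m * a n \<le> N n" using elim(1) an by (simp add: field_simps)
    then have "N n \<ge> x0" using pow2_ge[of "a n" m] elim by linarith
    have "real n * B (N n) \<le> real n * (A * \<rho> ^ m * B (a n))"
      using elim N by (intro mult_left_mono decay) auto
    also have "\<dots> = A * \<rho> ^ m * (real n * B (a n))" by simp
    also have "\<dots> \<le> A * \<rho> ^ m * 2" using elim A_ge rho by (intro mult_left_mono) auto
    also have "\<dots> < \<epsilon>" using m by simp
    finally show ?case using B_pos[OF \<open>N n \<ge> x0\<close>] by simp
  qed
qed

text \<open>If \<open>a k\<close> were more than \<open>m\<close> doublings beyond
  \<open>a n\<close> with \<open>k \<le> n\<close>, then \<open>real k * B (a k)\<close> would fall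
  below 1/2, although it tends to 1. The finitely many small \<open>k\<close> are absorbed because
  \<open>a\<close> tends to infinity.\<close>

lemma scale_quasi_mono:
  obtains C n1 where "C > 0" "\<And>n k. n \<ge> n1 \<Longrightarrow> k \<le> n \<Longrightarrow> a k \<le> C * a n"
proof -
  obtain m where m: "A * \<rho> ^ m < 1 / 4" using decay_factor_small[of "1 / 4"] by auto
  obtain n0 where n0: "\<And>n. n \<ge> n0 \<Longrightarrow> a n \<ge> x0 \<and> 1 / 2 \<le> real n * B (a n) \<and> real n * B (a n) \<le> 2"
    using eventually_scale[of x0] by (auto simp: eventually_sequentially)
  obtain n1 where n1: "\<And>n. n \<ge> n1 \<Longrightarrow> a n \<ge> max 0 (Max (a ` {..n0}))"
    using eventually_scale[of "max 0 (Max (a ` {..n0}))"] by (auto simp: eventually_sequentially)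
  show ?thesis
  proof (rule that[of "2 ^ m" "max n0 n1"])
    fix n k assume nk: "n \<ge> max n0 n1" "k \<le> n"
    have an: "a n \<ge> max 0 (Max (a ` {..n0}))" using n1 nk by simp
    have an2: "a n \<le> 2 ^ m * a n"
      using an by (intro mult_right_mono[of 1 "2 ^ m" "a n", simplified]) auto
    show "a k \<le> 2 ^ m * a n"
    proof (cases "k \<le> n0")
      case True
      then have "a k \<le> Max (a ` {..n0})" by (intro Max_ge) auto
      then show ?thesis using an an2 by linarith
    next
      case False
      show ?thesis
      proof (rule ccontr)
        assume "\<not> a k \<le> 2 ^ m * a n"
        then have "B (a k) \<le> A * \<rho> ^ m * B (a n)" using n0[of n] nk by (intro decay) auto
        moreover have "B (a k) > 0" using n0[of k] False by (intro B_pos) auto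
        ultimately have "real k * B (a k) \<le> real n * (A * \<rho> ^ m * B (a n))"
          using nk by (intro mult_mono) auto
        also have "\<dots> = A * \<rho> ^ m * (real n * B (a n))" by simp
        also have "\<dots> \<le> A * \<rho> ^ m * 2" using n0[of n] nk A_ge rho by (intro mult_left_mono) auto
        finally show False using m n0[of k] False by simp
      qed
    qed
  qed auto
qed

end

end

section \<open>The tail of the maximum at and beyond the scale\<close>

context quasi_independent_sums
begin

text \<open>The maximal inequality asks for control of all sums of length \<open>k \<le> n\<close>
  at the scale of \<open>n\<close>. Beyond \<open>n0\<close>, tightness at scale \<open>a k\<close>
  is transferred by the quasi-monotonicity \<open>qm\<close>; the finitely many other sums are
  dominated because \<open>a n\<close> tends to infinity.\<close>

lemma Q_small_at_scale:
  fixes a :: "nat \<Rightarrow> real"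
  assumes tight: "\<And>\<eta>. \<eta> > 0 \<Longrightarrow> \<exists>R>0. \<exists>n0. \<forall>n\<ge>n0. prob {y \<in> space M. \<bar>S n y\<bar> > R * a n} \<le> \<eta>"
    and a_inf: "filterlim a at_top sequentially"
    and qm: "C > 0" "\<And>n k. n \<ge> n1 \<Longrightarrow> k \<le> n \<Longrightarrow> a k \<le> C * a n"
    and "\<eta> > 0"
  obtains R where "R \<ge> 1" "eventually (\<lambda>n. Q n (R * a n) \<le> \<eta>) sequentially"
proof -
  define \<beta> where "\<beta> = \<eta> / (1 + K)"
  have \<beta>: "\<beta> > 0" "(1 + K) * \<beta> = \<eta>" using K_pos \<open>\<eta> > 0\<close> by (auto simp: \<beta>_def)
  obtain R0 n0 where R0: "R0 > 0" and n0: "\<And>n. n \<ge> n0 \<Longrightarrow> prob {y \<in> space M. \<bar>S n y\<bar> > R0 * a n} \<le> \<beta>"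
    using tight[OF \<beta>(1)] by blast
  have "\<exists>r. prob {y \<in> space M. \<bar>S k y\<bar> > r} \<le> \<beta>" for k
    using tail_small[OF S_meas \<beta>(1), of k] by (metis less_imp_le)
  then obtain r where r: "\<And>k. prob {y \<in> space M. \<bar>S k y\<bar> > r k} \<le> \<beta>" by metis
  define Z where "Z = Max (r ` {..n0})"
  \<comment> \<open>The maximal inequality doubles the threshold
    \<open>R0 * C * a n + \<kappa>\<close>, and eventually
    \<open>\<kappa> \<le> a n\<close>.\<close>
  define R where "R = 2 * R0 * C + 2"
  have "eventually (\<lambda>n. a n \<ge> max \<kappa> (Z / (R0 * C)) \<and> n \<ge> n1) sequentially"
    using a_inf eventually_ge_at_top[of n1] unfolding filterlim_at_top by (intro eventually_conj) blast+
  then have "eventually (\<lambda>n. Q n (R * a n) \<le> \<eta>) sequentially"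
  proof eventually_elim
    case (elim n)
    define t where "t = R0 * C * a n + \<kappa>"
    have Z: "Z \<le> R0 * C * a n" using elim R0 qm(1) by (simp add: field_simps)
    have "prob {y \<in> space M. \<exists>k\<le>n. \<bar>S k y - (\<lambda>_. 0) k\<bar> > 2 * t} \<le> (1 + K) * \<beta>"
    proof (rule ottaviani[where r = 0])
      fix k assume k: "k \<le> n"
      show "prob {y \<in> space M. \<bar>S k y - 0\<bar> > t - \<kappa> - 0} \<le> \<beta>"
      proof (cases "k \<le> n0")
        case True
        then have "r k \<le> Z" unfolding Z_def by (intro Max_ge) auto
        then have "prob {y \<in> space M. \<bar>S k y - 0\<bar> > t - \<kappa> - 0} \<le> prob {y \<in> space M. \<bar>S k y\<bar> > r k}"
          using Z by (intro finite_measure_mono) (auto simp: t_def)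
        then show ?thesis using r[of k] by simp
      next
        case False
        have "R0 * a k \<le> R0 * (C * a n)" using qm(2)[of n k] k elim R0 by (intro mult_left_mono) auto
        then have "prob {y \<in> space M. \<bar>S k y - 0\<bar> > t - \<kappa> - 0} \<le> prob {y \<in> space M. \<bar>S k y\<bar> > R0 * a k}"
          by (intro finite_measure_mono) (auto simp: t_def mult_ac)
        then show ?thesis using n0[of k] False by simp
      qed
    qed auto
    then have "Q n (2 * t) \<le> \<eta>" using \<beta> by (simp add: Q_def)
    moreover have "Q n (R * a n) \<le> Q n (2 * t)"
      using elim by (intro Q_mono) (auto simp: R_def t_def algebra_simps)
    ultimately show ?case by linarith
  qed
  moreover have "R \<ge> 1" using R0 qm(1) by (simp add: R_def)
  ultimately show ?thesis using that by blast
qed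

text \<open>\<open>hoffmann_jorgensen\<close> at level \<open>s / 3\<close> is used recursively: one
  factor of the quadratic term is at most \<open>\<eta>\<close> because \<open>s / 3\<close> is
  beyond \<open>R * a n\<close>, the other is bounded by the estimate already known at
  \<open>s / 4\<close>, and the gap between \<open>s / 4\<close> and \<open>s / 3\<close> absorbs
  \<open>\<kappa>\<close>. Within a factor 4 of \<open>R * a n\<close> the bound is trivial, since
  \<open>real n * B s\<close> is bounded below there.\<close>

lemma Q_beyond_scale:
  fixes a :: "nat \<Rightarrow> real"
  assumes "dyadic_decay B x0 A \<Gamma> \<rho>"
    and tight: "\<And>\<eta>. \<eta> > 0 \<Longrightarrow> \<exists>R>0. \<exists>n0. \<forall>n\<ge>n0. prob {y \<in> space M. \<bar>S n y\<bar> > R * a n} \<le> \<eta>"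
    and a_inf: "filterlim a at_top sequentially" and aB: "(\<lambda>n. real n * B (a n)) \<longlonglongrightarrow> 1"
    and HB: "\<And>x. x \<ge> x0 \<Longrightarrow> prob {y \<in> space M. \<bar>v y\<bar> > x} \<le> A1 * B x"
  obtains C R where "C > 0" "R > 0" "eventually (\<lambda>n. \<forall>s\<ge>R * a n. Q n s \<le> C * (real n * B s)) sequentially"
proof -
  interpret dyadic_decay B x0 A \<Gamma> \<rho> by fact
  obtain C1 n1 where C1: "C1 > 0" "\<And>n k. n \<ge> n1 \<Longrightarrow> k \<le> n \<Longrightarrow> a k \<le> C1 * a n"
    using scale_quasi_mono[OF a_inf aB] by blast
  \<comment> \<open>Passing from \<open>s / 4\<close> back to \<open>s\<close> costs
    \<open>\<Gamma>^2\<close>; with this \<open>\<eta>\<close> the quadratic term uses half of the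
    constant \<open>C\<close>.\<close>
  define \<eta> where "\<eta> = 1 / (2 * K * \<Gamma>^2)"
  have eta: "\<eta> > 0" "K * \<eta> * \<Gamma>^2 = 1 / 2" using K_pos Gam by (auto simp: \<eta>_def field_simps)
  obtain R where R: "R \<ge> 1" and QR: "eventually (\<lambda>n. Q n (R * a n) \<le> \<eta>) sequentially"
    using Q_small_at_scale[OF tight a_inf C1 eta(1)] by blast
  obtain j :: nat where j: "4 * R < 2 ^ j" using real_arch_pow[of 2 "4 * R"] by auto
  \<comment> \<open>The first entry makes the base range trivial; the second confines the
    single-summand term to the other half of \<open>C\<close>.\<close>
  define C where "C = max (2 * \<Gamma> ^ j) (2 * max A1 0 * \<Gamma>^2)"
  have C: "C \<ge> 2 * \<Gamma> ^ j" "C \<ge> 2 * max A1 0 * \<Gamma>^2" by (auto simp: C_def)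
  have Cpos: "C > 0" using C(1) Gam by (meson less_le_trans mult_pos_pos zero_less_numeral zero_less_one zero_less_power)
  have "eventually (\<lambda>n. \<forall>s\<ge>R * a n. Q n s \<le> C * (real n * B s)) sequentially"
    using QR eventually_scale[OF a_inf aB, of "max (3 * x0) (12 * \<kappa>)"]
  proof eventually_elim
    case (elim n)
    define s0 where "s0 = R * a n"
    have an: "a n \<ge> 3 * x0" "a n \<ge> 12 * \<kappa>" "1 / 2 \<le> real n * B (a n)" using elim by auto
    then have anp: "a n > 0" using x0 by linarith
    have s0a: "a n \<le> s0" using R anp by (simp add: s0_def)
    have base: "Q n s \<le> C * (real n * B s)" if "s0 \<le> s" "s \<le> 4 * s0" for s
    proof -
      have "4 * s0 \<le> 2 ^ j * a n" using j anp by (simp add: s0_def)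
      then have g: "B (a n) \<le> \<Gamma> ^ j * B s" using that s0a an x0 by (intro growth) auto
      have "1 \<le> 2 * (real n * B (a n))" using an by simp
      also have "\<dots> \<le> 2 * (real n * (\<Gamma> ^ j * B s))" using g by (intro mult_left_mono) auto
      also have "\<dots> = (2 * \<Gamma> ^ j) * (real n * B s)" by simp
      also have "\<dots> \<le> C * (real n * B s)"
        using B_pos[of s] that s0a an x0 by (intro mult_right_mono C mult_nonneg_nonneg) auto
      finally show ?thesis using Q_le_1[of n s] by linarith
    qed
    have main: "Q n s \<le> C * (real n * B s)" if "s0 \<le> s" "s \<le> 4 ^ i * s0" for s i
      using that
    proof (induction i arbitrary: s)
      case 0 then show ?case using base s0a anp by simp
    next
      case (Suc i)
      show ?case
      proof (cases "s \<le> 4 * s0")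
        case True then show ?thesis using base Suc by blast
      next
        case False
        have s3: "s / 3 \<ge> x0" "s / 4 \<ge> s0" using False s0a an x0 by auto
        have sp: "s > 0" using s3 s0a anp by linarith
        have Bs: "B s > 0" using s3 x0 by (intro B_pos) auto
        have k: "s / 4 \<le> s / 3 - \<kappa>" using False s0a an kappa_pos by simp
        have B3: "B (s / 3) \<le> \<Gamma>^2 * B s" and B4: "B (s / 4) \<le> \<Gamma>^2 * B s"
          using s3 s0a an x0 by (auto intro!: growth)
        have IH: "Q n (s / 4) \<le> C * (real n * B (s / 4))" using Suc s3 by (intro Suc.IH) auto
        have "Q n s \<le> real n * prob {y \<in> space M. \<bar>v y\<bar> > s / 3} + K * Q n (s / 3 - \<kappa>) * Q n (s / 3)"
          using hoffmann_jorgensen[of "s / 3" n] sp by simp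
        also have "\<dots> \<le> real n * (max A1 0 * (\<Gamma>^2 * B s)) + K * (C * (real n * (\<Gamma>^2 * B s))) * \<eta>"
        proof (intro add_mono mult_left_mono)
          have "prob {y \<in> space M. \<bar>v y\<bar> > s / 3} \<le> A1 * B (s / 3)" using HB s3 by blast
          also have "\<dots> \<le> max A1 0 * B (s / 3)" using B_pos[OF s3(1)] by (intro mult_right_mono) auto
          also have "\<dots> \<le> max A1 0 * (\<Gamma>^2 * B s)" by (intro mult_left_mono B3) auto
          finally show "prob {y \<in> space M. \<bar>v y\<bar> > s / 3} \<le> max A1 0 * (\<Gamma>^2 * B s)" .
          have "Q n (s / 3) \<le> Q n (R * a n)" using False s0a anp unfolding s0_def[symmetric] by (intro Q_mono) auto
          then have q1: "Q n (s / 3) \<le> \<eta>" using elim by simp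
          have "Q n (s / 3 - \<kappa>) \<le> Q n (s / 4)" by (intro Q_mono k) simp
          also note IH
          also have "C * (real n * B (s / 4)) \<le> C * (real n * (\<Gamma>^2 * B s))"
            using Cpos by (intro mult_left_mono B4) auto
          finally have q2: "Q n (s / 3 - \<kappa>) \<le> C * (real n * (\<Gamma>^2 * B s))" .
          show "K * Q n (s / 3 - \<kappa>) * Q n (s / 3) \<le> K * (C * (real n * (\<Gamma>^2 * B s))) * \<eta>"
            using q1 q2 K_pos Q_nonneg Cpos Bs Gam
            by (intro mult_mono mult_left_mono mult_nonneg_nonneg) auto
        qed auto
        also have "\<dots> = (max A1 0 * \<Gamma>^2 + (K * \<eta> * \<Gamma>^2) * C) * (real n * B s)" by (simp add: algebra_simps)
        also have "\<dots> \<le> C * (real n * B s)"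
          unfolding eta(2) using C(2) Bs by (intro mult_right_mono mult_nonneg_nonneg) auto
        finally show ?thesis .
      qed
    qed
    show ?case
    proof (intro allI impI)
      fix s assume s: "s \<ge> R * a n"
      have s0p: "s0 > 0" using s0a anp by linarith
      obtain i :: nat where "s / s0 < 4 ^ i" using real_arch_pow[of 4 "s / s0"] by auto
      then have "s \<le> 4 ^ i * s0" using s0p by (simp add: field_simps)
      then show "Q n s \<le> C * (real n * B s)" using main s by (simp add: s0_def)
    qed
  qed
  then show ?thesis using that[of C R] Cpos R by simp
qed

end

section \<open>One big jump\<close>

context quasi_independent_sums
begin

text \<open>Divided by \<open>real n * B (N n)\<close>, the bounds of \<open>large_sum_upper\<close>
  and \<open>large_sum_lower\<close> leave a difference of tail ratios plus a bounded multiple of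
  \<open>real n * B (N n)\<close>, which vanishes. The limiting differences are small with
  \<open>e\<close>, by continuity of \<open>c powr (- \<alpha>)\<close> at 1.\<close>

lemma single_big_jump:
  fixes N a :: "nat \<Rightarrow> real" and B :: "real \<Rightarrow> real"
  assumes B_pos: "\<And>x. B x > 0"
    and B_ratio: "\<And>c. c > 0 \<Longrightarrow> ((\<lambda>x. B (c * x) / B x) \<longlongrightarrow> c powr (- \<alpha>)) at_top"
    and tail: "\<And>c. c > 0 \<Longrightarrow> ((\<lambda>x. prob {y \<in> space M. v y > c * x} / B x) \<longlongrightarrow> p * c powr (- \<alpha>)) at_top"
    and N_inf: "filterlim N at_top sequentially"
    and N_a: "filterlim (\<lambda>n. N n / a n) at_top sequentially" and a_pos: "\<And>n. a n > 0"
    and NB: "(\<lambda>n. real n * B (N n)) \<longlonglongrightarrow> 0"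
    and R: "R > 0"
    and Qb: "eventually (\<lambda>n. \<forall>s\<ge>R * a n. Q n s \<le> C * (real n * B s)) sequentially"
  shows "(\<lambda>n. (prob {y \<in> space M. S n y > N n} - real n * prob {y \<in> space M. v y > N n}) / (real n * B (N n))) \<longlonglongrightarrow> 0"
proof (rule tendstoI)
  fix \<epsilon> :: real assume "\<epsilon> > 0"
  define u where "u c n = prob {y \<in> space M. v y > c * N n} / B (N n)" for c n
  have u_lim: "(\<lambda>n. u c n) \<longlonglongrightarrow> p * c powr (- \<alpha>)" if "c > 0" for c
    unfolding u_def by (rule filterlim_compose[OF tail[OF that] N_inf])
  have "((\<lambda>e. p * (1 - 2 * e) powr (- \<alpha>) - p) \<longlongrightarrow> p * (1 - 2 * 0) powr (- \<alpha>) - p) (at_right 0)"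
    by (intro tendsto_intros) auto
  then have e1: "eventually (\<lambda>e. p * (1 - 2 * e) powr (- \<alpha>) - p < \<epsilon> / 2) (at_right 0)"
    using \<open>\<epsilon> > 0\<close> by (intro order_tendstoD) auto
  have "((\<lambda>e. p - p * (1 + 2 * e) powr (- \<alpha>)) \<longlongrightarrow> p - p * (1 + 2 * 0) powr (- \<alpha>)) (at_right 0)"
    by (intro tendsto_intros) auto
  then have e2: "eventually (\<lambda>e. p - p * (1 + 2 * e) powr (- \<alpha>) < \<epsilon> / 2) (at_right 0)"
    using \<open>\<epsilon> > 0\<close> by (intro order_tendstoD) auto
  have e3: "eventually (\<lambda>e. 0 < e \<and> e < 1 / 4) (at_right (0::real))"
    by (auto simp: eventually_at_right_field intro!: exI[of _ "1/4"])
  have "eventually (\<lambda>e. (p * (1 - 2 * e) powr (- \<alpha>) - p < \<epsilon> / 2 \<and> p - p * (1 + 2 * e) powr (- \<alpha>) < \<epsilon> / 2) \<and> 0 < e \<and> e < 1 / 4) (at_right 0)"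
    by (rule eventually_conj[OF eventually_conj[OF e1 e2] e3])
  \<comment> \<open>\<open>e\<close> is fixed before \<open>n\<close>, so all remaining limits are
    taken at constant ratios; \<open>e < 1 / 4\<close> keeps \<open>1 - 2 * e\<close>
    positive.\<close>
  then obtain e where e: "p * (1 - 2 * e) powr (- \<alpha>) - p < \<epsilon> / 2" "p - p * (1 + 2 * e) powr (- \<alpha>) < \<epsilon> / 2" "0 < e" "e < 1 / 4"
    using eventually_happens'[of "at_right (0::real)"] by (metis (no_types, lifting) trivial_limit_at_right_real)
  \<comment> \<open>For large \<open>n\<close> the level \<open>e / 2 * N n\<close> lies below both
    \<open>e * N n\<close> and \<open>e * N n - \<kappa>\<close> and is still beyond
    \<open>R * a n\<close>, so one bound for \<open>Q\<close> serves both factors.\<close>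
  define w where "w n = B (e / 2 * N n) / B (N n)" for n
  have w_lim: "w \<longlonglongrightarrow> (e / 2) powr (- \<alpha>)"
    unfolding w_def by (rule filterlim_compose[OF B_ratio N_inf]) (use e in simp)
  define z where "z n = real n * B (N n)" for n
  have z_lim: "z \<longlonglongrightarrow> 0" using NB by (simp add: z_def[abs_def])
  have q_ev: "eventually (\<lambda>n. Q n (e / 2 * N n) \<le> C * w n * z n) sequentially"
  proof -
    have "eventually (\<lambda>n. N n / a n \<ge> 2 * R / e) sequentially" using N_a unfolding filterlim_at_top by blast
    then show ?thesis using Qb
    proof eventually_elim
      case (elim n)
      have "R * a n \<le> e / 2 * N n" using elim(1) a_pos[of n] e by (simp add: field_simps)
      then have "Q n (e / 2 * N n) \<le> C * (real n * B (e / 2 * N n))" using elim(2) by blast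
      also have "\<dots> = C * w n * z n" using B_pos[of "N n"] by (simp add: w_def z_def)
      finally show ?case .
    qed
  qed
  have up_lim: "(\<lambda>n. u (1 - 2 * e) n - u 1 n + K * ((C * w n) * (C * w n) * z n)) \<longlonglongrightarrow>
      p * (1 - 2 * e) powr (- \<alpha>) - p * 1 powr (- \<alpha>) + K * ((C * (e / 2) powr (- \<alpha>)) * (C * (e / 2) powr (- \<alpha>)) * 0)"
    using e by (intro tendsto_intros u_lim w_lim z_lim) auto
  have up_ev: "eventually (\<lambda>n. u (1 - 2 * e) n - u 1 n + K * ((C * w n) * (C * w n) * z n) < \<epsilon>) sequentially"
    by (rule order_tendstoD(2)[OF up_lim]) (use e \<open>\<epsilon> > 0\<close> in simp)
  have lo_lim: "(\<lambda>n. u 1 n - u (1 + 2 * e) n + K * (2 * (C * w n * z n)) * u 1 n) \<longlonglongrightarrow>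
      p * 1 powr (- \<alpha>) - p * (1 + 2 * e) powr (- \<alpha>) + K * (2 * (C * (e / 2) powr (- \<alpha>) * 0)) * (p * 1 powr (- \<alpha>))"
    using e by (intro tendsto_intros u_lim w_lim z_lim) auto
  have lo_ev: "eventually (\<lambda>n. u 1 n - u (1 + 2 * e) n + K * (2 * (C * w n * z n)) * u 1 n < \<epsilon>) sequentially"
    by (rule order_tendstoD(2)[OF lo_lim]) (use e \<open>\<epsilon> > 0\<close> in simp)
  have N_ev: "eventually (\<lambda>n. N n \<ge> max 1 (2 * \<kappa> / e)) sequentially" using N_inf unfolding filterlim_at_top by blast
  show "eventually (\<lambda>n. dist ((prob {y \<in> space M. S n y > N n} - real n * prob {y \<in> space M. v y > N n}) / (real n * B (N n))) 0 < \<epsilon>) sequentially"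
    using q_ev up_ev lo_ev N_ev eventually_gt_at_top[of "0::nat"]
  proof eventually_elim
    case (elim n)
    have N: "N n > 0" using elim(4) by simp
    have eN: "e * N n - \<kappa> \<ge> e / 2 * N n" using elim(4) e by (simp add: field_simps)
    define q where "q = Q n (e / 2 * N n)"
    have q: "0 \<le> q" "q \<le> C * w n * z n" using elim(1) Q_nonneg by (auto simp: q_def)
    have q1: "Q n (e * N n - \<kappa>) \<le> q" unfolding q_def using eN by (intro Q_mono) auto
    have q2: "Q n (e * N n) \<le> q" unfolding q_def using eN kappa_pos by (intro Q_mono) auto
    have zp: "z n > 0" using elim(5) B_pos by (simp add: z_def)
    have BN: "B (N n) > 0" by (rule B_pos)
    have ueq: "prob {y \<in> space M. v y > c * N n} = u c n * B (N n)" for c using BN by (simp add: u_def)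
    have ueq1: "prob {y \<in> space M. v y > N n} = u 1 n * B (N n)" using ueq[of 1] by simp
    have u1: "u 1 n \<ge> 0" using BN by (simp add: u_def)
    have "prob {y \<in> space M. S n y > N n} \<le> real n * prob {y \<in> space M. v y > (1 - 2 * e) * N n} + K * Q n (e * N n - \<kappa>) * Q n (e * N n)"
      using e N by (intro large_sum_upper) auto
    also have "K * Q n (e * N n - \<kappa>) * Q n (e * N n) \<le> K * (C * w n * z n) * (C * w n * z n)"
      using q q1 q2 K_pos Q_nonneg by (intro mult_mono mult_left_mono) (auto intro: order_trans)
    finally have "prob {y \<in> space M. S n y > N n} \<le> u (1 - 2 * e) n * z n + K * (C * w n * z n) * (C * w n * z n)"
      unfolding ueq by (simp add: z_def mult_ac)
    then have "prob {y \<in> space M. S n y > N n} - u 1 n * z n \<le> 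
       (u (1 - 2 * e) n - u 1 n + K * ((C * w n) * (C * w n) * z n)) * z n"
      by (simp add: algebra_simps)
    also have "\<dots> < \<epsilon> * z n" using elim(2) zp by (intro mult_strict_right_mono)
    finally have up: "prob {y \<in> space M. S n y > N n} - u 1 n * z n < \<epsilon> * z n" .
    have "real n * (prob {y \<in> space M. v y > (1 + 2 * e) * N n} 
        - K * (2 * (C * w n * z n)) * prob {y \<in> space M. v y > N n}) \<le>
      real n * (prob {y \<in> space M. v y > (1 + 2 * e) * N n} 
        - K * (Q n (e * N n - \<kappa>) + Q n (e * N n)) * prob {y \<in> space M. v y > (1 + 2 * e) * N n - \<kappa>})"
    proof (intro mult_left_mono diff_left_mono)
      have "prob {y \<in> space M. v y > (1 + 2 * e) * N n - \<kappa>} \<le> prob {y \<in> space M. v y > N n}"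
      proof (rule finite_measure_mono)
        have "(1 + 2 * e) * N n - \<kappa> = N n + (e * N n - \<kappa>) + e * N n" by (simp add: algebra_simps)
        moreover have "0 \<le> e * N n" "0 \<le> e / 2 * N n" using e N by simp_all
        ultimately have "(1 + 2 * e) * N n - \<kappa> \<ge> N n" using eN by linarith
        then show "{y \<in> space M. v y > (1 + 2 * e) * N n - \<kappa>} \<subseteq> {y \<in> space M. v y > N n}" by auto
      qed measurable
      then show "K * (Q n (e * N n - \<kappa>) + Q n (e * N n)) * prob {y \<in> space M. v y > (1 + 2 * e) * N n - \<kappa>}
         \<le> K * (2 * (C * w n * z n)) * prob {y \<in> space M. v y > N n}"
        using q q1 q2 K_pos Q_nonneg by (intro mult_mono mult_left_mono) auto
    qed auto
    also have "\<dots> \<le> prob {y \<in> space M. S n y > N n}" using e N by (intro large_sum_lower) auto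
    finally have "u (1 + 2 * e) n * z n - K * (2 * (C * w n * z n)) * u 1 n * z n \<le> prob {y \<in> space M. S n y > N n}"
      unfolding ueq ueq1 by (simp add: z_def algebra_simps)
    then have "u 1 n * z n - prob {y \<in> space M. S n y > N n} \<le>
       (u 1 n - u (1 + 2 * e) n + K * (2 * (C * w n * z n)) * u 1 n) * z n"
      by (simp add: algebra_simps)
    also have "\<dots> < \<epsilon> * z n" using elim(3) zp by (intro mult_strict_right_mono)
    finally have lo: "u 1 n * z n - prob {y \<in> space M. S n y > N n} < \<epsilon> * z n" .
    have "real n * prob {y \<in> space M. v y > N n} = u 1 n * z n" unfolding ueq1 by (simp add: z_def)
    then have "\<bar>prob {y \<in> space M. S n y > N n} - real n * prob {y \<in> space M. v y > N n}\<bar> < \<epsilon> * z n"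
      using up lo by linarith
    then have "\<bar>prob {y \<in> space M. S n y > N n} - real n * prob {y \<in> space M. v y > N n}\<bar> / z n < \<epsilon>"
      using zp by (simp add: divide_less_eq)
    then show ?case using zp unfolding z_def using BN by (simp add: dist_real_def abs_divide abs_mult)
  qed
qed

end

section \<open>The truncated second moment\<close>

lemma set_integral_mono_subset:
  fixes f :: "'a \<Rightarrow> real"
  assumes "set_integrable M B f" "A \<in> sets M" "A \<subseteq> B" "\<And>x. x \<in> B \<Longrightarrow> 0 \<le> f x"
  shows "(LINT u:A|M. f u) \<le> (LINT u:B|M. f u)"
  unfolding set_lebesgue_integral_def
proof (rule integral_mono)
  show "integrable M (\<lambda>x. indicator A x *\<^sub>R f x)" "integrable M (\<lambda>x. indicator B x *\<^sub>R f x)"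
    using set_integrable_subset[OF assms(1-3)] assms(1) by (simp_all add: set_integrable_def)
  show "indicator A x *\<^sub>R f x \<le> indicator B x *\<^sub>R f x" for x
    using assms(3,4) by (auto simp: indicator_def)
qed

context
  fixes L :: "real \<Rightarrow> real"
  assumes sv: "slowly_varying L" and sv_loc: "\<forall>x\<ge>1. set_integrable lborel {1..x} L"
begin

lemma slowly_varying_pos: "x > 0 \<Longrightarrow> L x > 0"
  using sv by (simp add: slowly_varying_def)

lemma slowly_varying_measurable [measurable]: "L \<in> borel_measurable borel"
  using sv by (simp add: slowly_varying_def)

lemma set_integrable_L_div: 
  assumes "1 \<le> a" shows "set_integrable lborel {a..b} (\<lambda>u. L u / u)"
proof -
  have "set_integrable lborel {1..max 1 b} L" using sv_loc by simp
  then have "set_integrable lborel {1..max 1 b} (\<lambda>u. L u / u)"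
    unfolding set_integrable_def
  proof (rule Bochner_Integration.integrable_bound)
    show "AE x in lborel. norm (indicator {1..max 1 b} x *\<^sub>R (L x / x)) \<le> norm (indicator {1..max 1 b} x *\<^sub>R L x)"
      by (auto simp: indicator_def divide_le_eq mult_le_cancel_left1 abs_mult intro!: AE_I2)
  qed measurable
  then show ?thesis by (rule set_integrable_subset) (use assms in auto)
qed

text \<open>The integral in \<open>ell_hat\<close> as a set integral, so that monotonicity in the
  domain is available.\<close>

definition log_primitive :: "real \<Rightarrow> real" where
  "log_primitive x = (LINT u:{1..x}|lborel. L u / u)"

lemma ell_hat_eq: "x \<ge> 0 \<Longrightarrow> ell_hat L x = 1 + log_primitive (1 + x)"
proof -
  assume x: "x \<ge> 0"
  have "(LBINT u=ereal 1..ereal (1 + x). L u / u) = (LBINT u:{1..1 + x}. L u / u)"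
    using x by (intro interval_integral_Icc) simp
  then show ?thesis unfolding ell_hat_def log_primitive_def by (simp add: one_ereal_def)
qed

lemma log_integral_mono:
  assumes "1 \<le> a" "a \<le> b" "d \<le> c" 
  shows "(LINT u:{b..d}|lborel. L u / u) \<le> (LINT u:{a..c}|lborel. L u / u)"
proof (rule set_integral_mono_subset)
  show "set_integrable lborel {a..c} (\<lambda>u. L u / u)" using assms by (intro set_integrable_L_div)
  show "0 \<le> L x / x" if "x \<in> {a..c}" for x
    using slowly_varying_pos[of x] assms that by simp
qed (use assms in auto)

lemma log_primitive_nonneg: "0 \<le> log_primitive x"
  unfolding log_primitive_def set_lebesgue_integral_def
  by (intro Bochner_Integration.integral_nonneg)
    (auto simp: indicator_def intro!: divide_nonneg_nonneg less_imp_le[OF slowly_varying_pos])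

lemma ell_hat_ge_1: "x \<ge> 0 \<Longrightarrow> ell_hat L x \<ge> 1"
  using log_primitive_nonneg by (simp add: ell_hat_eq)

lemma ell_hat_mono: "0 \<le> x \<Longrightarrow> x \<le> y \<Longrightarrow> ell_hat L x \<le> ell_hat L y"
  by (simp add: ell_hat_eq log_primitive_def log_integral_mono)

text \<open>Replacing \<open>u\<close> by \<open>2 * u\<close> carries \<open>{b..2 * b}\<close> to
  \<open>{2 * b..4 * b}\<close> and leaves du/u invariant, so slow variation bounds the integral
  over the outer block by twice that over the inner one. The factor 3 is crude but below
  \<open>2\<^sup>2\<close>, as the decay of \<open>ell_hat L s / s\<^sup>2\<close> requires.\<close>

lemma ell_hat_double:
  obtains x0 where "x0 > 0" "\<And>x. x \<ge> x0 \<Longrightarrow> ell_hat L (2 * x) \<le> 3 * ell_hat L x"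
proof -
  have "((\<lambda>x. L (2 * x) / L x) \<longlongrightarrow> 1) at_top" using sv by (simp add: slowly_varying_def)
  then have "eventually (\<lambda>x. L (2 * x) / L x < 2) at_top" by (rule order_tendstoD) simp
  then obtain u0 where u0: "\<And>x. x \<ge> u0 \<Longrightarrow> L (2 * x) / L x < 2" by (auto simp: eventually_at_top_linorder)
  show ?thesis
  proof (rule that[of "max 1 (2 * u0)"])
    fix x assume x: "x \<ge> max 1 (2 * u0)"
    \<comment> \<open>\<open>2 * b\<close> is the upper limit in \<open>ell_hat L x\<close>, and
      \<open>4 * b\<close> exceeds the limit \<open>1 + 2 * x\<close> in
      \<open>ell_hat L (2 * x)\<close>.\<close>
    define b where "b = (1 + x) / 2"
    have b: "b \<ge> 1" "b \<ge> u0" "2 * b = 1 + x" using x by (auto simp: b_def)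
    have "(LINT u:{2 * b..4 * b}|lborel. L u / u) = (LINT u:{b..2 * b}|lborel. L (2 * u) / u)"
    proof -
      have "(\<integral>u. indicator {2 * b..4 * b} u *\<^sub>R (L u / u) \<partial>lborel) = 
          2 * (\<integral>u. indicator {2 * b..4 * b} (0 + 2 * u) *\<^sub>R (L (0 + 2 * u) / (0 + 2 * u)) \<partial>lborel)"
        by (subst lborel_integral_real_affine[where t = 0 and c = 2]) auto
      also have "\<dots> = (\<integral>u. 2 * (indicator {2 * b..4 * b} (0 + 2 * u) *\<^sub>R (L (0 + 2 * u) / (0 + 2 * u))) \<partial>lborel)"
        by (rule integral_mult_right_zero[symmetric])
      also have "\<dots> = (\<integral>u. indicator {b..2 * b} u *\<^sub>R (L (2 * u) / u) \<partial>lborel)"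
        by (intro Bochner_Integration.integral_cong) (auto simp: indicator_def)
      finally show ?thesis by (simp add: set_lebesgue_integral_def)
    qed
    also have "\<dots> \<le> (LINT u:{b..2 * b}|lborel. 2 * (L u / u))"
    proof (rule set_integral_mono)
      show i2: "set_integrable lborel {b..2 * b} (\<lambda>u. 2 * (L u / u))"
        using b by (intro set_integrable_mult_right set_integrable_L_div)
      have le: "L (2 * u) / u \<le> 2 * (L u / u)" "0 \<le> L (2 * u) / u" if "u \<in> {b..2 * b}" for u
        using u0[of u] that b slowly_varying_pos[of u] slowly_varying_pos[of "2 * u"] by (auto simp: field_simps)
      then show "\<And>u. u \<in> {b..2 * b} \<Longrightarrow> L (2 * u) / u \<le> 2 * (L u / u)" by blast
      show "set_integrable lborel {b..2 * b} (\<lambda>u. L (2 * u) / u)"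
        using i2 unfolding set_integrable_def
      proof (rule Bochner_Integration.integrable_bound)
        show "AE x in lborel. norm (indicator {b..2 * b} x *\<^sub>R (L (2 * x) / x)) \<le> norm (indicator {b..2 * b} x *\<^sub>R (2 * (L x / x)))"
        proof (rule AE_I2)
          fix x
          show "norm (indicator {b..2 * b} x *\<^sub>R (L (2 * x) / x)) \<le> norm (indicator {b..2 * b} x *\<^sub>R (2 * (L x / x)))"
          proof (cases "x \<in> {b..2 * b}")
            case True
            have "\<bar>L (2 * x) / x\<bar> \<le> \<bar>2 * (L x / x)\<bar>" using le[OF True] by linarith
            then show ?thesis using True by simp
          qed simp
        qed
      qed measurable
    qed
    also have "\<dots> = 2 * (LINT u:{b..2 * b}|lborel. L u / u)" by (rule set_integral_mult_right)
    also have "\<dots> \<le> 2 * log_primitive (2 * b)"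
      unfolding log_primitive_def using b by (intro mult_left_mono log_integral_mono) auto
    finally have 1: "(LINT u:{2 * b..4 * b}|lborel. L u / u) \<le> 2 * log_primitive (2 * b)" .
    have "log_primitive (1 + 2 * x) \<le> log_primitive (4 * b)"
      unfolding log_primitive_def using b x by (intro log_integral_mono) auto
    also have "\<dots> \<le> log_primitive (2 * b) + (LINT u:{2 * b..4 * b}|lborel. L u / u)"
    proof -
      have int: "set_integrable lborel A (\<lambda>u. L u / u)" if "A \<in> sets lborel" "A \<subseteq> {1..4 * b}" for A
        using set_integrable_subset[OF set_integrable_L_div[of 1 "4 * b"]] that by simp
      have "log_primitive (4 * b) = (LINT u:{1..2 * b} \<union> {2 * b<..4 * b}|lborel. L u / u)"
      proof -
        have "{1..2 * b} \<union> {2 * b<..4 * b} = {1..4 * b}" using b by auto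
        then show ?thesis by (simp add: log_primitive_def)
      qed
      also have "\<dots> = log_primitive (2 * b) + (LINT u:{2 * b<..4 * b}|lborel. L u / u)"
        unfolding log_primitive_def using b by (intro set_integral_Un int) auto
      also have "(LINT u:{2 * b<..4 * b}|lborel. L u / u) \<le> (LINT u:{2 * b..4 * b}|lborel. L u / u)"
      proof (rule set_integral_mono_subset)
        show "0 \<le> L x / x" if "x \<in> {2 * b..4 * b}" for x
          using slowly_varying_pos[of x] b that by simp
      qed (use int b in auto)
      finally show ?thesis by simp
    qed
    finally have "log_primitive (1 + 2 * x) \<le> 3 * log_primitive (1 + x)" using 1 b by simp
    then show "ell_hat L (2 * x) \<le> 3 * ell_hat L x" using x by (simp add: ell_hat_eq)
  qed simp
qed

text \<open>Doubling gains \<open>3 / 2\<^sup>2\<close>; monotonicity of \<open>ell_hat L\<close>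
  confines the loss to the factor \<open>2\<^sup>2\<close> from the denominator.\<close>

lemma ell_hat_dyadic_decay:
  obtains x0 where "dyadic_decay (\<lambda>x. ell_hat L x / x\<^sup>2) x0 3 4 (3 / 4)"
proof -
  obtain x0 where x0: "x0 > 0" and dbl: "\<And>x. x \<ge> x0 \<Longrightarrow> ell_hat L (2 * x) \<le> 3 * ell_hat L x"
    using ell_hat_double by blast
  have "dyadic_decay (\<lambda>x. ell_hat L x / x\<^sup>2) x0 3 4 (3 / 4)"
  proof
    fix x assume x: "x0 \<le> x"
    show "ell_hat L x / x\<^sup>2 > 0" using ell_hat_ge_1[of x] x x0 by (intro divide_pos_pos) auto
    have "ell_hat L (2 * x) / (2 * x)\<^sup>2 \<le> 3 * ell_hat L x / (2 * x)\<^sup>2" using dbl[OF x] by (intro divide_right_mono) auto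
    then show "ell_hat L (2 * x) / (2 * x)\<^sup>2 \<le> 3 / 4 * (ell_hat L x / x\<^sup>2)" by (simp add: power2_eq_square)
  next
    fix x y assume xy: "x0 \<le> x" "x \<le> y" "y \<le> 2 * x"
    have p: "0 < x\<^sup>2" "x\<^sup>2 \<le> y\<^sup>2" "y\<^sup>2 \<le> (2 * x)\<^sup>2"
      using xy x0 power_mono[of x y 2] power_mono[of y "2 * x" 2] by auto
    have "ell_hat L y \<le> ell_hat L (2 * x)" using xy x0 by (intro ell_hat_mono) auto
    also have "\<dots> \<le> 3 * ell_hat L x" by (rule dbl[OF xy(1)])
    finally have "ell_hat L y / y\<^sup>2 \<le> 3 * ell_hat L x / x\<^sup>2"
      using p ell_hat_ge_1[of x] xy x0 by (intro frac_le) auto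
    then show "ell_hat L y / y\<^sup>2 \<le> 3 * (ell_hat L x / x\<^sup>2)" by simp
    have "ell_hat L x / x\<^sup>2 = 4 * (ell_hat L x / (2 * x)\<^sup>2)" by (simp add: power2_eq_square)
    also have "ell_hat L x / (2 * x)\<^sup>2 \<le> ell_hat L y / y\<^sup>2"
      using p ell_hat_mono[of x y] ell_hat_ge_1[of x] xy x0 by (intro frac_le) auto
    finally show "ell_hat L x / x\<^sup>2 \<le> 4 * (ell_hat L y / y\<^sup>2)" by simp
  qed (use x0 in auto)
  then show ?thesis by (rule that)
qed

text \<open>Monotonicity of \<open>H\<close> makes the comparison with \<open>L\<close> uniform on
  \<open>{x / 2..x}\<close>: there \<open>L u / u\<close> is at least \<open>H x * x / 4\<close>,
  and integration over a length of \<open>x / 2\<close> produces the constant 8.\<close>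

lemma antimono_le_ell_hat:
  fixes H :: "real \<Rightarrow> real"
  assumes H: "\<And>x y. x \<le> y \<Longrightarrow> H y \<le> H x" "\<And>x. H x \<ge> 0"
    and HL: "((\<lambda>x. H x / (L x * x powr (- 2))) \<longlongrightarrow> 1) at_top"
  obtains x0 where "\<And>x. x \<ge> x0 \<Longrightarrow> H x \<le> 8 * (ell_hat L x / x\<^sup>2)"
proof -
  have "eventually (\<lambda>x. H x / (L x * x powr (- 2)) < 2) at_top" using HL by (rule order_tendstoD) simp
  then obtain u0 where u0: "\<And>x. x \<ge> u0 \<Longrightarrow> H x / (L x * x powr (- 2)) < 2" by (auto simp: eventually_at_top_linorder)
  show ?thesis
  proof (rule that[of "max 2 (2 * u0)"])
    fix x assume x: "x \<ge> max 2 (2 * u0)"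
    have pt: "H x * x / 4 \<le> L u / u" if u: "u \<in> {x / 2..x}" for u
    proof -
      have up: "u > 0" "u \<ge> u0" using u x by auto
      have "H u < 2 * (L u / u\<^sup>2)"
        using u0[OF up(2)] slowly_varying_pos[OF up(1)] up by (simp add: powr_minus powr_numeral field_simps)
      then have "H u * u / 2 \<le> L u / u" using up by (simp add: field_simps power2_eq_square)
      moreover have "H x * (x / 2) \<le> H u * u" using H u x by (intro mult_mono) auto
      ultimately show ?thesis by linarith
    qed
    have "H x * x / 4 * (x / 2) = (LINT u:{x / 2..x}|lborel. H x * x / 4)"
      using x by (simp add: set_integral_const set_lebesgue_integral_def)
    also have "\<dots> \<le> (LINT u:{x / 2..x}|lborel. L u / u)"
      using pt x by (intro set_integral_mono set_integrable_L_div) (auto simp: set_integrable_def)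
    also have "\<dots> \<le> log_primitive (1 + x)" unfolding log_primitive_def using x by (intro log_integral_mono) auto
    also have "\<dots> \<le> ell_hat L x" using x by (simp add: ell_hat_eq)
    finally have "H x * x\<^sup>2 \<le> 8 * ell_hat L x" by (simp add: power2_eq_square)
    then have "H x \<le> 8 * ell_hat L x / x\<^sup>2" using x by (simp add: field_simps)
    then show "H x \<le> 8 * (ell_hat L x / x\<^sup>2)" by simp
  qed
qed

end

section \<open>Regularly varying tails\<close>

locale regular_tails = prob_space M
  for M :: "'a measure" +
  fixes v :: "'a \<Rightarrow> real" and L :: "real \<Rightarrow> real" and \<alpha> p q :: real
  assumes v_meas' [measurable]: "v \<in> borel_measurable M"
    and sv: "slowly_varying L" and alpha_pos: "\<alpha> > 0"
    and pq: "p > 0" "q > 0" "p + q = 1"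
    and tail_pos: "(\<lambda>x. prob {y\<in>space M. v y > x}) \<sim>[at_top] (\<lambda>x. p * L x * x powr (- \<alpha>))"
    and tail_neg: "(\<lambda>x. prob {y\<in>space M. v y < - x}) \<sim>[at_top] (\<lambda>x. q * L x * x powr (- \<alpha>))"
begin

definition h :: "real \<Rightarrow> real" where "h x = L x * x powr (- \<alpha>)"

text \<open>This tail, rather than the asymptotically equal \<open>h\<close>, serves as decay
  function for \<alpha> < 2: it is antimonotone and positive on the whole line, whereas
  \<open>h\<close> need not be monotone.\<close>

definition H :: "real \<Rightarrow> real" where "H x = prob {y \<in> space M. \<bar>v y\<bar> > x}"

lemma h_pos: "x > 0 \<Longrightarrow> h x > 0"
proof -
  assume x: "x > 0"
  have "\<forall>x>0. L x > 0" using sv unfolding slowly_varying_def by blast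
  then have "L x > 0" using x by blast
  then show ?thesis unfolding h_def using x by (intro mult_pos_pos) simp_all
qed

text \<open>Asymptotic equivalence tolerates simultaneous zeros; positivity of \<open>h\<close>
  turns it into convergence of a plain quotient.\<close>

lemma ratio_from_equiv:
  assumes "f \<sim>[at_top] (\<lambda>x. r * L x * x powr (- \<alpha>))" "r > 0"
  shows "((\<lambda>x. f x / h x) \<longlongrightarrow> r) at_top"
proof -
  have pos: "eventually (\<lambda>x. x > (0::real)) at_top" by (rule eventually_gt_at_top)
  have "((\<lambda>x. f x / (r * L x * x powr (- \<alpha>))) \<longlongrightarrow> 1) at_top"
  proof (rule asymp_equivD_strong[OF assms(1)])
    show "eventually (\<lambda>x. f x \<noteq> 0 \<or> r * L x * x powr (- \<alpha>) \<noteq> 0) at_top"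
      using pos
    proof eventually_elim
      case (elim x)
      then show ?case using h_pos[of x] assms(2) by (auto simp: h_def)
    qed
  qed
  then have "((\<lambda>x. r * (f x / (r * L x * x powr (- \<alpha>)))) \<longlongrightarrow> r * 1) at_top" by (intro tendsto_intros)
  moreover have "(\<lambda>x. r * (f x / (r * L x * x powr (- \<alpha>)))) = (\<lambda>x. f x / h x)"
    using assms(2) by (auto simp: h_def fun_eq_iff)
  ultimately show ?thesis by simp
qed

lemma h_ratio: "c > 0 \<Longrightarrow> ((\<lambda>x. h (c * x) / h x) \<longlongrightarrow> c powr (- \<alpha>)) at_top"
proof -
  assume c: "c > 0"
  have "((\<lambda>x. L (c * x) / L x) \<longlongrightarrow> 1) at_top" using sv c unfolding slowly_varying_def by blast
  then have "((\<lambda>x. L (c * x) / L x * c powr (- \<alpha>)) \<longlongrightarrow> 1 * c powr (- \<alpha>)) at_top" by (intro tendsto_intros)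
  moreover have "eventually (\<lambda>x. L (c * x) / L x * c powr (- \<alpha>) = h (c * x) / h x) at_top"
    using eventually_gt_at_top[of "0::real"]
    by eventually_elim (use c in \<open>simp add: h_def powr_mult\<close>)
  ultimately have "((\<lambda>x. h (c * x) / h x) \<longlongrightarrow> 1 * c powr (- \<alpha>)) at_top"
    by (rule Lim_transform_eventually)
  then show ?thesis by simp
qed

lemma H_h: "((\<lambda>x. H x / h x) \<longlongrightarrow> 1) at_top"
proof -
  have "((\<lambda>x. prob {y\<in>space M. v y > x} / h x + prob {y\<in>space M. v y < - x} / h x) \<longlongrightarrow> p + q) at_top"
    using pq by (intro tendsto_add ratio_from_equiv tail_pos tail_neg) auto
  moreover have "eventually (\<lambda>x. prob {y\<in>space M. v y > x} / h x + prob {y\<in>space M. v y < - x} / h x = H x / h x) at_top"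
    using eventually_gt_at_top[of "0::real"]
  proof eventually_elim
    case (elim x)
    have "H x = prob ({y\<in>space M. v y > x} \<union> {y\<in>space M. v y < - x})"
      unfolding H_def by (rule arg_cong[where f = prob]) auto
    also have "\<dots> = prob {y\<in>space M. v y > x} + prob {y\<in>space M. v y < - x}"
      using elim by (intro finite_measure_Union) auto
    finally show ?case by (simp add: add_divide_distrib)
  qed
  ultimately have "((\<lambda>x. H x / h x) \<longlongrightarrow> p + q) at_top" by (rule Lim_transform_eventually)
  then show ?thesis using pq by simp
qed

lemma H_antimono: "x \<le> y \<Longrightarrow> H y \<le> H x"
  unfolding H_def by (intro finite_measure_mono) auto

text \<open>A zero of \<open>H\<close> would propagate to all larger arguments by monotonicity,
  against \<open>H_h\<close>. It follows that \<open>v\<close> is essentially unbounded, on which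
  the growth of the normalisation relies.\<close>

lemma H_pos: "H x > 0"
proof -
  have "eventually (\<lambda>z. H z / h z > 0) at_top" using H_h by (rule order_tendstoD) simp
  then have "eventually (\<lambda>z. H z / h z > 0 \<and> z \<ge> x) at_top" using eventually_ge_at_top[of x] by (rule eventually_conj)
  then obtain z where z: "H z / h z > 0" "z \<ge> x" unfolding eventually_at_top_linorder by blast
  have "H z \<ge> 0" by (simp add: H_def)
  then have "H z > 0" using z(1) by (cases "H z = 0") auto
  then show ?thesis using H_antimono[OF z(2)] by linarith
qed

lemma tail_ratio_of:
  assumes f: "((\<lambda>x. f x / h x) \<longlongrightarrow> r) at_top" and c: "c > 0"
  shows "((\<lambda>x. f (c * x) / H x) \<longlongrightarrow> r * c powr (- \<alpha>)) at_top"
proof -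
  have "filterlim (\<lambda>x. c * x) at_top at_top" using c by (intro filterlim_tendsto_pos_mult_at_top[OF tendsto_const]) (auto simp: filterlim_ident)
  then have "((\<lambda>x. f (c * x) / h (c * x)) \<longlongrightarrow> r) at_top" by (rule filterlim_compose[OF f])
  then have "((\<lambda>x. f (c * x) / h (c * x) * (h (c * x) / h x) / (H x / h x)) \<longlongrightarrow> r * c powr (- \<alpha>) / 1) at_top"
    using c by (intro tendsto_intros h_ratio H_h) auto
  moreover have "eventually (\<lambda>x. f (c * x) / h (c * x) * (h (c * x) / h x) / (H x / h x) = f (c * x) / H x) at_top"
    using eventually_gt_at_top[of "0::real"]
  proof eventually_elim
    case (elim x)
    have "h x \<noteq> 0" "h (c * x) \<noteq> 0" using h_pos[of x] h_pos[of "c * x"] elim c by auto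
    then show ?case by simp
  qed
  ultimately have "((\<lambda>x. f (c * x) / H x) \<longlongrightarrow> r * c powr (- \<alpha>) / 1) at_top"
    by (rule Lim_transform_eventually)
  then show ?thesis by simp
qed

lemma H_ratio: "c > 0 \<Longrightarrow> ((\<lambda>x. H (c * x) / H x) \<longlongrightarrow> c powr (- \<alpha>)) at_top"
  using tail_ratio_of[OF H_h, of c] by simp

lemma pos_tail_ratio: "c > 0 \<Longrightarrow> ((\<lambda>x. prob {y \<in> space M. v y > c * x} / H x) \<longlongrightarrow> p * c powr (- \<alpha>)) at_top"
  by (rule tail_ratio_of[OF ratio_from_equiv[OF tail_pos pq(1)]])

lemma neg_tail_ratio: "c > 0 \<Longrightarrow> ((\<lambda>x. prob {y \<in> space M. - v y > c * x} / H x) \<longlongrightarrow> q * c powr (- \<alpha>)) at_top"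
proof -
  assume c: "c > 0"
  have "{y \<in> space M. - v y > x} = {y \<in> space M. v y < - x}" for x by auto
  then show ?thesis using tail_ratio_of[OF ratio_from_equiv[OF tail_neg pq(2)] c] by simp
qed

text \<open>The doubling ratio tends to \<open>2 powr (- \<alpha>)\<close>, strictly between 0 and
  1, so eventually it lies between \<open>r / 2\<close> and \<open>(1 + r) / 2\<close>;
  antimonotonicity gives the constant \<open>1\<close> within dyadic blocks.\<close>

lemma H_dyadic_decay:
  obtains x0 \<Gamma> \<rho> where "dyadic_decay H x0 1 \<Gamma> \<rho>"
proof -
  define r where "r = 2 powr (- \<alpha>)"
  have r: "0 < r" "r < 1" using alpha_pos by (auto simp: r_def powr_less_one)
  have lim: "((\<lambda>x. H (2 * x) / H x) \<longlongrightarrow> r) at_top" using H_ratio[of 2] by (simp add: r_def)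
  have "eventually (\<lambda>x. r / 2 < H (2 * x) / H x \<and> H (2 * x) / H x < (1 + r) / 2) at_top"
    by (intro eventually_conj order_tendstoD[OF lim]) (use r in auto)
  then obtain x1 where x1: "\<And>x. x \<ge> x1 \<Longrightarrow> r / 2 < H (2 * x) / H x \<and> H (2 * x) / H x < (1 + r) / 2"
    by (auto simp: eventually_at_top_linorder)
  have "dyadic_decay H (max 1 x1) 1 (2 / r) ((1 + r) / 2)"
  proof
    fix x assume x: "max 1 x1 \<le> x"
    show "H (2 * x) \<le> (1 + r) / 2 * H x" using x1[of x] x H_pos[of x] by (simp add: field_simps)
  next
    fix x y assume xy: "max 1 x1 \<le> x" "x \<le> y" "y \<le> 2 * x"
    show "H y \<le> 1 * H x" using H_antimono xy by simp
    have "H x \<le> 2 / r * H (2 * x)" using x1[of x] xy H_pos[of x] r by (simp add: field_simps)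
    also have "\<dots> \<le> 2 / r * H y" using H_antimono xy r by (intro mult_left_mono) auto
    finally show "H x \<le> 2 / r * H y" .
  qed (use r H_pos in auto)
  then show ?thesis by (rule that)
qed

end

section \<open>Application to Gibbs-Markov maps\<close>

lemma neg_birkhoff_sum: "birkhoff_sum T (\<lambda>y. - v y) n y = - birkhoff_sum T v n y"
  by (simp add: birkhoff_sum_def sum_negf)

context gibbs_markov_map
begin

lemma quasi_independent_sums_lipschitz:
  assumes v: "v \<in> borel_measurable M" and lip: "(SUP j\<in>J. D_loc \<theta> T Om J v j) < \<infinity>"
  obtains K \<kappa> where "quasi_independent_sums M T v same_upto K \<kappa>"
    "quasi_independent_sums M T (\<lambda>y. - v y) same_upto K \<kappa>"
proof -
  obtain K where K: "K > 0"
    and qi: "\<And>k A B. A \<subseteq> space M \<Longrightarrow> (\<And>y y'. y \<in> A \<Longrightarrow> y' \<in> space M \<Longrightarrow> same_upto k y y' \<Longrightarrow> y' \<in> A) \<Longrightarrow> B \<in> sets M \<Longrightarrow>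
       A \<in> sets M \<and> measure M (A \<inter> (T ^^ k) -` B) \<le> K * measure M A * measure M B"
    using quasi_independence by blast
  obtain \<kappa> where \<kappa>: "\<kappa> > 0"
    and osc1: "\<And>k i y y'. y \<in> space M \<Longrightarrow> y' \<in> space M \<Longrightarrow> same_upto k y y' \<Longrightarrow> i \<le> k \<Longrightarrow>
       \<bar>birkhoff_sum T v i y - birkhoff_sum T v i y'\<bar> \<le> \<kappa>"
    and osc2: "\<And>k i y y'. y \<in> space M \<Longrightarrow> y' \<in> space M \<Longrightarrow> same_upto k y y' \<Longrightarrow> i < k \<Longrightarrow>
       \<bar>v ((T ^^ i) y) - v ((T ^^ i) y')\<bar> \<le> \<kappa>"
    using lipschitz_oscillation[OF lip] by blast
  have base: "quasi_independent_sums M T w same_upto K \<kappa>"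
    if w: "w \<in> borel_measurable M"
      and o1: "\<And>k i y y'. y \<in> space M \<Longrightarrow> y' \<in> space M \<Longrightarrow> same_upto k y y' \<Longrightarrow> i \<le> k \<Longrightarrow>
         \<bar>birkhoff_sum T w i y - birkhoff_sum T w i y'\<bar> \<le> \<kappa>"
      and o2: "\<And>k i y y'. y \<in> space M \<Longrightarrow> y' \<in> space M \<Longrightarrow> same_upto k y y' \<Longrightarrow> i < k \<Longrightarrow>
         \<bar>w ((T ^^ i) y) - w ((T ^^ i) y')\<bar> \<le> \<kappa>" for w
    by unfold_locales
      (fact T_measurable distr_T w same_upto_refl same_upto_sym same_upto_trans same_upto_mono K \<kappa> qi o1 o2)+
  show ?thesis
  proof (rule that)
    show "quasi_independent_sums M T v same_upto K \<kappa>" by (rule base[OF v osc1 osc2])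
    show "quasi_independent_sums M T (\<lambda>y. - v y) same_upto K \<kappa>"
    proof (rule base)
      show "(\<lambda>y. - v y) \<in> borel_measurable M" using v by simp
      show "\<bar>birkhoff_sum T (\<lambda>y. - v y) i y - birkhoff_sum T (\<lambda>y. - v y) i y'\<bar> \<le> \<kappa>"
        if "y \<in> space M" "y' \<in> space M" "same_upto k y y'" "i \<le> k" for k i y y'
        using osc1[OF that] unfolding neg_birkhoff_sum by linarith
      show "\<bar>- v ((T ^^ i) y) - - v ((T ^^ i) y')\<bar> \<le> \<kappa>"
        if "y \<in> space M" "y' \<in> space M" "same_upto k y y'" "i < k" for k i y y'
        using osc2[OF that] by linarith
    qed
  qed
qed

end

lemma (in quasi_independent_sums) weak_conv_sums_tight:
  assumes a_pos: "\<And>n. a n > 0" and \<nu>: "real_distribution \<nu>"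
    and conv: "weak_conv_m (\<lambda>n. distr M borel (\<lambda>y. S n y / a n)) \<nu>" and "\<eta> > 0"
  shows "\<exists>R>0. \<exists>n0. \<forall>n\<ge>n0. prob {y \<in> space M. \<bar>S n y\<bar> > R * a n} \<le> \<eta>"
proof -
  have "real_distribution (distr M borel (\<lambda>y. S n y / a n))" for n
    by (rule real_distribution_distr) measurable
  then obtain R n0 where R: "R > 0" 
    and tight: "\<And>n. n \<ge> n0 \<Longrightarrow> measure (distr M borel (\<lambda>y. S n y / a n)) {x. \<bar>x\<bar> > R} \<le> \<eta>"
    using weak_conv_tight[OF _ \<nu> conv \<open>\<eta> > 0\<close>] by blast
  have "prob {y \<in> space M. \<bar>S n y\<bar> > R * a n} \<le> \<eta>" if "n \<ge> n0" for n
  proof -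
    have "measure (distr M borel (\<lambda>y. S n y / a n)) {x. \<bar>x\<bar> > R} 
        = prob ((\<lambda>y. S n y / a n) -` {x. \<bar>x\<bar> > R} \<inter> space M)"
      by (rule measure_distr) auto
    also have "(\<lambda>y. S n y / a n) -` {x. \<bar>x\<bar> > R} \<inter> space M = {y \<in> space M. \<bar>S n y\<bar> > R * a n}"
      using a_pos[of n] by (auto simp: abs_divide less_divide_eq)
    finally show ?thesis using tight[OF that] by simp
  qed
  then show ?thesis using R by blast
qed

lemma smallo_of_ratio:
  fixes d h H :: "nat \<Rightarrow> real"
  assumes "(\<lambda>n. d n / (real n * H n)) \<longlonglongrightarrow> 0" "(\<lambda>n. H n / h n) \<longlonglongrightarrow> 1" "\<And>n. H n > 0"
    and "eventually (\<lambda>n. h n > 0) sequentially"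
  shows "(\<lambda>n. \<bar>d n\<bar>) \<in> o(\<lambda>n. real n * h n)"
proof (rule smalloI_tendsto)
  have "(\<lambda>n. \<bar>d n / (real n * H n)\<bar> * (H n / h n)) \<longlonglongrightarrow> \<bar>0\<bar> * 1" by (intro tendsto_intros assms)
  moreover have "eventually (\<lambda>n. \<bar>d n / (real n * H n)\<bar> * (H n / h n) = \<bar>d n\<bar> / (real n * h n)) sequentially"
    using assms(4) eventually_gt_at_top[of "0::nat"]
  proof eventually_elim
    case (elim n)
    then show ?case using assms(3)[of n] by (simp add: abs_divide abs_mult)
  qed
  ultimately have "(\<lambda>n. \<bar>d n\<bar> / (real n * h n)) \<longlonglongrightarrow> \<bar>0\<bar> * 1" by (rule Lim_transform_eventually)
  then show "(\<lambda>n. \<bar>d n\<bar> / (real n * h n)) \<longlonglongrightarrow> 0" by simp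
  show "eventually (\<lambda>n. real n * h n \<noteq> 0) sequentially"
    using assms(4) eventually_gt_at_top[of "0::nat"] by eventually_elim simp
qed

theorem theorem1p3:
  fixes M :: "'a measure" and T :: "'a \<Rightarrow> 'a" and Om :: "nat \<Rightarrow> 'a set" and J :: "nat set"
    and \<theta> :: real and v :: "'a \<Rightarrow> real" and \<alpha> p q \<delta> :: real and L :: "real \<Rightarrow> real"
    and a :: "nat \<Rightarrow> real" and N :: "nat \<Rightarrow> real"
  defines "b \<equiv> (\<lambda>n::nat. if \<alpha> < 1 then 0 else real n * integral\<^sup>L M v)"
  defines "D \<equiv> (\<lambda>x::real. if \<alpha> < 1 then ln x * L x * x powr (- \<alpha>) else x powr (- (\<alpha> - \<delta>)))"
  assumes GM: "gibbs_markov M T Om J \<theta>"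
    and mix: "mixing_map M T"
    and v_meas: "v \<in> borel_measurable M"
    and v_sq: "(\<integral>\<^sup>+ y. ennreal ((v y)\<^sup>2) \<partial>M) = \<infinity>"
    and alpha: "\<alpha> \<in> {0<..<1} \<union> {1<..2}"
    and sv: "slowly_varying L"
    and sv_loc: "\<forall>x\<ge>1. set_integrable lborel {1..x} L"
    and pq: "p > 0" "q > 0" "p + q = 1"
    and tail_pos: "(\<lambda>x. measure M {y\<in>space M. v y > x}) \<sim>[at_top] (\<lambda>x. p * L x * x powr (- \<alpha>))"
    and tail_neg: "(\<lambda>x. measure M {y\<in>space M. v y < - x}) \<sim>[at_top] (\<lambda>x. q * L x * x powr (- \<alpha>))"
    and lip: "(SUP j\<in>J. D_loc \<theta> T Om J v j) < \<infinity>"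
    and lip_inf: "\<exists>C>0. \<forall>j\<in>J. D_loc \<theta> T Om J v j \<le> ereal C * (INF y\<in>Om j. ereal \<bar>v y\<bar>)"
    and mean0: "\<alpha> > 1 \<Longrightarrow> integral\<^sup>L M v = 0"
    and a_pos: "\<forall>n. a n > 0"
    and a_norm1: "\<alpha> < 2 \<Longrightarrow> (\<lambda>n. a n powr \<alpha>) \<sim>[sequentially] (\<lambda>n. real n * L (a n))"
    and a_norm2: "\<alpha> = 2 \<Longrightarrow> (\<lambda>n. (a n)\<^sup>2) \<sim>[sequentially] (\<lambda>n. real n * ell_hat L (a n))"
    and stable: "\<exists>\<nu>. stable_law \<alpha> \<nu> \<and>
        weak_conv_m (\<lambda>n. distr M borel (\<lambda>y. (birkhoff_sum T v n y - b n) / a n)) \<nu>"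
    and delta: "\<delta> > 0"
    and N_inf: "filterlim N at_top sequentially"
    and N_a: "filterlim (\<lambda>n. N n / a n) at_top sequentially"
  shows
    "(\<alpha> < 2 \<longrightarrow>
       (\<exists>f g. f \<in> O(\<lambda>n. D (N n)) \<and> g \<in> o(\<lambda>n. real n * L (N n) * N n powr (- \<alpha>)) \<and>
          (\<forall>n. \<bar>measure M {y\<in>space M. birkhoff_sum T v n y > N n}
                 - real n * measure M {y\<in>space M. v y > N n}\<bar> = f n + g n)) \<and>
       (\<exists>f g. f \<in> O(\<lambda>n. D (N n)) \<and> g \<in> o(\<lambda>n. real n * L (N n) * N n powr (- \<alpha>)) \<and>
          (\<forall>n. \<bar>measure M {y\<in>space M. birkhoff_sum T v n y < - N n}
                 - real n * measure M {y\<in>space M. v y < - N n}\<bar> = f n + g n))) \<and>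
     (\<alpha> = 2 \<longrightarrow>
       (\<exists>f g h. f \<in> O(\<lambda>n. D (N n)) \<and> g \<in> O(\<lambda>n. real n * ln (N n) * N n powr (-2)) \<and>
          h \<in> O(\<lambda>n. real n * ell_hat L (N n) * N n powr (-2)) \<and>
          (\<forall>n. \<bar>measure M {y\<in>space M. birkhoff_sum T v n y > N n}
                 - real n * measure M {y\<in>space M. v y > N n}\<bar> = f n + g n + h n)) \<and>
       (\<exists>f g h. f \<in> O(\<lambda>n. D (N n)) \<and> g \<in> O(\<lambda>n. real n * ln (N n) * N n powr (-2)) \<and>
          h \<in> O(\<lambda>n. real n * ell_hat L (N n) * N n powr (-2)) \<and>
          (\<forall>n. \<bar>measure M {y\<in>space M. birkhoff_sum T v n y \<le> - N n}
                 - real n * measure M {y\<in>space M. v y \<le> - N n}\<bar> = f n + g n + h n)))"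
proof -
  interpret gm: gibbs_markov_map M T Om J \<theta> by unfold_locales (rule GM)
  obtain K \<kappa> where qi: "quasi_independent_sums M T v gm.same_upto K \<kappa>" 
    and qi': "quasi_independent_sums M T (\<lambda>y. - v y) gm.same_upto K \<kappa>"
    using gm.quasi_independent_sums_lipschitz[OF v_meas lip] by blast
  interpret S: quasi_independent_sums M T v gm.same_upto K \<kappa> by (rule qi)
  interpret S': quasi_independent_sums M T "\<lambda>y. - v y" gm.same_upto K \<kappa> by (rule qi')
  have alpha_pos: "\<alpha> > 0" using alpha by auto
  interpret rt: regular_tails M v L \<alpha> p q
    by unfold_locales (fact v_meas sv alpha_pos pq tail_pos tail_neg)+
  \<comment> \<open>The centring vanishes by definition for \<alpha> < 1 and by the zero mean for
    \<alpha> > 1, so tightness holds for the sums themselves.\<close>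
  have b0: "b n = 0" for n using mean0 alpha by (auto simp: b_def)
  obtain \<nu> where \<nu>: "stable_law \<alpha> \<nu>" and conv: "weak_conv_m (\<lambda>n. distr M borel (\<lambda>y. birkhoff_sum T v n y / a n)) \<nu>"
    using stable unfolding b0 by auto
  have tight: "\<exists>R>0. \<exists>n0. \<forall>n\<ge>n0. measure M {y \<in> space M. \<bar>birkhoff_sum T v n y\<bar> > R * a n} \<le> \<eta>" if "\<eta> > 0" for \<eta>
    using S.weak_conv_sums_tight[OF _ _ conv that] \<nu> a_pos by (auto simp: stable_law_def)
  have a_inf: "filterlim a at_top sequentially"
    by (rule S.normalisation_unbounded[OF mix _ tight]) (use rt.H_pos in \<open>auto simp: rt.H_def\<close>)
  have a_pos': "a n > 0" for n using a_pos by blast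
  have N_pos: "eventually (\<lambda>n. N n > 0) sequentially" using N_inf by (simp add: filterlim_at_top_dense)
  \<comment> \<open>Absolute values do not see the sign of \<open>v\<close>, so each bound for
    \<open>S.Q\<close> also serves the lower tail.\<close>
  have Q_neg: "S'.Q n t = S.Q n t" for n t
    unfolding S.Q_def S'.Q_def by (simp add: neg_birkhoff_sum)

  have lt2: "(\<lambda>n. \<bar>measure M {y\<in>space M. birkhoff_sum T v n y > N n} - real n * measure M {y\<in>space M. v y > N n}\<bar>)
       \<in> o(\<lambda>n. real n * L (N n) * N n powr (- \<alpha>)) \<and>
     (\<lambda>n. \<bar>measure M {y\<in>space M. birkhoff_sum T v n y < - N n} - real n * measure M {y\<in>space M. v y < - N n}\<bar>)
       \<in> o(\<lambda>n. real n * L (N n) * N n powr (- \<alpha>))" if "\<alpha> < 2"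
  proof -
    obtain x0 \<Gamma> \<rho> where dd: "dyadic_decay rt.H x0 1 \<Gamma> \<rho>" by (rule rt.H_dyadic_decay)
    interpret dd: dyadic_decay rt.H x0 1 \<Gamma> \<rho> by (rule dd)
    \<comment> \<open>The defining relation of \<open>a\<close> states that
      \<open>real n * rt.h (a n)\<close> tends to 1; as \<open>a\<close> tends to infinity,
      \<open>rt.H\<close> may replace \<open>rt.h\<close>.\<close>
    have aB: "(\<lambda>n. real n * rt.H (a n)) \<longlonglongrightarrow> 1"
    proof -
      have "(\<lambda>n. a n powr \<alpha> / (real n * L (a n))) \<longlonglongrightarrow> 1"
        using a_norm1[OF that] by (rule asymp_equivD_strong) (use a_pos' in \<open>auto intro!: always_eventually simp: less_imp_neq[symmetric]\<close>)
      then have "(\<lambda>n. rt.H (a n) / rt.h (a n) * inverse (a n powr \<alpha> / (real n * L (a n)))) \<longlonglongrightarrow> 1 * inverse 1"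
        by (intro tendsto_intros filterlim_compose[OF rt.H_h a_inf]) auto
      moreover have "rt.H (a n) / rt.h (a n) * inverse (a n powr \<alpha> / (real n * L (a n))) = real n * rt.H (a n)" for n
      proof -
        have "rt.h (a n) > 0" using rt.h_pos a_pos' by blast
        then have "L (a n) \<noteq> 0" by (auto simp: rt.h_def)
        then show ?thesis using a_pos'[of n] by (simp add: rt.h_def powr_minus field_simps)
      qed
      ultimately show ?thesis by simp
    qed
    have NB: "(\<lambda>n. real n * rt.H (N n)) \<longlonglongrightarrow> 0" by (rule dd.beyond_scale_null[OF a_inf aB N_a])
    obtain C R where R: "R > 0" and Qb: "eventually (\<lambda>n. \<forall>s\<ge>R * a n. S.Q n s \<le> C * (real n * rt.H s)) sequentially"
    proof (rule S.Q_beyond_scale[OF dd tight a_inf aB, of 1])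
      show "measure M {y \<in> space M. \<bar>v y\<bar> > x} \<le> 1 * rt.H x" for x by (simp add: rt.H_def)
    qed
    have Hh: "(\<lambda>n. rt.H (N n) / rt.h (N n)) \<longlonglongrightarrow> 1" by (rule filterlim_compose[OF rt.H_h N_inf])
    have h_ev: "eventually (\<lambda>n. rt.h (N n) > 0) sequentially" using N_pos by eventually_elim (rule rt.h_pos)
    have h_eq: "(\<lambda>n. real n * L (N n) * N n powr (- \<alpha>)) = (\<lambda>n. real n * rt.h (N n))" by (simp add: rt.h_def mult.assoc)
    have j1: "(\<lambda>n. (measure M {y \<in> space M. birkhoff_sum T v n y > N n} - real n * measure M {y \<in> space M. v y > N n}) / (real n * rt.H (N n))) \<longlonglongrightarrow> 0"
      by (rule S.single_big_jump[OF rt.H_pos rt.H_ratio rt.pos_tail_ratio N_inf N_a a_pos' NB R Qb])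
    have Qb': "eventually (\<lambda>n. \<forall>s\<ge>R * a n. S'.Q n s \<le> C * (real n * rt.H s)) sequentially" using Qb unfolding Q_neg .
    have "(\<lambda>n. (measure M {y \<in> space M. birkhoff_sum T (\<lambda>y. - v y) n y > N n} - real n * measure M {y \<in> space M. - v y > N n}) / (real n * rt.H (N n))) \<longlonglongrightarrow> 0"
      by (rule S'.single_big_jump[OF rt.H_pos rt.H_ratio rt.neg_tail_ratio N_inf N_a a_pos' NB R Qb'])
    moreover have "{y \<in> space M. - f y > N n} = {y \<in> space M. f y < - N n}" for f :: "'a \<Rightarrow> real" and n by auto
    ultimately have j2: "(\<lambda>n. (measure M {y \<in> space M. birkhoff_sum T v n y < - N n} - real n * measure M {y \<in> space M. v y < - N n}) / (real n * rt.H (N n))) \<longlonglongrightarrow> 0"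
      by (simp add: neg_birkhoff_sum)
    show ?thesis unfolding h_eq
      using smallo_of_ratio[OF j1 Hh rt.H_pos h_ev] smallo_of_ratio[OF j2 Hh rt.H_pos h_ev] by blast
  qed

  have eq2: "(\<lambda>n. \<bar>measure M {y\<in>space M. birkhoff_sum T v n y > N n} - real n * measure M {y\<in>space M. v y > N n}\<bar>)
       \<in> O(\<lambda>n. real n * ell_hat L (N n) * N n powr (-2)) \<and>
     (\<lambda>n. \<bar>measure M {y\<in>space M. birkhoff_sum T v n y \<le> - N n} - real n * measure M {y\<in>space M. v y \<le> - N n}\<bar>)
       \<in> O(\<lambda>n. real n * ell_hat L (N n) * N n powr (-2))" if "\<alpha> = 2"
  proof -
    define B where "B x = ell_hat L x / x\<^sup>2" for x
    obtain x1 where dd1: "dyadic_decay B x1 3 4 (3 / 4)"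
      using ell_hat_dyadic_decay[OF sv sv_loc] unfolding B_def by blast
    have HL: "((\<lambda>x. rt.H x / (L x * x powr (- 2))) \<longlongrightarrow> 1) at_top"
      using rt.H_h[unfolded rt.h_def] that by simp
    obtain x2 where x2: "\<And>x. x \<ge> x2 \<Longrightarrow> rt.H x \<le> 8 * B x"
      using antimono_le_ell_hat[OF sv sv_loc rt.H_antimono _ HL] rt.H_pos unfolding B_def by (meson less_imp_le)
    define x0 where "x0 = max x1 x2"
    interpret d1: dyadic_decay B x1 3 4 "3 / 4" by (rule dd1)
    have dd: "dyadic_decay B x0 3 4 (3 / 4)"
      by unfold_locales (use d1.x0 d1.B_pos d1.B_upper d1.B_lower d1.B_double in \<open>auto simp: x0_def\<close>)
    interpret dd: dyadic_decay B x0 3 4 "3 / 4" by (rule dd)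
    have aB: "(\<lambda>n. real n * B (a n)) \<longlonglongrightarrow> 1"
    proof -
      have "(\<lambda>n. (a n)\<^sup>2 / (real n * ell_hat L (a n))) \<longlonglongrightarrow> 1"
        using a_norm2[OF that] by (rule asymp_equivD_strong) (use a_pos' in \<open>auto intro!: always_eventually simp: less_imp_neq[symmetric]\<close>)
      then have "(\<lambda>n. inverse ((a n)\<^sup>2 / (real n * ell_hat L (a n)))) \<longlonglongrightarrow> inverse 1"
        by (intro tendsto_intros) auto
      then show ?thesis by (simp add: B_def)
    qed
    obtain C R where C: "C > 0" and R: "R > 0" 
      and Qb: "eventually (\<lambda>n. \<forall>s\<ge>R * a n. S.Q n s \<le> C * (real n * B s)) sequentially"
    proof (rule S.Q_beyond_scale[OF dd tight a_inf aB, of 8])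
      show "measure M {y \<in> space M. \<bar>v y\<bar> > x} \<le> 8 * B x" if "x \<ge> x0" for x
        using x2[of x] that by (simp add: x0_def rt.H_def)
    qed
    have Na: "eventually (\<lambda>n. N n / a n \<ge> 2 * R) sequentially" using N_a unfolding filterlim_at_top by blast
    have Nx: "eventually (\<lambda>n. N n \<ge> max 1 (2 * x0)) sequentially" using N_inf unfolding filterlim_at_top by blast
    \<comment> \<open>The two probabilities are bounded separately. Half the threshold is used
      because \<open>S.Q\<close> and \<open>rt.H\<close> are defined by strict inequalities while
      the lower tail has \<open>\<le>\<close>; halving costs the factor 4 of
      \<open>dd.B_lower\<close>, and 32 is this 4 times the 8 of \<open>x2\<close>.\<close>
    have bound: "eventually (\<lambda>n. S.Q n (N n / 2) \<le> 4 * C * (real n * ell_hat L (N n) * N n powr (-2)) \<and>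
        real n * rt.H (N n / 2) \<le> 32 * (real n * ell_hat L (N n) * N n powr (-2)) \<and> N n > 0) sequentially"
      using Qb Na Nx
    proof eventually_elim
      case (elim n)
      have N: "N n > 0" "N n / 2 \<ge> x0" using elim(3) by auto
      have B_eq: "real n * B (N n) = real n * ell_hat L (N n) * N n powr (-2)"
        using N by (simp add: B_def powr_minus powr_numeral field_simps)
      have "B (N n / 2) \<le> 4 * B (N n)" using N dd.x0 by (intro dd.B_lower) auto
      then have B2: "real n * B (N n / 2) \<le> 4 * (real n * B (N n))"
        using mult_left_mono[of "B (N n / 2)" "4 * B (N n)" "real n"] by simp
      have "R * a n \<le> N n / 2" using elim(2) a_pos'[of n] by (simp add: field_simps)
      then have "S.Q n (N n / 2) \<le> C * (real n * B (N n / 2))" using elim(1) by blast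
      also have "\<dots> \<le> C * (4 * (real n * B (N n)))" using C by (intro mult_left_mono B2) auto
      finally have 1: "S.Q n (N n / 2) \<le> 4 * C * (real n * B (N n))" by simp
      have "rt.H (N n / 2) \<le> 8 * B (N n / 2)" using N by (intro x2) (simp add: x0_def)
      then have "real n * rt.H (N n / 2) \<le> real n * (8 * B (N n / 2))" by (intro mult_left_mono) auto
      also have "\<dots> \<le> 8 * (4 * (real n * B (N n)))" using B2 by simp
      finally have 2: "real n * rt.H (N n / 2) \<le> 32 * (real n * B (N n))" by simp
      show ?case using 1 2 N(1) unfolding B_eq by blast
    qed
    have big: "(\<lambda>n. \<bar>F n - real n * G n\<bar>) \<in> O(\<lambda>n. real n * ell_hat L (N n) * N n powr (-2))"
      if F: "\<And>n. N n > 0 \<Longrightarrow> 0 \<le> F n \<and> F n \<le> S.Q n (N n / 2)" 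
        and G: "\<And>n. N n > 0 \<Longrightarrow> 0 \<le> G n \<and> G n \<le> rt.H (N n / 2)" for F G
    proof (rule bigoI)
      show "eventually (\<lambda>n. norm \<bar>F n - real n * G n\<bar> \<le> (4 * C + 32) * norm (real n * ell_hat L (N n) * N n powr (-2))) sequentially"
        using bound
      proof eventually_elim
        case (elim n)
        have "real n * G n \<le> real n * rt.H (N n / 2)" using G[of n] elim by (intro mult_left_mono) auto
        moreover have "0 \<le> real n * G n" using G[of n] elim by simp
        ultimately have "\<bar>F n - real n * G n\<bar> \<le> S.Q n (N n / 2) + real n * rt.H (N n / 2)"
          using F[of n] elim by linarith
        also have "\<dots> \<le> (4 * C + 32) * (real n * ell_hat L (N n) * N n powr (-2))"
          using elim by (simp add: distrib_right)
        also have "\<dots> \<le> (4 * C + 32) * norm (real n * ell_hat L (N n) * N n powr (-2))"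
          using C by (intro mult_left_mono) auto
        finally show ?case by simp
      qed
    qed
    have F1: "0 \<le> measure M {y\<in>space M. birkhoff_sum T v n y > N n} \<and> measure M {y\<in>space M. birkhoff_sum T v n y > N n} \<le> S.Q n (N n / 2)"
      if "N n > 0" for n
      unfolding S.Q_def using that by (auto intro!: gm.finite_measure_mono exI[of _ n])
    have F2: "0 \<le> measure M {y\<in>space M. birkhoff_sum T v n y \<le> - N n} \<and> measure M {y\<in>space M. birkhoff_sum T v n y \<le> - N n} \<le> S.Q n (N n / 2)"
      if "N n > 0" for n
      unfolding S.Q_def using that by (auto intro!: gm.finite_measure_mono exI[of _ n])
    have G1: "0 \<le> measure M {y\<in>space M. v y > N n} \<and> measure M {y\<in>space M. v y > N n} \<le> rt.H (N n / 2)"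
      if "N n > 0" for n
      unfolding rt.H_def using that by (auto intro!: gm.finite_measure_mono)
    have G2: "0 \<le> measure M {y\<in>space M. v y \<le> - N n} \<and> measure M {y\<in>space M. v y \<le> - N n} \<le> rt.H (N n / 2)"
      if "N n > 0" for n
      unfolding rt.H_def using that by (auto intro!: gm.finite_measure_mono)
    show ?thesis using big[OF F1 G1] big[OF F2 G2] by blast
  qed

  have split2: "\<exists>f g. f \<in> O(\<lambda>n. D (N n)) \<and> g \<in> o(r) \<and> (\<forall>n. d n = f n + g n)"
    if "d \<in> o(r)" for d r :: "nat \<Rightarrow> real"
    by (rule exI[of _ "\<lambda>_. 0"], rule exI[of _ d]) (use that in simp)
  have split3: "\<exists>f g h. f \<in> O(\<lambda>n. D (N n)) \<and> g \<in> O(r) \<and> h \<in> O(s) \<and> (\<forall>n. d n = f n + g n + h n)"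
    if "d \<in> O(s)" for d r s :: "nat \<Rightarrow> real"
    by (rule exI[of _ "\<lambda>_. 0"], rule exI[of _ "\<lambda>_. 0"], rule exI[of _ d]) (use that in simp)
  show ?thesis
    using lt2 eq2 by (intro conjI impI split2 split3) blast+
qed

end
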